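(* Let $A$ be a non-unital $\sigma$-unital $C^*$-algebra and let $E$ be a right $C^*$-$A$-module. The following are equivalent. \begin{enumerate} \item There is a finite subset $F\subseteq \operatorname{Mult}(A)$ such that, putting $A_b := C^*(F\cup A)\subseteq \operatorname{Mult}(A)$, the module $E$ is $A_b$-finite projective. \item The module $E$ is $\operatorname{Mult}(A)$-finite projective. \item The module $\operatorname{Mult}(E)$ is finitely generated and projective as a right $\operatorname{Mult}(A)$-module. \item The module $\operatorname{Mult}(E)$ is full as a left $C^*$-module over $\operatorname{End}_A(E)$. \end{enumerate}
   Context: $\operatorname{Mult}(A)$ is the multiplier algebra of $A$. A right $C^*$-$A$-module is a right Hilbert $A$-module, with inner product $(\cdot\,|\,\cdot)_A$. $\operatorname{End}_A(E)$ is the $C^*$-algebra of adjointable operators on $E$; for $e,f\in E$, $\Theta_{e,f}$ is the operator $g\mapsto e\cdot(f\,|\,g)_A$, and $\operatorname{End}^0_A(E)=\overline{\operatorname{span}}\{\Theta_{e,f}: e,f\in E\}$ is the ideal of compact endomorphisms. Unitisation: a unitisation of a nonunital $C^*$-algebra $A$ is an embedding of $A$ as an essential ideal of a unital $C^*$-algebra $A_b$. Finite projectivity: for a unitisation $A_b$ of $A$, an $A_b$-finite projective $A$-module is a right $A$-module isomorphic to $pA^n$ for some $n\in\mathbb{N}$ and some projection $p\in M_n(A_b)$ (isomorphism of right Hilbert $A$-modules, where $pA^n\subseteq A^n$ has inner product $(\xi\,|\,\eta)_A=\sum_i\xi_i^*\eta_i$). In particular, saying that $E$ is $A_b$-finite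 projective presupposes that $A_b$ is a unitisation of $A$ (so $A_b$ is unital). Multiplier module: the linking algebra of $E$ is $\mathcal{L}(E)=\operatorname{End}^0_A(E\oplus A)$. Let $r=\mathrm{Id}_E\oplus 0$ and $s=0\oplus 1_{\operatorname{Mult}(A)}$ in $\operatorname{Mult}(\mathcal{L}(E))$. Define $\operatorname{Mult}(E)=r\operatorname{Mult}(\mathcal{L}(E))s$, a right $C^*$-$\operatorname{Mult}(A)$-module with right action given by multiplication in $\operatorname{Mult}(\mathcal{L}(E))$ and inner product $(e\,|\,f)_{\operatorname{Mult}(A)}=e^*f$. Equivalently $\operatorname{Mult}(E)\cong\operatorname{Hom}_A(A,E)$, the space of adjointable operators from $A$ to $E$. It contains $E$. Left structure: for $e,f\in\operatorname{Mult}(E)$, the rank-one operator $\Theta_{e,f}: g\mapsto e\cdot (f\,|\,g)_{\operatorname{Mult}(A)}$ on $\operatorname{Mult}(E)$ leaves $E\subseteq\operatorname{Mult}(E)$ invariant and restricts to an element of $\operatorname{End}_A(E)$. $\operatorname{Mult}(E)$ is a left $C^*$-module over $\operatorname{End}_A(E)$ (acting by composition on $\operatorname{Hom}_A(A,E)$) with left inner product ${}_{\operatorname{End}_A(E)}(e\,|\,f)=\Theta_{e,f}|_E$. An inner product module over a $C^*$-algebra is full if the closed linear span of its inner products is the whole $C^*$-algebra. *)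

theory Defs
  imports "HOL-Analysis.Analysis" "HOL-Library.Function_Algebras"
begin

class complex_vector = ab_group_add +
  fixes scaleC :: "complex \<Rightarrow> 'a \<Rightarrow> 'a" (infixr \<open>*\<^sub>C\<close> 75)
  assumes scaleC_add_right: "c *\<^sub>C (x + y) = c *\<^sub>C x + c *\<^sub>C y"
    and scaleC_add_left: "(c + d) *\<^sub>C x = c *\<^sub>C x + d *\<^sub>C x"
    and scaleC_scaleC: "c *\<^sub>C (d *\<^sub>C x) = (c * d) *\<^sub>C x"
    and scaleC_one: "1 *\<^sub>C x = x"

global_interpretation cvec: vector_space "scaleC :: complex \<Rightarrow> 'x \<Rightarrow> 'x::complex_vector"
  by unfold_locales (simp_all add: scaleC_add_right scaleC_add_left scaleC_scaleC scaleC_one)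

instantiation prod :: (complex_vector, complex_vector) complex_vector
begin
definition "c *\<^sub>C p = (c *\<^sub>C fst p, c *\<^sub>C snd p)"
instance
  by standard (simp_all add: scaleC_prod_def scaleC_add_right scaleC_add_left
      scaleC_scaleC scaleC_one)
end

instantiation "fun" :: (type, complex_vector) complex_vector
begin
definition "c *\<^sub>C f = (\<lambda>x. c *\<^sub>C f x)"
instance
  by standard (simp_all add: scaleC_fun_def plus_fun_def scaleC_add_right scaleC_add_left
      scaleC_scaleC scaleC_one)
end

class cbanach = banach + complex_vector +
  assumes scaleR_scaleC: "r *\<^sub>R x = complex_of_real r *\<^sub>C x"
    and norm_scaleC: "norm (c *\<^sub>C x) = cmod c * norm x"

text \<open>A \<open>C\<^sup>*\<close>-algebra is a type of the following class; no unit is required.\<close>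

class cstar_algebra = cbanach + real_normed_algebra +
  fixes star :: "'a \<Rightarrow> 'a"
  assumes mult_scaleC_left: "(c *\<^sub>C x) * y = c *\<^sub>C (x * y)"
    and mult_scaleC_right: "x * (c *\<^sub>C y) = c *\<^sub>C (x * y)"
    and star_add: "star (x + y) = star x + star y"
    and star_scaleC: "star (c *\<^sub>C x) = cnj c *\<^sub>C star x"
    and star_mult: "star (x * y) = star y * star x"
    and star_star: "star (star x) = x"
    and cstar_identity: "norm (star x * x) = (norm x)\<^sup>2"

definition positive :: "'a::cstar_algebra \<Rightarrow> bool" where
  "positive a \<longleftrightarrow> (\<exists>b. a = star b * b)"

definition unital :: "'a::cstar_algebra itself \<Rightarrow> bool" where
  "unital _ \<longleftrightarrow> (\<exists>u::'a. \<forall>a. u * a = a \<and> a * u = a)"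

text \<open>Existence of a sequential (increasing, positive, contractive) approximate unit.\<close>

definition sigma_unital :: "'a::cstar_algebra itself \<Rightarrow> bool" where
  "sigma_unital _ \<longleftrightarrow> (\<exists>u :: nat \<Rightarrow> 'a.
     (\<forall>n. positive (u n) \<and> norm (u n) \<le> 1 \<and> positive (u (Suc n) - u n)) \<and>
     (\<forall>a. (\<lambda>n. u n * a) \<longlonglongrightarrow> a \<and> (\<lambda>n. a * u n) \<longlonglongrightarrow> a))"

text \<open>The vector space operations of a module are those of its ambient type. Operators on a
  module are functions on the ambient type which are \<open>0\<close> off the carrier, so that
  addition and composition of operators are those of functions. The coefficient algebra need not
  be a type: below, an algebra of operators is also regarded as a module over itself.\<close>

record ('b, 'x) hmod =
  hcarrier :: "'x set"
  hact :: "'x \<Rightarrow> 'b \<Rightarrow> 'x"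
  hip :: "'x \<Rightarrow> 'x \<Rightarrow> 'b"

text \<open>The module to which the theorem applies is a whole type; completeness is part of
  \<^class>\<open>cbanach\<close>.\<close>

locale hilbert_module =
  fixes E :: "('a::cstar_algebra, 'e::cbanach) hmod"
  assumes carrier: "hcarrier E = UNIV"
    and act_add_left: "hact E (x + y) a = hact E x a + hact E y a"
    and act_add_right: "hact E x (a + b) = hact E x a + hact E x b"
    and act_act: "hact E (hact E x a) b = hact E x (a * b)"
    and act_scaleC_left: "hact E (c *\<^sub>C x) a = c *\<^sub>C hact E x a"
    and act_scaleC_right: "hact E x (c *\<^sub>C a) = c *\<^sub>C hact E x a"
    and ip_add_right: "hip E x (y + z) = hip E x y + hip E x z"
    and ip_scaleC_right: "hip E x (c *\<^sub>C y) = c *\<^sub>C hip E x y"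
    and ip_act_right: "hip E x (hact E y a) = hip E x y * a"
    and ip_star: "star (hip E x y) = hip E y x"
    and ip_positive: "positive (hip E x x)"
    and norm_ip: "(norm x)\<^sup>2 = norm (hip E x x)"

definition is_adjoint ::
    "('b, 'x::zero) hmod \<Rightarrow> ('b, 'y::zero) hmod \<Rightarrow> ('x \<Rightarrow> 'y) \<Rightarrow> ('y \<Rightarrow> 'x) \<Rightarrow> bool" where
  "is_adjoint X Y T S \<longleftrightarrow>
     (\<forall>x\<in>hcarrier X. T x \<in> hcarrier Y) \<and> (\<forall>x. x \<notin> hcarrier X \<longrightarrow> T x = 0) \<and>
     (\<forall>y\<in>hcarrier Y. S y \<in> hcarrier X) \<and> (\<forall>y. y \<notin> hcarrier Y \<longrightarrow> S y = 0) \<and>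
     (\<forall>x\<in>hcarrier X. \<forall>y\<in>hcarrier Y. hip Y (T x) y = hip X x (S y))"

definition End :: "('b, 'x::zero) hmod \<Rightarrow> ('x \<Rightarrow> 'x) set" where
  "End X = {T. \<exists>S. is_adjoint X X T S}"

definition adj :: "('b, 'x::zero) hmod \<Rightarrow> ('x \<Rightarrow> 'x) \<Rightarrow> ('x \<Rightarrow> 'x)" where
  "adj X T = (THE S. is_adjoint X X T S)"

definition theta :: "('b, 'x::zero) hmod \<Rightarrow> 'x \<Rightarrow> 'x \<Rightarrow> 'x \<Rightarrow> 'x" where
  "theta X x y = (\<lambda>z. if z \<in> hcarrier X then hact X x (hip X y z) else 0)"

definition hnorm :: "('a::cstar_algebra, 'x) hmod \<Rightarrow> 'x \<Rightarrow> real" where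
  "hnorm X x = sqrt (norm (hip X x x))"

text \<open>The closure in \<open>End X\<close> for the operator norm; the inequality says that
  \<open>T - S\<close> has norm at most \<open>\<epsilon>\<close>.\<close>

definition op_closure ::
    "('a::cstar_algebra, 'x::complex_vector) hmod \<Rightarrow> ('x \<Rightarrow> 'x) set \<Rightarrow> ('x \<Rightarrow> 'x) set" where
  "op_closure X Z = {T \<in> End X. \<forall>\<epsilon>>0. \<exists>S\<in>Z. \<forall>x\<in>hcarrier X.
      hnorm X (T x - S x) \<le> \<epsilon> * hnorm X x}"

definition End0 :: "('a::cstar_algebra, 'x::complex_vector) hmod \<Rightarrow> ('x \<Rightarrow> 'x) set" where
  "End0 X = op_closure X (cvec.span {theta X x y | x y. x \<in> hcarrier X \<and> y \<in> hcarrier X})"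

definition hmod_iso :: "('b, 'x::complex_vector) hmod \<Rightarrow> ('b, 'y::complex_vector) hmod \<Rightarrow> bool" where
  "hmod_iso X Y \<longleftrightarrow> (\<exists>\<phi>. bij_betw \<phi> (hcarrier X) (hcarrier Y) \<and>
     (\<forall>x\<in>hcarrier X. \<forall>y\<in>hcarrier X. \<phi> (x + y) = \<phi> x + \<phi> y) \<and>
     (\<forall>c. \<forall>x\<in>hcarrier X. \<phi> (c *\<^sub>C x) = c *\<^sub>C \<phi> x) \<and>
     (\<forall>x\<in>hcarrier X. \<forall>b. \<phi> (hact X x b) = hact Y (\<phi> x) b) \<and>
     (\<forall>x\<in>hcarrier X. \<forall>y\<in>hcarrier X. hip Y (\<phi> x) (\<phi> y) = hip X x y))"

definition hmod_sum ::
    "('a::plus, 'x) hmod \<Rightarrow> ('a, 'y) hmod \<Rightarrow> ('a, 'x \<times> 'y) hmod" where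
  "hmod_sum X Y = \<lparr>hcarrier = hcarrier X \<times> hcarrier Y,
     hact = (\<lambda>(x, y) a. (hact X x a, hact Y y a)),
     hip = (\<lambda>(x, y) (x', y'). hip X x x' + hip Y y y')\<rparr>"

text \<open>\<open>alg_mod\<close> is \<open>A\<close> as a right Hilbert module over itself. The multiplier
  algebra of a \<open>C\<^sup>*\<close>-algebra \<open>B\<close> is taken to be the algebra of adjointable
  operators on the Hilbert \<open>B\<close>-module \<open>B\<close>, in which \<open>B\<close> sits by left
  multiplication.\<close>

definition alg_mod :: "('a::cstar_algebra, 'a) hmod" where
  "alg_mod = \<lparr>hcarrier = UNIV, hact = (*), hip = (\<lambda>a b. star a * b)\<rparr>"

definition Mult :: "('a::cstar_algebra \<Rightarrow> 'a) set" where
  "Mult = End alg_mod"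

definition alg_emb :: "'a::cstar_algebra \<Rightarrow> 'a \<Rightarrow> 'a" where
  "alg_emb a = (\<lambda>b. a * b)"

definition cstar_subalgebra :: "('a::cstar_algebra \<Rightarrow> 'a) set \<Rightarrow> bool" where
  "cstar_subalgebra B \<longleftrightarrow> B \<subseteq> Mult \<and> cvec.subspace B \<and>
     (\<forall>T\<in>B. \<forall>S\<in>B. T \<circ> S \<in> B) \<and> (\<forall>T\<in>B. adj alg_mod T \<in> B) \<and> op_closure alg_mod B = B"

definition cstar_generated :: "('a::cstar_algebra \<Rightarrow> 'a) set \<Rightarrow> ('a \<Rightarrow> 'a) set" where
  "cstar_generated S = \<Inter>{B. cstar_subalgebra B \<and> S \<subseteq> B}"

definition closed_ideal :: "('a::cstar_algebra \<Rightarrow> 'a) set \<Rightarrow> ('a \<Rightarrow> 'a) set \<Rightarrow> bool" where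
  "closed_ideal B J \<longleftrightarrow> J \<subseteq> B \<and> cvec.subspace J \<and>
     (\<forall>T\<in>B. \<forall>S\<in>J. T \<circ> S \<in> J \<and> S \<circ> T \<in> J) \<and> op_closure alg_mod J = J"

text \<open>Unitisations inside the multiplier algebra, which are the only ones that occur here.\<close>

definition unitisation :: "('a::cstar_algebra \<Rightarrow> 'a) set \<Rightarrow> bool" where
  "unitisation B \<longleftrightarrow> cstar_subalgebra B \<and> (\<exists>u\<in>B. \<forall>T\<in>B. u \<circ> T = T \<and> T \<circ> u = T) \<and>
     closed_ideal B (range alg_emb) \<and>
     (\<forall>J. closed_ideal B J \<and> J \<noteq> {0} \<longrightarrow> J \<inter> range alg_emb \<noteq> {0})"

text \<open>Vectors in \<open>A\<^sup>n\<close> are sequences vanishing from index \<open>n\<close> on; of an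
  \<open>n\<close> by \<open>n\<close> matrix only the entries with both indices below \<open>n\<close> matter.\<close>

definition vecs :: "nat \<Rightarrow> (nat \<Rightarrow> 'a::zero) set" where
  "vecs n = {\<xi>. \<forall>i\<ge>n. \<xi> i = 0}"

definition mat_app :: "nat \<Rightarrow> (nat \<Rightarrow> nat \<Rightarrow> 'a \<Rightarrow> 'a) \<Rightarrow> (nat \<Rightarrow> 'a::comm_monoid_add) \<Rightarrow> nat \<Rightarrow> 'a" where
  "mat_app n p \<xi> = (\<lambda>i. if i < n then \<Sum>j<n. p i j (\<xi> j) else 0)"

definition mat_projection ::
    "('a::cstar_algebra \<Rightarrow> 'a) set \<Rightarrow> nat \<Rightarrow> (nat \<Rightarrow> nat \<Rightarrow> 'a \<Rightarrow> 'a) \<Rightarrow> bool" where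
  "mat_projection B n p \<longleftrightarrow> (\<forall>i<n. \<forall>j<n. p i j \<in> B \<and> adj alg_mod (p j i) = p i j \<and>
     (\<Sum>k<n. p i k \<circ> p k j) = p i j)"

definition proj_mod ::
    "nat \<Rightarrow> (nat \<Rightarrow> nat \<Rightarrow> 'a::cstar_algebra \<Rightarrow> 'a) \<Rightarrow> ('a, nat \<Rightarrow> 'a) hmod" where
  "proj_mod n p = \<lparr>hcarrier = mat_app n p ` vecs n,
     hact = (\<lambda>\<xi> a i. \<xi> i * a),
     hip = (\<lambda>\<xi> \<eta>. \<Sum>i<n. star (\<xi> i) * \<eta> i)\<rparr>"

definition finite_projective ::
    "('a::cstar_algebra \<Rightarrow> 'a) set \<Rightarrow> ('a, 'e::cbanach) hmod \<Rightarrow> bool" where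
  "finite_projective B E \<longleftrightarrow> unitisation B \<and>
     (\<exists>n p. mat_projection B n p \<and> hmod_iso E (proj_mod n p))"

text \<open>\<open>link_mod E\<close> is the linking algebra \<open>End0 (E \<oplus> A)\<close> as a Hilbert module over
  itself.\<close>

abbreviation EA :: "('a::cstar_algebra, 'e) hmod \<Rightarrow> ('a, 'e \<times> 'a) hmod" where
  "EA E \<equiv> hmod_sum E alg_mod"

definition link_mod :: "('a::cstar_algebra, 'e::cbanach) hmod \<Rightarrow>
    ('e \<times> 'a \<Rightarrow> 'e \<times> 'a, 'e \<times> 'a \<Rightarrow> 'e \<times> 'a) hmod" where
  "link_mod E = \<lparr>hcarrier = End0 (EA E), hact = (\<lambda>T S. T \<circ> S), hip = (\<lambda>T S. adj (EA E) T \<circ> S)\<rparr>"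

type_synonym ('a, 'e) linkmult = "('e \<times> 'a \<Rightarrow> 'e \<times> 'a) \<Rightarrow> ('e \<times> 'a \<Rightarrow> 'e \<times> 'a)"

definition Mult_link :: "('a::cstar_algebra, 'e::cbanach) hmod \<Rightarrow> ('a, 'e) linkmult set" where
  "Mult_link E = End (link_mod E)"

text \<open>An adjointable operator on \<open>E \<oplus> A\<close> acts on the linking algebra by left
  multiplication.\<close>

definition lmul :: "('a::cstar_algebra, 'e::cbanach) hmod \<Rightarrow>
    ('e \<times> 'a \<Rightarrow> 'e \<times> 'a) \<Rightarrow> ('a, 'e) linkmult" where
  "lmul E T = (\<lambda>k. if k \<in> End0 (EA E) then T \<circ> k else 0)"

definition link_r :: "('a::cstar_algebra, 'e::cbanach) hmod \<Rightarrow> ('a, 'e) linkmult" where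
  "link_r E = lmul E (\<lambda>(x, a). (x, 0))"

definition link_s :: "('a::cstar_algebra, 'e::cbanach) hmod \<Rightarrow> ('a, 'e) linkmult" where
  "link_s E = lmul E (\<lambda>(x, a). (0, a))"

text \<open>The inclusions of \<open>Mult A\<close> (as the lower right corner) and of \<open>E\<close> (as the
  upper right corner of the linking algebra) in the multiplier algebra of the linking algebra.\<close>

definition Mult_emb :: "('a::cstar_algebra, 'e::cbanach) hmod \<Rightarrow> ('a \<Rightarrow> 'a) \<Rightarrow> ('a, 'e) linkmult" where
  "Mult_emb E m = lmul E (\<lambda>(x, a). (0, m a))"

definition mod_emb :: "('a::cstar_algebra, 'e::cbanach) hmod \<Rightarrow> 'e \<Rightarrow> ('a, 'e) linkmult" where
  "mod_emb E e = lmul E (\<lambda>(x, a). (hact E e a, 0))"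

definition Mult_mod :: "('a::cstar_algebra, 'e::cbanach) hmod \<Rightarrow>
    ('a \<Rightarrow> 'a, ('a, 'e) linkmult) hmod" where
  "Mult_mod E = \<lparr>hcarrier = {link_r E \<circ> T \<circ> link_s E | T. T \<in> Mult_link E},
     hact = (\<lambda>e m. e \<circ> Mult_emb E m),
     hip = (\<lambda>e f. THE m. m \<in> Mult \<and> Mult_emb E m = adj (link_mod E) e \<circ> f)\<rparr>"

text \<open>The restriction to \<open>E\<close> of the rank one operator on \<open>Mult E\<close> given by
  \<open>e\<close> and \<open>f\<close>.\<close>

definition left_ip :: "('a::cstar_algebra, 'e::cbanach) hmod \<Rightarrow>
    ('a, 'e) linkmult \<Rightarrow> ('a, 'e) linkmult \<Rightarrow> 'e \<Rightarrow> 'e" where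
  "left_ip E e f = (THE T. T \<in> End E \<and>
     (\<forall>x\<in>hcarrier E. mod_emb E (T x) = theta (Mult_mod E) e f (mod_emb E x)))"

definition left_full :: "('a::cstar_algebra, 'e::cbanach) hmod \<Rightarrow> bool" where
  "left_full E \<longleftrightarrow> op_closure E (cvec.span {left_ip E e f | e f.
     e \<in> hcarrier (Mult_mod E) \<and> f \<in> hcarrier (Mult_mod E)}) = End E"

text \<open>\<open>R\<close> is a unital ring, with addition that of the ambient type and multiplication
  \<open>mul\<close>; \<open>M\<close> is a right module over \<open>R\<close> with action \<open>act\<close>.\<close>

definition finitely_generated :: "'r set \<Rightarrow> 'm::comm_monoid_add set \<Rightarrow> ('m \<Rightarrow> 'r \<Rightarrow> 'm) \<Rightarrow> bool" where
  "finitely_generated R M act \<longleftrightarrow> (\<exists>G. finite G \<and> G \<subseteq> M \<and>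
     (\<forall>x\<in>M. \<exists>c. (\<forall>g\<in>G. c g \<in> R) \<and> x = (\<Sum>g\<in>G. act g (c g))))"

definition free_rmod :: "'r::zero set \<Rightarrow> 'i set \<Rightarrow> ('i \<Rightarrow> 'r) set" where
  "free_rmod R I = {c. (\<forall>i\<in>I. c i \<in> R) \<and> (\<forall>i. i \<notin> I \<longrightarrow> c i = 0) \<and> finite {i. c i \<noteq> 0}}"

definition rsubmodule :: "'r set \<Rightarrow> ('m::ab_group_add \<Rightarrow> 'r \<Rightarrow> 'm) \<Rightarrow> 'm set \<Rightarrow> bool" where
  "rsubmodule R act N \<longleftrightarrow> 0 \<in> N \<and> (\<forall>x\<in>N. \<forall>y\<in>N. x - y \<in> N) \<and> (\<forall>x\<in>N. \<forall>r\<in>R. act x r \<in> N)"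

definition rmod_iso :: "'r set \<Rightarrow> 'm::plus set \<Rightarrow> ('m \<Rightarrow> 'r \<Rightarrow> 'm) \<Rightarrow>
    'n::plus set \<Rightarrow> ('n \<Rightarrow> 'r \<Rightarrow> 'n) \<Rightarrow> bool" where
  "rmod_iso R M act N act' \<longleftrightarrow> (\<exists>\<phi>. bij_betw \<phi> M N \<and>
     (\<forall>x\<in>M. \<forall>y\<in>M. \<phi> (x + y) = \<phi> x + \<phi> y) \<and> (\<forall>x\<in>M. \<forall>r\<in>R. \<phi> (act x r) = act' (\<phi> x) r))"

text \<open>Projective: isomorphic to a direct summand of a free module. Taking the basis \<open>I\<close> in the
  type of \<open>M\<close> is no restriction, because a projective module is a direct summand of the free
  module on its own underlying set.\<close>

definition projective :: "'r::ab_group_add set \<Rightarrow> ('r \<Rightarrow> 'r \<Rightarrow> 'r) \<Rightarrow>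
    'm::plus set \<Rightarrow> ('m \<Rightarrow> 'r \<Rightarrow> 'm) \<Rightarrow> bool" where
  "projective R mul M act \<longleftrightarrow> (\<exists>(I :: 'm set) P Q.
     let F = free_rmod R I; fact = (\<lambda>c r i. mul (c i) r) in
       P \<subseteq> F \<and> Q \<subseteq> F \<and> rsubmodule R fact P \<and> rsubmodule R fact Q \<and>
       P \<inter> Q = {0} \<and> (\<forall>c\<in>F. \<exists>p\<in>P. \<exists>q\<in>Q. c = p + q) \<and>
       rmod_iso R M act P fact)"

end

theory Submission
  imports Defs
begin

text \<open>Write \<open>Hom(A,E)\<close> for the adjointable maps from \<open>A\<close> to \<open>E\<close>. Each of the four conditions is
  equivalent to the existence of a finite \<^emph>\<open>Parseval frame\<close>: maps \<open>g\<^sub>1, \<dots>, g\<^sub>n\<close> in \<open>Hom(A,E)\<close> with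
  \<open>\<Sum> g\<^sub>i g\<^sub>i\<^sup>* = 1\<close> on \<open>E\<close>.

  A frame amounts to an isometric embedding \<open>x \<mapsto> (g\<^sub>i\<^sup>* x)\<^sub>i\<close> of \<open>E\<close> in \<open>A\<^sup>n\<close>, with range \<open>pA\<^sup>n\<close> for the
  projection with entries \<open>p\<^sub>i\<^sub>j = g\<^sub>i\<^sup>* g\<^sub>j\<close> in \<open>Mult(A)\<close>. This is finite projectivity over \<open>Mult(A)\<close>. Only
  finitely many entries occur, so the \<open>C\<^sup>*\<close>-algebra generated by them, the identity and \<open>A\<close> serves
  as well as \<open>Mult(A)\<close> (lemmas \<open>frame_iff_finite_projective\<close> and
  \<open>frame_iff_finite_projective_generated\<close>).

  The linking algebra has \<open>Mult(E) = Hom(A,E)\<close>, with inner product \<open>t\<^sup>* t'\<close> and left inner product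
  \<open>t t'\<^sup>*\<close> (lemmas \<open>Mult_mod_carrier\<close>, \<open>Mult_mod_ip\<close>, \<open>left_ip_eq\<close>). A frame therefore gives
  \<open>t = \<Sum> g\<^sub>i (g\<^sub>i\<^sup>* t)\<close> for \<open>t\<close> in \<open>Mult(E)\<close>, hence finite generation and projectivity, and
  \<open>T = \<Sum> (T g\<^sub>i) g\<^sub>i\<^sup>*\<close> for \<open>T\<close> in \<open>End(E)\<close>, hence fullness.

  Conversely, it is enough to find maps with \<open>d \<parallel>x\<parallel> \<le> \<Sum> \<parallel>g\<^sub>i\<^sup>* x\<parallel>\<close> for some \<open>d > 0\<close>, because then the
  frame operator \<open>S = \<Sum> g\<^sub>i g\<^sub>i\<^sup>*\<close> is positive and invertible and the maps \<open>S\<^sup>-\<^sup>1\<^sup>/\<^sup>2 g\<^sub>i\<close> form a Parseval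
  frame (lemma \<open>parseval_of_bounded_below\<close>). If the left inner products span a dense subspace, some
  \<open>\<Sum> t\<^sub>i g\<^sub>i\<^sup>*\<close> is within \<open>1/2\<close> of the identity, which gives such a bound. If finitely many \<open>g\<^sub>i\<close>
  generate \<open>Mult(E)\<close>, the bound follows from the uniform boundedness principle (lemma
  \<open>bounded_below_of_generating\<close>).

  The square root of \<open>S\<close>, and the comparison of norms in \<open>E \<oplus> A\<close>, rest on the theorem that \<open>b\<^sup>* b\<close> is
  positive. The first two sections prove it by the binomial series, without spectral theory.\<close>

section \<open>Square roots by the binomial series\<close>

text \<open>The coefficients of the power series of \<open>sqrt (1 - x)\<close>.\<close>

definition sqrt_coeff :: "nat \<Rightarrow> real" where
  "sqrt_coeff k = (- 1) ^ k * ((1 / 2) gchoose k)"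

lemma sqrt_coeff_Suc: "sqrt_coeff (Suc k) = sqrt_coeff k * ((real k - 1 / 2) / real (Suc k))"
proof -
  have "((1 / 2 :: real) gchoose Suc k) * real (Suc k) = ((1 / 2) gchoose k) * (1 / 2 - real k)"
    using gbinomial_mult_1'[of "1 / 2 :: real" k] by (simp add: algebra_simps)
  then have "((1 / 2 :: real) gchoose Suc k) = ((1 / 2) gchoose k) * (1 / 2 - real k) / real (Suc k)"
    by (simp add: field_simps)
  then have *: "((1 / 2 :: real) gchoose Suc k) = ((1 / 2) gchoose k) * ((1 / 2 - real k) / real (Suc k))"
    by simp
  have "(real k - 1 / 2) / real (Suc k) = - ((1 / 2 - real k) / real (Suc k))"
    by (simp add: minus_divide_left)
  then show ?thesis
    unfolding sqrt_coeff_def * power_Suc by simp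
qed

lemma sqrt_coeff_0: "sqrt_coeff 0 = 1"
  by (simp add: sqrt_coeff_def)

lemma sqrt_coeff_nonpos: "sqrt_coeff (Suc k) \<le> 0"
proof (induction k)
  case 0
  then show ?case by (simp add: sqrt_coeff_Suc sqrt_coeff_0)
next
  case (Suc k)
  have "0 \<le> (real (Suc k) - 1 / 2) / real (Suc (Suc k))" by simp
  with Suc show ?case
    unfolding sqrt_coeff_Suc[of "Suc k"] by (rule mult_nonpos_nonneg)
qed

text \<open>The partial sums at \<open>x = 1\<close> are \<open>(-1)\<^sup>n\<close> times the binomial coefficient of \<open>-1/2\<close> over \<open>n\<close>. As all
  coefficients but the first are at most \<open>0\<close>, this bounds their absolute values in sum, so the
  series converges on the closed unit ball. The boundary is needed: if \<open>h\<close> is self-adjoint of norm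
  at most \<open>1\<close>, then \<open>1 - h\<^sup>2\<close> may have norm \<open>1\<close>.\<close>

lemma sum_sqrt_coeff_nonneg: "0 \<le> (\<Sum>k\<le>n. sqrt_coeff k)"
proof -
  have pos: "0 \<le> (- 1) ^ m * ((- 1 / 2 :: real) gchoose m)" for m
  proof (induction m)
    case (Suc m)
    have "((- 1 / 2 :: real) gchoose Suc m) * real (Suc m) = ((- 1 / 2) gchoose m) * (- 1 / 2 - real m)"
      using gbinomial_mult_1'[of "- 1 / 2 :: real" m] by (simp add: algebra_simps)
    then have "((- 1 / 2 :: real) gchoose Suc m) = ((- 1 / 2) gchoose m) * (- 1 / 2 - real m) / real (Suc m)"
      by (simp add: field_simps)
    then have *: "((- 1 / 2 :: real) gchoose Suc m) = ((- 1 / 2) gchoose m) * ((- 1 / 2 - real m) / real (Suc m))"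
      by simp
    have "(- 1 / 2 - real m) / real (Suc m) = - ((1 / 2 + real m) / real (Suc m))"
      unfolding minus_divide_left by (rule arg_cong[where f = "\<lambda>x. x / real (Suc m)"]) simp
    then have "(- 1) ^ Suc m * ((- 1 / 2 :: real) gchoose Suc m)
        = ((- 1) ^ m * ((- 1 / 2) gchoose m)) * ((1 / 2 + real m) / real (Suc m))"
      unfolding * power_Suc by (simp only: mult_minus_left mult_minus_right mult_1 minus_minus mult.assoc)
    also have "0 \<le> \<dots>"
      by (intro mult_nonneg_nonneg Suc) simp
    finally show ?case .
  qed simp
  have "(\<Sum>k\<le>n. sqrt_coeff k) = (- 1) ^ n * ((1 / 2 - 1 :: real) gchoose n)"
    unfolding sqrt_coeff_def gbinomial_sum_lower_neg[symmetric] by (simp add: mult.commute)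
  with pos[of n] show ?thesis by simp
qed

lemma sum_abs_sqrt_coeff: "(\<Sum>k<n. \<bar>sqrt_coeff (Suc k)\<bar>) \<le> 1"
proof -
  have "(\<Sum>k<n. \<bar>sqrt_coeff (Suc k)\<bar>) = - (\<Sum>k<n. sqrt_coeff (Suc k))"
    using sqrt_coeff_nonpos by (simp add: sum_negf abs_of_nonpos)
  also have "\<dots> = 1 - (\<Sum>k\<le>n. sqrt_coeff k)"
    by (simp add: lessThan_Suc_atMost[symmetric] sum.lessThan_Suc_shift sqrt_coeff_0 del: sum.lessThan_Suc)
  also have "\<dots> \<le> 1" using sum_sqrt_coeff_nonneg[of n] by simp
  finally show ?thesis .
qed

lemma summable_abs_sqrt_coeff: "summable (\<lambda>k. \<bar>sqrt_coeff k\<bar>)"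
proof -
  have "summable (\<lambda>k. \<bar>sqrt_coeff (Suc k)\<bar>)"
    by (rule summableI_nonneg_bounded[where x = 1]) (use sum_abs_sqrt_coeff in auto)
  then show ?thesis by (subst (asm) summable_Suc_iff)
qed

text \<open>Vandermonde's identity for \<open>1/2 + 1/2 = 1\<close>.\<close>

lemma sqrt_coeff_convolution:
  "(\<Sum>i\<le>n. sqrt_coeff i * sqrt_coeff (n - i)) = (if n = 0 then 1 else if n = 1 then - 1 else 0)"
proof -
  have "(\<Sum>i\<le>n. sqrt_coeff i * sqrt_coeff (n - i))
      = (- 1) ^ n * (\<Sum>i=0..n. ((1 / 2 :: real) gchoose i) * ((1 / 2) gchoose (n - i)))"
    unfolding sum_distrib_left atMost_atLeast0
  proof (rule sum.cong)
    fix i assume "i \<in> {0..n}"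
    then have "(- 1 :: real) ^ n = (- 1) ^ i * (- 1) ^ (n - i)"
      by (simp add: power_add[symmetric])
    then show "sqrt_coeff i * sqrt_coeff (n - i)
        = (- 1) ^ n * (((1 / 2 :: real) gchoose i) * ((1 / 2) gchoose (n - i)))"
      by (simp add: sqrt_coeff_def algebra_simps)
  qed simp
  also have "\<dots> = (- 1) ^ n * (1 gchoose n)"
    by (subst gbinomial_Vandermonde) simp
  also have "(1 gchoose n) = (of_nat (1 choose n) :: real)"
    by (metis binomial_gbinomial of_nat_1)
  also have "(- 1) ^ n * real (1 choose n) = (if n = 0 then 1 else if n = 1 then - 1 else 0)"
    by (auto simp: binomial_eq_0)
  finally show ?thesis .
qed

lemma norm_power_le_one:
  fixes x :: "'b::{real_normed_algebra, monoid_mult}"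
  assumes "norm x \<le> 1" "norm (1 :: 'b) \<le> 1"
  shows "norm (x ^ n) \<le> 1"
proof (induction n)
  case (Suc n)
  have "norm (x * x ^ n) \<le> norm x * norm (x ^ n)" by (rule norm_mult_ineq)
  also have "\<dots> \<le> 1" using Suc assms by (simp add: mult_le_one)
  finally show ?case by simp
qed (use assms in simp)

definition sqrt1m :: "'b::{real_normed_algebra, monoid_mult} \<Rightarrow> 'b" where
  "sqrt1m x = (\<Sum>k. sqrt_coeff k *\<^sub>R x ^ k)"

lemma summable_norm_sqrt1m:
  fixes x :: "'b::{banach, real_normed_algebra, monoid_mult}"
  assumes "norm x \<le> 1" "norm (1 :: 'b) \<le> 1"
  shows "summable (\<lambda>k. norm (sqrt_coeff k *\<^sub>R x ^ k))"
proof (rule summable_comparison_test[OF _ summable_abs_sqrt_coeff], intro exI allI impI)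
  fix k
  have "\<bar>sqrt_coeff k\<bar> * norm (x ^ k) \<le> \<bar>sqrt_coeff k\<bar> * 1"
    by (intro mult_left_mono norm_power_le_one assms) simp
  then show "norm (norm (sqrt_coeff k *\<^sub>R x ^ k)) \<le> \<bar>sqrt_coeff k\<bar>" by simp
qed

lemma sqrt1m_sums:
  fixes x :: "'b::{banach, real_normed_algebra, monoid_mult}"
  assumes "norm x \<le> 1" "norm (1 :: 'b) \<le> 1"
  shows "(\<lambda>k. sqrt_coeff k *\<^sub>R x ^ k) sums sqrt1m x"
  unfolding sqrt1m_def
  by (rule summable_sums, rule summable_norm_cancel, rule summable_norm_sqrt1m[OF assms])

lemma sqrt1m_square:
  fixes x :: "'b::{banach, real_normed_algebra, monoid_mult}"
  assumes "norm x \<le> 1" "norm (1 :: 'b) \<le> 1"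
  shows "sqrt1m x * sqrt1m x = 1 - x"
proof -
  let ?a = "\<lambda>k. sqrt_coeff k *\<^sub>R x ^ k"
  have cauchy: "(\<lambda>k. \<Sum>i\<le>k. ?a i * ?a (k - i)) sums (sqrt1m x * sqrt1m x)"
    unfolding sqrt1m_def by (intro Cauchy_product_sums summable_norm_sqrt1m assms)
  have coeff: "(\<Sum>i\<le>k. ?a i * ?a (k - i)) = (if k = 0 then 1 else if k = 1 then - 1 else 0) *\<^sub>R x ^ k" for k
  proof -
    have "(\<Sum>i\<le>k. ?a i * ?a (k - i)) = (\<Sum>i\<le>k. (sqrt_coeff i * sqrt_coeff (k - i)) *\<^sub>R x ^ k)"
      by (rule sum.cong) (auto simp: power_add[symmetric])
    then show ?thesis by (simp add: scaleR_left.sum[symmetric] sqrt_coeff_convolution)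
  qed
  have fin: "(\<lambda>k. (if k = 0 then 1 else if k = 1 then - 1 else 0) *\<^sub>R x ^ k) sums (1 - x)"
  proof -
    have "(\<lambda>k. (if k = 0 then 1 else if k = 1 then - 1 else (0::real)) *\<^sub>R x ^ k) sums
        (\<Sum>k\<in>{0, 1::nat}. (if k = 0 then 1 else if k = 1 then - 1 else (0::real)) *\<^sub>R x ^ k)"
      by (rule sums_finite) auto
    then show ?thesis by simp
  qed
  show ?thesis using cauchy unfolding coeff by (rule sums_unique2[OF _ fin])
qed

lemma norm_one_minus_sqrt1m:
  fixes x :: "'b::{banach, real_normed_algebra, monoid_mult}"
  assumes "norm x \<le> 1" "norm (1 :: 'b) \<le> 1"
  shows "norm (1 - sqrt1m x) \<le> 1"
proof -
  let ?a = "\<lambda>k. sqrt_coeff k *\<^sub>R x ^ k"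
  have s: "(\<lambda>k. ?a (Suc k)) sums (sqrt1m x - 1)"
    using sqrt1m_sums[OF assms] by (subst sums_Suc_iff) (simp add: sqrt_coeff_0)
  have "norm (\<Sum>k<n. ?a (Suc k)) \<le> 1" for n
  proof -
    have "norm (\<Sum>k<n. ?a (Suc k)) \<le> (\<Sum>k<n. norm (?a (Suc k)))" by (rule norm_sum)
    also have "\<dots> \<le> (\<Sum>k<n. \<bar>sqrt_coeff (Suc k)\<bar> * 1)"
      unfolding norm_scaleR by (intro sum_mono mult_left_mono norm_power_le_one assms) simp
    also have "\<dots> \<le> 1" using sum_abs_sqrt_coeff by simp
    finally show ?thesis .
  qed
  then have "norm (sqrt1m x - 1) \<le> 1"
    using s unfolding sums_def
    by (intro tendsto_upperbound[OF tendsto_norm]) (auto intro!: always_eventually)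
  then show ?thesis by (simp add: norm_minus_commute)
qed

lemma sqrt1m_commute:
  fixes x :: "'b::{banach, real_normed_algebra, monoid_mult}"
  assumes x: "norm x \<le> 1" "norm (1 :: 'b) \<le> 1" and comm: "y * x = x * y"
  shows "y * sqrt1m x = sqrt1m x * y"
proof -
  have p: "y * x ^ k = x ^ k * y" for k
    by (induction k) (simp_all add: mult.assoc[symmetric] comm, simp add: mult.assoc)
  have "(\<lambda>k. y * (sqrt_coeff k *\<^sub>R x ^ k)) sums (y * sqrt1m x)"
    "(\<lambda>k. (sqrt_coeff k *\<^sub>R x ^ k) * y) sums (sqrt1m x * y)"
    by (intro sums_mult sums_mult2 sqrt1m_sums x)+
  then show ?thesis by (simp add: p) (rule sums_unique2)
qed

text \<open>The series is kept in the conclusion because it shows that the inverse stays in a closed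
  subalgebra.\<close>

lemma neumann_inverse:
  fixes y :: "'b::{banach, real_normed_algebra, monoid_mult}"
  assumes y: "norm y < 1" and one: "norm (1 :: 'b) \<le> 1"
  shows "\<exists>w. (\<lambda>k. y ^ k) sums w \<and> w * (1 - y) = 1 \<and> (1 - y) * w = 1"
proof -
  have n: "norm (y ^ k) \<le> norm y ^ k" for k
  proof (induction k)
    case (Suc k)
    have "norm (y * y ^ k) \<le> norm y * norm (y ^ k)" by (rule norm_mult_ineq)
    also have "\<dots> \<le> norm y * norm y ^ k" by (intro mult_left_mono Suc) simp
    finally show ?case by simp
  qed (use one in simp)
  have "summable (\<lambda>k. y ^ k)"
    by (rule summable_comparison_test[OF _ summable_geometric[of "norm y"]]) (use n y in auto)
  then have s: "(\<lambda>k. y ^ k) sums (\<Sum>k. y ^ k)" by (rule summable_sums)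
  let ?w = "\<Sum>k. y ^ k"
  have "(\<lambda>k. y ^ Suc k) sums (?w - 1)"
    using s by (subst sums_Suc_iff) simp
  moreover have "(\<lambda>k. y ^ Suc k) sums (y * ?w)" using sums_mult[OF s, of y] by simp
  moreover have "(\<lambda>k. y ^ Suc k) sums (?w * y)" using sums_mult2[OF s, of y] by (simp add: power_commutes)
  ultimately have "y * ?w = ?w - 1" "?w * y = ?w - 1" by (metis sums_unique2)+
  then show ?thesis using s by (intro exI[of _ ?w]) (simp add: algebra_simps)
qed

section \<open>Positivity in a unital \<open>C\<^sup>*\<close>-algebra\<close>

text \<open>A unital \<open>C\<^sup>*\<close>-algebra inside a real Banach algebra. A set rather than a type is used because the
  algebra of adjointable operators depends on the module. The element \<open>J\<close> is multiplication by the
  imaginary unit. The unit may have norm \<open>0\<close>, which covers operators on the zero module.\<close>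

locale unital_cstar =
  fixes B :: "'b::{banach, real_normed_algebra, monoid_mult} set"
    and st :: "'b \<Rightarrow> 'b"
    and J :: 'b
  assumes closed_B: "closed B"
    and B_one: "1 \<in> B"
    and B_J: "J \<in> B"
    and B_add: "x \<in> B \<Longrightarrow> y \<in> B \<Longrightarrow> x + y \<in> B"
    and B_scaleR: "x \<in> B \<Longrightarrow> r *\<^sub>R x \<in> B"
    and B_mult: "x \<in> B \<Longrightarrow> y \<in> B \<Longrightarrow> x * y \<in> B"
    and B_st: "x \<in> B \<Longrightarrow> st x \<in> B"
    and st_add: "x \<in> B \<Longrightarrow> y \<in> B \<Longrightarrow> st (x + y) = st x + st y"
    and st_scaleR: "x \<in> B \<Longrightarrow> st (r *\<^sub>R x) = r *\<^sub>R st x"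
    and st_mult: "x \<in> B \<Longrightarrow> y \<in> B \<Longrightarrow> st (x * y) = st y * st x"
    and st_st: "x \<in> B \<Longrightarrow> st (st x) = x"
    and J_J: "J * J = - 1"
    and J_commute: "x \<in> B \<Longrightarrow> J * x = x * J"
    and st_J: "st J = - J"
    and cstar: "x \<in> B \<Longrightarrow> norm (st x * x) = (norm x)\<^sup>2"
    and norm_one_le: "norm (1 :: 'b) \<le> 1"
begin

lemma B_minus: "x \<in> B \<Longrightarrow> - x \<in> B"
  using B_scaleR[of x "- 1"] by simp

lemma B_diff: "x \<in> B \<Longrightarrow> y \<in> B \<Longrightarrow> x - y \<in> B"
  using B_add[OF _ B_minus, of x y] by simp

lemma B_zero: "0 \<in> B"
  using B_scaleR[OF B_one, of 0] by simp

lemma B_power: "x \<in> B \<Longrightarrow> x ^ n \<in> B"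
  by (induction n) (auto intro: B_one B_mult)

lemma B_sum: "(\<And>i. i \<in> I \<Longrightarrow> f i \<in> B) \<Longrightarrow> (\<Sum>i\<in>I. f i) \<in> B"
  by (induction I rule: infinite_finite_induct) (auto intro: B_zero B_add)

lemmas B_closed = B_one B_J B_add B_scaleR B_mult B_st B_minus B_diff B_zero B_power

lemma B_sums: "(\<And>k. f k \<in> B) \<Longrightarrow> f sums s \<Longrightarrow> s \<in> B"
  unfolding sums_def by (rule closed_sequentially[OF closed_B _, of "\<lambda>n. sum f {..<n}"]) (auto intro: B_sum)

lemma st_minus: "x \<in> B \<Longrightarrow> st (- x) = - st x"
  using st_scaleR[of x "- 1"] by simp

lemma st_diff: "x \<in> B \<Longrightarrow> y \<in> B \<Longrightarrow> st (x - y) = st x - st y"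
  using st_add[OF _ B_minus, of x y] by (simp add: st_minus)

lemma st_zero: "st 0 = 0"
  using st_scaleR[OF B_one, of 0] by simp

lemma st_one: "st 1 = 1"
proof -
  have "st 1 * 1 = st (st 1 * 1)" using st_mult[OF B_st[OF B_one] B_one] by (simp add: st_st B_one)
  then show ?thesis by (simp add: st_st B_one)
qed

lemma st_power: "x \<in> B \<Longrightarrow> st (x ^ n) = st x ^ n"
  by (induction n) (auto simp: st_one st_mult B_power power_commutes)

lemma st_sum: "(\<And>i. i \<in> I \<Longrightarrow> f i \<in> B) \<Longrightarrow> st (\<Sum>i\<in>I. f i) = (\<Sum>i\<in>I. st (f i))"
  by (induction I rule: infinite_finite_induct) (auto simp: st_zero st_add B_sum)

lemma norm_le_norm_st: assumes "x \<in> B" shows "norm x \<le> norm (st x)"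
proof (cases "x = 0")
  case False
  have "norm x * norm x \<le> norm (st x) * norm x"
    using cstar[OF assms] norm_mult_ineq[of "st x" x] by (simp add: power2_eq_square)
  with False show ?thesis by simp
qed simp

lemma norm_st: "x \<in> B \<Longrightarrow> norm (st x) = norm x"
  using norm_le_norm_st[of x] norm_le_norm_st[of "st x"] by (simp add: st_st B_st)

lemma st_sums:
  assumes "\<And>k. f k \<in> B" "f sums s"
  shows "(\<lambda>k. st (f k)) sums st s"
proof -
  have s: "s \<in> B" by (rule B_sums[OF assms])
  have eq: "norm ((\<Sum>k<n. st (f k)) - st s) = norm ((\<Sum>k<n. f k) - s)" for n
    using assms(1) s by (simp add: st_sum[symmetric] st_diff[symmetric] B_sum norm_st B_diff)
  have "(\<lambda>n. norm ((\<Sum>k<n. f k) - s)) \<longlonglongrightarrow> 0"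
    using assms(2) unfolding sums_def by (subst (asm) LIM_zero_iff[symmetric]) (rule tendsto_norm_zero)
  then have "(\<lambda>n. (\<Sum>k<n. st (f k)) - st s) \<longlonglongrightarrow> 0"
    unfolding eq[symmetric] by (rule tendsto_norm_zero_cancel)
  then show ?thesis unfolding sums_def by (rule LIM_zero_cancel)
qed

lemma J_mult: "x \<in> B \<Longrightarrow> x * (J * y) = J * (x * y)"
  by (simp add: mult.assoc[symmetric] J_commute)

lemma J_mult_J_mult: assumes "x \<in> B" shows "J * x * (J * y) = - (x * y)"
proof -
  have "J * x * (J * y) = (J * J) * (x * y)"
    by (simp only: mult.assoc J_mult[OF assms])
  then show ?thesis by (simp add: J_J)
qed

definition sa :: "'b \<Rightarrow> bool" where
  "sa x \<longleftrightarrow> x \<in> B \<and> st x = x"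

lemma sa_B: "sa x \<Longrightarrow> x \<in> B"
  by (simp add: sa_def)

lemma sa_one: "sa 1" by (simp add: sa_def B_one st_one)
lemma sa_zero: "sa 0" by (simp add: sa_def B_zero st_zero)
lemma sa_add: "sa x \<Longrightarrow> sa y \<Longrightarrow> sa (x + y)" by (simp add: sa_def B_add st_add)
lemma sa_diff: "sa x \<Longrightarrow> sa y \<Longrightarrow> sa (x - y)" by (simp add: sa_def B_diff st_diff)
lemma sa_scaleR: "sa x \<Longrightarrow> sa (r *\<^sub>R x)" by (simp add: sa_def B_scaleR st_scaleR)
lemma sa_mult: "sa x \<Longrightarrow> sa y \<Longrightarrow> x * y = y * x \<Longrightarrow> sa (x * y)" by (simp add: sa_def B_mult st_mult)
lemma sa_st_mult: "x \<in> B \<Longrightarrow> sa (st x * x)" by (simp add: sa_def B_mult B_st st_mult st_st)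

lemmas sa_intros = sa_one sa_zero sa_add sa_diff sa_scaleR

lemma norm_sa_square: "sa h \<Longrightarrow> norm (h * h) = (norm h)\<^sup>2"
  using cstar[of h] by (simp add: sa_def)

lemma sa_sqrt1m:
  assumes "sa x" "norm x \<le> 1"
  shows "sa (sqrt1m x)"
proof -
  have B: "sqrt_coeff k *\<^sub>R x ^ k \<in> B" for k using assms by (intro B_closed sa_B)
  have "(\<lambda>k. st (sqrt_coeff k *\<^sub>R x ^ k)) sums st (sqrt1m x)"
    by (rule st_sums[OF B sqrt1m_sums[OF assms(2) norm_one_le]])
  moreover have "st (sqrt_coeff k *\<^sub>R x ^ k) = sqrt_coeff k *\<^sub>R x ^ k" for k
    using assms(1) by (simp add: st_scaleR st_power B_power sa_def)
  ultimately have "st (sqrt1m x) = sqrt1m x"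
    using sqrt1m_sums[OF assms(2) norm_one_le] by (simp add: sums_unique2)
  with B_sums[OF B sqrt1m_sums[OF assms(2) norm_one_le]] show ?thesis by (simp add: sa_def)
qed

text \<open>For self-adjoint \<open>h\<close> this inequality says that the spectrum lies in \<open>[0, 2l]\<close>. With positivity
  expressed by norms, sums of positive elements are positive by the triangle inequality.\<close>

definition npos :: "'b \<Rightarrow> bool" where
  "npos h \<longleftrightarrow> sa h \<and> (\<exists>l\<ge>0. norm (l *\<^sub>R 1 - h) \<le> l)"

lemma npos_sa: "npos h \<Longrightarrow> sa h"
  by (simp add: npos_def)

lemma npos_zero: "npos 0"
  by (auto simp: npos_def sa_zero intro: exI[of _ 0])

lemma npos_add:
  assumes "npos h" "npos k" shows "npos (h + k)"
proof -
  from assms obtain l m where lm: "l \<ge> 0" "norm (l *\<^sub>R 1 - h) \<le> l" "m \<ge> 0" "norm (m *\<^sub>R 1 - k) \<le> m"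
    by (auto simp: npos_def)
  have "norm ((l *\<^sub>R 1 - h) + (m *\<^sub>R 1 - k)) \<le> l + m" by (intro norm_triangle_mono lm)
  then have "norm ((l + m) *\<^sub>R 1 - (h + k)) \<le> l + m" by (simp add: algebra_simps)
  with lm show ?thesis using assms unfolding npos_def by (intro conjI sa_add exI[of _ "l + m"]) auto
qed

lemma npos_scaleR:
  assumes "npos h" "0 \<le> r" shows "npos (r *\<^sub>R h)"
proof -
  from assms obtain l where l: "l \<ge> 0" "norm (l *\<^sub>R 1 - h) \<le> l" by (auto simp: npos_def)
  have "norm (r *\<^sub>R (l *\<^sub>R 1 - h)) \<le> r * l" using l assms(2) by (simp add: mult_left_mono)
  then have "norm ((r * l) *\<^sub>R 1 - r *\<^sub>R h) \<le> r * l" by (simp add: algebra_simps)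
  with l assms show ?thesis unfolding npos_def by (intro conjI sa_scaleR exI[of _ "r * l"]) auto
qed

lemma npos_norm_minus:
  assumes "sa h" "norm h \<le> M" shows "npos (M *\<^sub>R 1 - h)"
proof -
  have "0 \<le> M" using assms(2) norm_ge_zero[of h] by linarith
  with assms show ?thesis unfolding npos_def by (intro conjI sa_intros exI[of _ M]) auto
qed

text \<open>With \<open>x = 1 - h/l\<close>, which has norm at most \<open>1\<close>, the root of \<open>h = l (1 - x)\<close> is a multiple of the
  series for \<open>sqrt (1 - x)\<close>. A limit of polynomials in \<open>h\<close> commutes with whatever commutes with
  \<open>h\<close>.\<close>

lemma npos_sqrt:
  assumes "npos h"
  obtains k where "npos k" "k * k = h" "\<And>y. y * h = h * y \<Longrightarrow> y * k = k * y"
proof -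
  from assms obtain l where l: "l \<ge> 0" "norm (l *\<^sub>R 1 - h) \<le> l" and h: "sa h" by (auto simp: npos_def)
  show ?thesis
  proof (cases "l = 0")
    case True
    then have "h = 0" using l by simp
    then show ?thesis by (intro that[of 0] npos_zero) auto
  next
    case False
    with l have l0: "l > 0" by simp
    define x where "x = (1 / l) *\<^sub>R (l *\<^sub>R 1 - h)"
    have x: "sa x" unfolding x_def by (intro sa_intros h)
    have n: "norm x \<le> 1" using l l0 by (simp add: x_def)
    have h_eq: "h = l *\<^sub>R (1 - x)" using l0 by (simp add: x_def algebra_simps)
    let ?k = "sqrt l *\<^sub>R sqrt1m x"
    have "norm (sqrt l *\<^sub>R (1 - sqrt1m x)) \<le> sqrt l * 1"
      unfolding norm_scaleR using norm_one_minus_sqrt1m[OF n norm_one_le] l0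
      by (intro mult_mono) auto
    then have "npos ?k" unfolding npos_def using l0
      by (intro conjI sa_scaleR sa_sqrt1m x n exI[of _ "sqrt l"]) (auto simp: scaleR_diff_right)
    moreover have "?k * ?k = h" using l0 by (simp add: sqrt1m_square[OF n norm_one_le] h_eq)
    moreover have "y * ?k = ?k * y" if "y * h = h * y" for y
    proof -
      have "y * x = x * y" using that by (simp add: x_def algebra_simps)
      then show ?thesis by (simp add: sqrt1m_commute[OF n norm_one_le])
    qed
    ultimately show ?thesis by (rule that)
  qed
qed

text \<open>If \<open>g\<close> is self-adjoint of norm \<open>1\<close>, then \<open>u = g + i sqrt (1 - g\<^sup>2)\<close> is unitary and
  \<open>4g\<^sup>2 - 2 = u\<^sup>2 + u\<^sup>*\<^sup>2\<close> has norm at most \<open>2\<close>.\<close>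

lemma npos_square:
  assumes h: "sa h" shows "npos (h * h)"
proof (cases "h = 0")
  case True
  then show ?thesis by (simp add: npos_zero)
next
  case False
  define g where "g = (1 / norm h) *\<^sub>R h"
  have g: "sa g" unfolding g_def by (intro sa_intros h)
  have gB: "g \<in> B" using g by (rule sa_B)
  have ng: "norm g = 1" using False by (simp add: g_def)
  have gg: "sa (g * g)" "norm (g * g) \<le> 1" using g ng by (auto intro!: sa_mult simp: norm_sa_square)
  define v where "v = sqrt1m (g * g)"
  have v: "sa v" unfolding v_def by (rule sa_sqrt1m[OF gg])
  have vB: "v \<in> B" using v by (rule sa_B)
  have vv: "v * v = 1 - g * g" unfolding v_def by (rule sqrt1m_square[OF gg(2) norm_one_le])
  have comm: "g * v = v * g" unfolding v_def
    by (rule sqrt1m_commute[OF gg(2) norm_one_le]) (simp add: mult.assoc)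
  define u where "u = g + J * v"
  have uB: "u \<in> B" unfolding u_def by (intro B_closed gB vB)
  have st_u: "st u = g - J * v"
    using g v J_commute[OF vB] by (simp add: u_def st_add st_mult B_closed gB vB st_J sa_def)
  have J1: "g * (J * v) = J * (g * v)" "J * v * g = J * (g * v)" "J * v * (J * v) = - (v * v)"
    by (rule J_mult[OF gB], simp only: mult.assoc comm, rule J_mult_J_mult[OF vB])
  have "st u * u = 1" unfolding st_u unfolding u_def
    unfolding left_diff_distrib distrib_left J1 vv by simp
  then have "(norm u)\<^sup>2 \<le> 1" using cstar[OF uB] norm_one_le by simp
  then have nu: "norm u \<le> 1" by (simp add: power2_le_iff_abs_le abs_square_le_1)
  have four: "4 *\<^sub>R y = 2 *\<^sub>R y + 2 *\<^sub>R y" for y :: 'b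
    by (simp add: scaleR_add_left[symmetric])
  have "u * u + st u * st u = 4 *\<^sub>R (g * g) - 2 *\<^sub>R 1"
  proof -
    have "u * u + st u * st u = 2 *\<^sub>R (g * g) + 2 *\<^sub>R (J * v * (J * v))"
      unfolding st_u unfolding u_def by (simp add: distrib_left distrib_right left_diff_distrib right_diff_distrib scaleR_2)
    also have "\<dots> = 4 *\<^sub>R (g * g) - 2 *\<^sub>R 1"
      unfolding J1 vv four by (simp add: scaleR_diff_right)
    finally show ?thesis .
  qed
  moreover have "norm (u * u + st u * st u) \<le> 1 + 1"
    using nu norm_st[OF uB]
    by (intro norm_triangle_mono order_trans[OF norm_mult_ineq] mult_le_one) auto
  ultimately have "norm (4 *\<^sub>R (g * g) - 2 *\<^sub>R 1) \<le> 2" by simp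
  then have n: "norm (2 *\<^sub>R 1 - 4 *\<^sub>R (g * g)) \<le> 2" by (simp add: norm_minus_commute)
  have "npos (4 *\<^sub>R (g * g))" unfolding npos_def
    by (intro conjI sa_intros gg exI[of _ 2] n) auto
  then have "npos (((norm h)\<^sup>2 / 4) *\<^sub>R (4 *\<^sub>R (g * g)))" by (rule npos_scaleR) simp
  also have "((norm h)\<^sup>2 / 4) *\<^sub>R (4 *\<^sub>R (g * g)) = h * h"
    using False by (simp add: g_def power2_eq_square)
  finally show ?thesis .
qed

lemma npos_mult_commute:
  assumes "npos h" "npos k" "h * k = k * h" shows "npos (h * k)"
proof -
  obtain a where a: "npos a" "a * a = h" "\<And>y. y * h = h * y \<Longrightarrow> y * a = a * y"
    using npos_sqrt[OF assms(1)] by blast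
  obtain b where b: "npos b" "b * b = k" "\<And>y. y * k = k * y \<Longrightarrow> y * b = b * y"
    using npos_sqrt[OF assms(2)] by blast
  have "k * a = a * k" by (rule a(3)) (simp add: assms(3))
  then have ab: "a * b = b * a" by (intro b(3)) simp
  have "h * k = (a * b) * (a * b)"
    unfolding a(2)[symmetric] b(2)[symmetric] by (metis ab mult.assoc)
  moreover have "sa (a * b)" by (intro sa_mult npos_sa a(1) b(1) ab)
  ultimately show ?thesis by (simp add: npos_square)
qed

text \<open>If \<open>a\<close> and \<open>b\<close> are commuting self-adjoint roots of \<open>h\<close> and \<open>M - h\<close>, then \<open>u = a + ib\<close> satisfies
  \<open>u\<^sup>* u = a\<^sup>2 + b\<^sup>2 = M\<close>, and \<open>a\<close> is the real part of \<open>u\<close>.\<close>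

lemma norm_le_of_npos:
  assumes h: "npos h" and k: "npos (M *\<^sub>R 1 - h)"
  shows "norm h \<le> \<bar>M\<bar>"
proof -
  obtain a where a: "npos a" "a * a = h" "\<And>y. y * h = h * y \<Longrightarrow> y * a = a * y"
    using npos_sqrt[OF h] by blast
  obtain b where b: "npos b" "b * b = M *\<^sub>R 1 - h" "\<And>y. y * (M *\<^sub>R 1 - h) = (M *\<^sub>R 1 - h) * y \<Longrightarrow> y * b = b * y"
    using npos_sqrt[OF k] by blast
  have sa: "sa a" "sa b" by (rule npos_sa[OF a(1)], rule npos_sa[OF b(1)])
  have aB: "a \<in> B" and bB: "b \<in> B" using sa by (auto intro: sa_B)
  have "a * h = h * a" unfolding a(2)[symmetric] by (simp add: mult.assoc)
  then have ab: "a * b = b * a" by (intro b(3)) (simp add: algebra_simps)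
  define u where "u = a + J * b"
  have uB: "u \<in> B" unfolding u_def by (intro B_closed aB bB)
  have st_u: "st u = a - J * b"
    using sa J_commute[OF bB] by (simp add: u_def st_add st_mult B_closed aB bB st_J sa_def)
  have J1: "a * (J * b) = J * (a * b)" "J * b * a = J * (a * b)" "J * b * (J * b) = - (b * b)"
    by (rule J_mult[OF aB], simp only: mult.assoc ab, rule J_mult_J_mult[OF bB])
  have "st u * u = M *\<^sub>R 1" unfolding st_u unfolding u_def
    unfolding left_diff_distrib distrib_left J1 a(2) b(2) by simp
  then have "(norm u)\<^sup>2 = \<bar>M\<bar> * norm (1::'b)" using cstar[OF uB] by simp
  also have "\<dots> \<le> \<bar>M\<bar> * 1" by (intro mult_left_mono norm_one_le) simp
  finally have nu: "(norm u)\<^sup>2 \<le> \<bar>M\<bar>" by simp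
  have "2 *\<^sub>R a = u + st u" unfolding st_u unfolding u_def by (simp add: scaleR_2)
  then have "2 * norm a \<le> norm u + norm (st u)" by (metis norm_triangle_ineq norm_scaleR abs_numeral)
  then have "norm a \<le> norm u" by (simp add: norm_st[OF uB])
  then have "(norm a)\<^sup>2 \<le> \<bar>M\<bar>" using nu by (meson norm_ge_zero order_trans power_mono)
  then show ?thesis using norm_sa_square[OF sa(1)] a(2) by simp
qed

lemma npos_norm_mono:
  assumes "npos h" "npos k" shows "norm h \<le> norm (h + k)"
proof -
  let ?M = "norm (h + k)"
  have "npos (?M *\<^sub>R 1 - (h + k))" by (intro npos_norm_minus npos_sa npos_add assms) simp
  then have "npos (?M *\<^sub>R 1 - (h + k) + k)" by (rule npos_add[OF _ assms(2)])
  then have "npos (?M *\<^sub>R 1 - h)" by (simp add: algebra_simps)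
  from norm_le_of_npos[OF assms(1) this] show ?thesis by simp
qed

text \<open>The norm of a positive element belongs to its spectrum. Suppose that \<open>t - h\<close> with \<open>t = \<parallel>h\<parallel>\<close> has an
  inverse \<open>w\<close>. Then \<open>w\<close> is positive, so \<open>C - w\<close> is positive for \<open>C \<ge> \<parallel>w\<parallel>\<close>, and multiplying by the
  commuting positive element \<open>(t - h)/C\<close> shows that \<open>t - 1/C - h\<close> is positive. This forces
  \<open>\<parallel>h\<parallel> < t\<close>.\<close>

lemma npos_norm_not_invertible:
  assumes h: "npos h" and wB: "w \<in> B"
    and w: "w * (norm h *\<^sub>R 1 - h) = 1" "(norm h *\<^sub>R 1 - h) * w = 1"
  shows "h = 0"
proof (rule ccontr)
  assume "h \<noteq> 0"
  define t where "t = norm h"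
  have t: "t > 0" using \<open>h \<noteq> 0\<close> by (simp add: t_def)
  define d where "d = t *\<^sub>R 1 - h"
  have dpos: "npos d" unfolding d_def t_def by (intro npos_norm_minus npos_sa h) simp
  then have dB: "d \<in> B" and dsa: "st d = d" using npos_sa by (auto simp: sa_def)
  have w': "w * d = 1" "d * w = 1" using w by (simp_all add: d_def t_def)
  have "st w * d = 1" using arg_cong[OF w'(2), of st] by (simp add: st_mult dB wB dsa st_one)
  then have stw: "st w = w" by (metis w'(2) mult.assoc mult_1 mult_1_right)
  obtain l where l: "npos l" "l * l = d" "\<And>y. y * d = d * y \<Longrightarrow> y * l = l * y"
    using npos_sqrt[OF dpos] by blast
  have wl: "w * l = l * w" by (rule l(3)) (simp add: w')
  have saw: "sa w" using wB stw by (simp add: sa_def)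
  have "(w * l) * (w * l) = w"
    by (metis l(2) mult.assoc mult_1_right w'(2) wl)
  then have wpos: "npos w"
    using npos_square[OF sa_mult[OF saw npos_sa[OF l(1)] wl]] by simp
  \<comment> \<open>The second entry keeps \<open>t - 1/C\<close> nonnegative.\<close>
  define C where "C = max (norm w) (1 / t)"
  have "1 / t \<le> C" by (simp add: C_def)
  moreover have "0 < 1 / t" using t by simp
  ultimately have C0: "C > 0" by linarith
  with \<open>1 / t \<le> C\<close> t have C: "C > 0" "1 / C \<le> t" by (auto simp: field_simps)
  have "npos (C *\<^sub>R 1 - w)" by (intro npos_norm_minus saw) (simp add: C_def)
  moreover have "d * (C *\<^sub>R 1 - w) = (C *\<^sub>R 1 - w) * d" by (simp add: algebra_simps w')
  ultimately have "npos (d * (C *\<^sub>R 1 - w))" by (intro npos_mult_commute dpos)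
  then have "npos ((1 / C) *\<^sub>R (d * (C *\<^sub>R 1 - w)))" by (rule npos_scaleR) (use C in simp)
  also have "(1 / C) *\<^sub>R (d * (C *\<^sub>R 1 - w)) = (t - 1 / C) *\<^sub>R 1 - h"
    using C by (simp add: algebra_simps w') (simp add: d_def algebra_simps)
  finally have "norm h \<le> \<bar>t - 1 / C\<bar>" by (rule norm_le_of_npos[OF h])
  moreover have "\<bar>t - 1 / C\<bar> < t" using C t by (simp add: abs_if)
  ultimately show False by (simp add: t_def)
qed

lemma npos_shift_invertible:
  assumes q: "npos q" and l: "0 < l"
  obtains v where "v \<in> B" "v * (l *\<^sub>R 1 + q) = 1" "(l *\<^sub>R 1 + q) * v = 1"
proof -
  from q obtain m where m: "m \<ge> 0" "norm (m *\<^sub>R 1 - q) \<le> m" by (auto simp: npos_def)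
  define y where "y = (1 / (l + m)) *\<^sub>R (m *\<^sub>R 1 - q)"
  have yB: "y \<in> B" unfolding y_def by (intro B_closed sa_B npos_sa q)
  have "norm y = norm (m *\<^sub>R 1 - q) / (l + m)" using m l by (simp add: y_def)
  also have "\<dots> < 1" using m l by (simp add: divide_less_eq)
  finally have "norm y < 1" .
  from neumann_inverse[OF this norm_one_le]
  obtain w where w: "(\<lambda>k. y ^ k) sums w" "w * (1 - y) = 1" "(1 - y) * w = 1" by blast
  have wB: "w \<in> B" by (rule B_sums[OF _ w(1)]) (intro B_closed yB)
  have "(l + m) *\<^sub>R y = m *\<^sub>R 1 - q" using m l by (simp add: y_def)
  then have eq: "l *\<^sub>R 1 + q = (l + m) *\<^sub>R (1 - y)" by (simp add: scaleR_diff_right scaleR_add_left)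
  show ?thesis
    by (rule that[of "(1 / (l + m)) *\<^sub>R w"]) (use m l w wB in \<open>auto simp: eq intro: B_closed\<close>)
qed

lemma npos_abs:
  assumes h: "sa h"
  obtains a where "npos a" "a * a = h * h" "\<And>y. y * h = h * y \<Longrightarrow> y * a = a * y"
proof -
  obtain a where a: "npos a" "a * a = h * h" "\<And>y. y * (h * h) = (h * h) * y \<Longrightarrow> y * a = a * y"
    using npos_sqrt[OF npos_square[OF h]] by blast
  show ?thesis by (rule that[OF a(1,2)], rule a(3)) (metis mult.assoc)
qed

text \<open>With \<open>c = x + iy\<close> one has \<open>c c\<^sup>* + c\<^sup>* c = 2x\<^sup>2 + 2y\<^sup>2\<close>, so \<open>c c\<^sup>*\<close> is positive if \<open>c\<^sup>* c\<close> is negative. Then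
  \<open>t + c c\<^sup>*\<close> is invertible for \<open>t > 0\<close>, and so is \<open>t + c\<^sup>* c = t - p\<close>, because nonzero spectra do not
  depend on the order of the factors. For \<open>t = \<parallel>p\<parallel>\<close> this is possible only if
  \<open>p = 0\<close>, because the norm of a positive element belongs to its spectrum.\<close>

lemma negative_st_mult_eq_0:
  assumes c: "c \<in> B" and p: "npos p" and eq: "st c * c = - p"
  shows "c = 0"
proof -
  define x where "x = (1 / 2) *\<^sub>R (c + st c)"
  define y where "y = (1 / 2) *\<^sub>R (J * (st c - c))"
  have xB: "x \<in> B" and yB: "y \<in> B" unfolding x_def y_def by (intro B_closed c)+
  have x: "sa x" using c by (simp add: sa_def x_def st_scaleR st_add B_closed st_st algebra_simps)
  have y: "sa y" using c J_commute[OF c] J_commute[OF B_st[OF c]]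
    by (simp add: sa_def y_def st_scaleR st_diff st_mult B_closed st_st st_J algebra_simps)
  have Jy': "J * y = (1 / 2) *\<^sub>R (c - st c)"
    unfolding y_def by (simp add: mult.assoc[symmetric] J_J)
  have c_eq: "c = x + J * y"
  proof -
    have "x + J * y = (1 / 2) *\<^sub>R ((c + st c) + (c - st c))"
      unfolding Jy' x_def by (simp only: scaleR_add_right)
    also have "(c + st c) + (c - st c) = 2 *\<^sub>R c" by (simp add: scaleR_2)
    finally show ?thesis by simp
  qed
  have stc_eq: "st c = x - J * y"
  proof -
    have "x - J * y = (1 / 2) *\<^sub>R ((c + st c) - (c - st c))"
      unfolding Jy' x_def by (simp only: scaleR_diff_right)
    also have "(c + st c) - (c - st c) = 2 *\<^sub>R st c" by (simp add: scaleR_2)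
    finally show ?thesis by simp
  qed
  have Jy: "J * y * (J * y) = - (y * y)" by (rule J_mult_J_mult[OF yB])
  have "c * st c + st c * c = 2 *\<^sub>R (x * x) - 2 *\<^sub>R (J * y * (J * y))"
  proof -
    have "(x + J * y) * (x - J * y) + (x - J * y) * (x + J * y) = 2 *\<^sub>R (x * x) - 2 *\<^sub>R (J * y * (J * y))"
      by (simp add: distrib_left distrib_right left_diff_distrib right_diff_distrib scaleR_2)
    then show ?thesis unfolding c_eq[symmetric] stc_eq[symmetric] .
  qed
  then have "c * st c = 2 *\<^sub>R (x * x) + 2 *\<^sub>R (y * y) + p" unfolding Jy eq by (simp add: algebra_simps)
  also have "npos \<dots>" by (intro npos_add npos_scaleR npos_square x y p) auto
  finally have q: "npos (c * st c)" .
  have "p = 0"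
  proof (rule ccontr)
    assume "p \<noteq> 0"
    define t where "t = norm p"
    have t: "0 < t" using \<open>p \<noteq> 0\<close> by (simp add: t_def)
    obtain v where v: "v \<in> B" "v * (t *\<^sub>R 1 + c * st c) = 1" "(t *\<^sub>R 1 + c * st c) * v = 1"
      using npos_shift_invertible[OF q t] by blast
    define w where "w = (1 / t) *\<^sub>R (1 - st c * v * c)"
    have wB: "w \<in> B" unfolding w_def by (intro B_closed c v)
    have v': "c * st c * v = 1 - t *\<^sub>R v" "v * (c * st c) = 1 - t *\<^sub>R v"
      using v by (simp_all add: algebra_simps)
    have d: "t *\<^sub>R 1 - p = t *\<^sub>R 1 + st c * c" by (simp add: eq)
    have "(t *\<^sub>R 1 + st c * c) * (1 - st c * v * c)
        = t *\<^sub>R 1 + st c * c - t *\<^sub>R (st c * v * c) - st c * (c * st c * v) * c"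
      by (simp add: algebra_simps mult.assoc)
    also have "\<dots> = t *\<^sub>R 1" unfolding v' by (simp add: algebra_simps)
    finally have w1: "(t *\<^sub>R 1 - p) * w = 1" unfolding d w_def using t by simp
    have "(1 - st c * v * c) * (t *\<^sub>R 1 + st c * c)
        = t *\<^sub>R 1 + st c * c - t *\<^sub>R (st c * v * c) - st c * (v * (c * st c)) * c"
      by (simp add: algebra_simps mult.assoc)
    also have "\<dots> = t *\<^sub>R 1" unfolding v' by (simp add: algebra_simps)
    finally have w2: "w * (t *\<^sub>R 1 - p) = 1" unfolding d w_def using t by simp
    from npos_norm_not_invertible[OF p wB] w1 w2 have "p = 0" by (simp add: t_def)
    with \<open>p \<noteq> 0\<close> show False by simp
  qed
  then show ?thesis using cstar[OF c] eq by simp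
qed

text \<open>Kaplansky's argument: with \<open>h = b\<^sup>* b\<close> and \<open>g = \<bar>h\<bar> - h\<close>, twice the negative part of \<open>h\<close>, the element
  \<open>c = b g\<close> has \<open>c\<^sup>* c = g h g = - g \<bar>h\<bar> g\<close>, which is negative. Hence \<open>c = 0\<close>, which gives \<open>g\<^sup>2 = 0\<close>
  and \<open>h = \<bar>h\<bar>\<close>.\<close>

theorem npos_st_mult:
  assumes b: "b \<in> B" shows "npos (st b * b)"
proof -
  define h where "h = st b * b"
  have h: "sa h" unfolding h_def by (rule sa_st_mult[OF b])
  obtain a where a: "npos a" "a * a = h * h" "\<And>y. y * h = h * y \<Longrightarrow> y * a = a * y"
    using npos_abs[OF h] by blast
  obtain k where k: "npos k" "k * k = a" "\<And>y. y * a = a * y \<Longrightarrow> y * k = k * y"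
    using npos_sqrt[OF a(1)] by blast
  have ah: "h * a = a * h" by (rule a(3)) simp
  define g where "g = a - h"
  have g: "sa g" unfolding g_def by (intro sa_diff npos_sa a h)
  have gB: "g \<in> B" by (rule sa_B[OF g])
  have ga: "g * a = a * g" by (simp add: g_def algebra_simps ah)
  have gk: "g * k = k * g" by (rule k(3)[OF ga])
  have gh: "g * h = - (a * g)" by (simp add: g_def algebra_simps ah a(2))
  have "st (b * g) * (b * g) = g * h * g"
    using g by (simp add: st_mult b gB sa_def h_def mult.assoc)
  also have "\<dots> = - (g * k * (g * k))"
    unfolding gh by (simp add: k(2)[symmetric] mult.assoc gk) (metis gk mult.assoc)
  finally have eq: "st (b * g) * (b * g) = - (g * k * (g * k))" .
  have "b * g = 0"
    by (rule negative_st_mult_eq_0[OF _ npos_square eq]) (intro B_closed b gB sa_mult g npos_sa k gk)+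
  then have hg: "h * g = 0" by (simp add: h_def mult.assoc)
  have "g * h = 0" using hg by (simp add: g_def algebra_simps ah)
  then have "a * g = 0" using gh by simp
  then have "g * g = 0" using hg by (subst (1) g_def) (simp add: left_diff_distrib)
  then have "g = 0" using norm_sa_square[OF g] by simp
  then show ?thesis using a(1) by (simp add: g_def h_def)
qed

text \<open>The element \<open>l + S\<close> is invertible for large \<open>l\<close>. Where it is invertible the inverse has norm at most
  \<open>1/d\<close>, so invertibility persists under moving \<open>l\<close> by less than \<open>d\<close>, and finitely many such steps
  lead to \<open>l = 0\<close>.\<close>

lemma bounded_below_invertible:
  assumes S: "S \<in> B" and d: "0 < d"
    and below: "\<And>l w. 0 \<le> l \<Longrightarrow> w \<in> B \<Longrightarrow> d * norm w \<le> norm ((l *\<^sub>R 1 + S) * w)"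
  obtains w where "w \<in> B" "w * S = 1" "S * w = 1"
proof -
  define inv where "inv l \<longleftrightarrow> (\<exists>w\<in>B. w * (l *\<^sub>R 1 + S) = 1 \<and> (l *\<^sub>R 1 + S) * w = 1)" for l
  have step: "inv m" if l: "0 \<le> l" "inv l" and lm: "\<bar>l - m\<bar> < d" for l m
  proof -
    from l obtain w where w: "w \<in> B" "w * (l *\<^sub>R 1 + S) = 1" "(l *\<^sub>R 1 + S) * w = 1" by (auto simp: inv_def)
    have nw: "d * norm w \<le> 1" using below[OF l(1) w(1)] w(3) norm_one_le by simp
    define y where "y = (l - m) *\<^sub>R w"
    have yB: "y \<in> B" unfolding y_def by (intro B_closed w)
    have "norm y < 1"
    proof (cases "w = 0")
      case False
      then have "\<bar>l - m\<bar> * norm w < d * norm w" using lm by simp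
      with nw show ?thesis by (simp add: y_def)
    qed (simp add: y_def)
    from neumann_inverse[OF this norm_one_le]
    obtain v where v: "(\<lambda>k. y ^ k) sums v" "v * (1 - y) = 1" "(1 - y) * v = 1" by blast
    have vB: "v \<in> B" by (rule B_sums[OF _ v(1)]) (intro B_closed yB)
    have e1: "m *\<^sub>R 1 + S = (l *\<^sub>R 1 + S) * (1 - y)"
      unfolding y_def right_diff_distrib mult_scaleR_right w(3) by (simp add: algebra_simps)
    have e2: "m *\<^sub>R 1 + S = (1 - y) * (l *\<^sub>R 1 + S)"
      unfolding y_def left_diff_distrib mult_scaleR_left w(2) by (simp add: algebra_simps)
    have "w * v * (m *\<^sub>R 1 + S) = w * (v * (1 - y)) * (l *\<^sub>R 1 + S)" unfolding e2 by (simp add: mult.assoc)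
    then have 1: "w * v * (m *\<^sub>R 1 + S) = 1" by (simp add: v w)
    have "(m *\<^sub>R 1 + S) * (v * w) = (l *\<^sub>R 1 + S) * ((1 - y) * v) * w" unfolding e1 by (simp add: mult.assoc)
    then have 2: "(m *\<^sub>R 1 + S) * (v * w) = 1" by (simp add: v w)
    have "w * v = v * w" by (metis 1 2 mult.assoc mult_1 mult_1_right)
    with 1 2 show ?thesis unfolding inv_def by (intro bexI[of _ "w * v"] B_closed vB w) auto
  qed
  have large: "inv (norm S + 1)"
  proof -
    define y where "y = (- 1 / (norm S + 1)) *\<^sub>R S"
    have "norm S + 1 > 0" using norm_ge_zero[of S] by linarith
    then have "norm y < 1" by (simp add: y_def field_simps)
    from neumann_inverse[OF this norm_one_le]
    obtain v where v: "(\<lambda>k. y ^ k) sums v" "v * (1 - y) = 1" "(1 - y) * v = 1" by blast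
    have vB: "v \<in> B" by (rule B_sums[OF _ v(1)]) (unfold y_def, intro B_closed S)
    have "(norm S + 1) *\<^sub>R 1 + S = (norm S + 1) *\<^sub>R (1 - y)"
      using \<open>norm S + 1 > 0\<close> by (simp add: y_def scaleR_add_right)
    with v vB \<open>norm S + 1 > 0\<close> show ?thesis unfolding inv_def
      by (intro bexI[of _ "(1 / (norm S + 1)) *\<^sub>R v"] B_closed) auto
  qed
  have "inv (max 0 (norm S + 1 - real n * (d / 2)))" for n
  proof (induction n)
    case 0
    then show ?case using large by (simp add: max_def)
  next
    case (Suc n)
    show ?case by (rule step[OF _ Suc]) (use d in \<open>auto simp: algebra_simps max_def abs_if\<close>)
  qed
  moreover obtain n where "norm S + 1 < real n * (d / 2)" using reals_Archimedean3[of "d / 2"] d by (meson half_gt_zero)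
  ultimately have "inv 0" by (metis max.absorb1 diff_le_0_iff_le less_imp_le)
  then show ?thesis using that by (auto simp: inv_def)
qed

end

section \<open>Adjointable operators on a Hilbert module\<close>

text \<open>A copy of the bounded operators on a space, made a Banach algebra with composition as multiplication.\<close>

typedef (overloaded) 'x bop = "UNIV :: ('x::real_normed_vector \<Rightarrow>\<^sub>L 'x) set"
  morphisms blinfun_of_bop Bop ..

setup_lifting type_definition_bop

instantiation bop :: (real_normed_vector) real_vector
begin

lift_definition zero_bop :: "'a bop" is 0 .
lift_definition plus_bop :: "'a bop \<Rightarrow> 'a bop \<Rightarrow> 'a bop" is "(+)" .
lift_definition minus_bop :: "'a bop \<Rightarrow> 'a bop \<Rightarrow> 'a bop" is "(-)" .
lift_definition uminus_bop :: "'a bop \<Rightarrow> 'a bop" is "uminus" .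
lift_definition scaleR_bop :: "real \<Rightarrow> 'a bop \<Rightarrow> 'a bop" is "(*\<^sub>R)" .

instance
  by standard (transfer, simp add: algebra_simps)+

end

instantiation bop :: (real_normed_vector) real_normed_algebra
begin

lift_definition norm_bop :: "'a bop \<Rightarrow> real" is norm .
lift_definition times_bop :: "'a bop \<Rightarrow> 'a bop \<Rightarrow> 'a bop" is "(o\<^sub>L)" .
definition dist_bop :: "'a bop \<Rightarrow> 'a bop \<Rightarrow> real" where "dist_bop a b = norm (a - b)"
definition sgn_bop :: "'a bop \<Rightarrow> 'a bop" where "sgn_bop x = x /\<^sub>R norm x"
definition uniformity_bop :: "('a bop \<times> 'a bop) filter" where
  "uniformity_bop = (INF e\<in>{0<..}. principal {(x, y). dist x y < e})"
definition open_bop :: "'a bop set \<Rightarrow> bool" where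
  "open_bop S = (\<forall>x\<in>S. \<forall>\<^sub>F (x', y) in uniformity. x' = x \<longrightarrow> y \<in> S)"

instance
proof
  fix x y z :: "'a bop" and r :: real
  show "dist x y = norm (x - y)" by (rule dist_bop_def)
  show "sgn x = x /\<^sub>R norm x" by (rule sgn_bop_def)
  show "uniformity = (INF e\<in>{0<..}. principal {(x :: 'a bop, y). dist x y < e})" by (rule uniformity_bop_def)
  show "open S = (\<forall>x\<in>S. \<forall>\<^sub>F (x', y) in uniformity. x' = x \<longrightarrow> y \<in> S)" for S :: "'a bop set"
    by (rule open_bop_def)
  show "norm x = 0 \<longleftrightarrow> x = 0" by transfer simp
  show "norm (x + y) \<le> norm x + norm y" by transfer (rule norm_triangle_ineq)
  show "norm (r *\<^sub>R x) = \<bar>r\<bar> * norm x" by transfer simp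
  show "x * y * z = x * (y * z)" by transfer (rule blinfun_eqI, simp)
  show "(x + y) * z = x * z + y * z" by transfer (rule bounded_bilinear.add_left[OF bounded_bilinear_blinfun_compose])
  show "x * (y + z) = x * y + x * z" by transfer (rule bounded_bilinear.add_right[OF bounded_bilinear_blinfun_compose])
  show "r *\<^sub>R x * y = r *\<^sub>R (x * y)" by transfer (rule bounded_bilinear.scaleR_left[OF bounded_bilinear_blinfun_compose])
  show "x * r *\<^sub>R y = r *\<^sub>R (x * y)" by transfer (rule bounded_bilinear.scaleR_right[OF bounded_bilinear_blinfun_compose])
  show "norm (x * y) \<le> norm x * norm y" by transfer (rule norm_blinfun_compose)
qed

end

instantiation bop :: (real_normed_vector) monoid_mult
begin
lift_definition one_bop :: "'a bop" is id_blinfun .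
instance
  by standard (transfer, rule blinfun_eqI, simp)+
end

instance bop :: (banach) banach
proof
  fix X :: "nat \<Rightarrow> 'a bop"
  assume "Cauchy X"
  have d: "dist (blinfun_of_bop S) (blinfun_of_bop T) = dist S T" for S T :: "'a bop"
    unfolding dist_norm by transfer (rule refl)
  have "Cauchy (\<lambda>n. blinfun_of_bop (X n))" using \<open>Cauchy X\<close> unfolding Cauchy_def d .
  then obtain L where "(\<lambda>n. blinfun_of_bop (X n)) \<longlonglongrightarrow> L" using Cauchy_convergent_iff convergent_def by blast
  then have "X \<longlonglongrightarrow> Bop L"
    unfolding lim_sequentially by (simp add: d[symmetric] Bop_inverse)
  then show "convergent X" by (rule convergentI)
qed

lift_definition bop_apply :: "'x::real_normed_vector bop \<Rightarrow> 'x \<Rightarrow> 'x" is blinfun_apply .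
lift_definition bop_of :: "('x::real_normed_vector \<Rightarrow> 'x) \<Rightarrow> 'x bop" is Blinfun .

lemma bop_apply_of: "bounded_linear f \<Longrightarrow> bop_apply (bop_of f) = f"
  by transfer (rule bounded_linear_Blinfun_apply)

lemma bop_eqI: "(\<And>x. bop_apply S x = bop_apply T x) \<Longrightarrow> S = T"
  by transfer (rule blinfun_eqI)

lemma bounded_linear_bop: "bounded_linear (bop_apply T)"
  by transfer (rule blinfun.bounded_linear_right)

lemma norm_bop: "norm (bop_apply T x) \<le> norm T * norm x"
  by transfer (rule norm_blinfun)

lemma norm_bop_le: "0 \<le> b \<Longrightarrow> (\<And>x. norm (bop_apply T x) \<le> b * norm x) \<Longrightarrow> norm T \<le> b"
  by transfer (rule norm_blinfun_bound)

lemma bop_simps [simp]: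
  "bop_apply (S + T) x = bop_apply S x + bop_apply T x"
  "bop_apply (S - T) x = bop_apply S x - bop_apply T x"
  "bop_apply (- T) x = - bop_apply T x"
  "bop_apply (r *\<^sub>R T) x = r *\<^sub>R bop_apply T x"
  "bop_apply (S * T) x = bop_apply S (bop_apply T x)"
  "bop_apply 1 x = x"
  "bop_apply 0 x = 0"
  by (transfer, simp add: blinfun.bilinear_simps)+

lemma tendsto_bop_apply:
  assumes "X \<longlonglongrightarrow> T" shows "(\<lambda>n. bop_apply (X n) x) \<longlonglongrightarrow> bop_apply T x"
proof (rule LIM_zero_cancel, rule Lim_null_comparison)
  show "\<forall>\<^sub>F n in sequentially. norm (bop_apply (X n) x - bop_apply T x) \<le> norm (X n - T) * norm x"
    using norm_bop[of "X _ - T" x] by simp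
  have "(\<lambda>n. norm (X n - T)) \<longlonglongrightarrow> 0" using assms by (intro tendsto_norm_zero LIM_zero)
  then show "(\<lambda>n. norm (X n - T) * norm x) \<longlonglongrightarrow> 0" by (rule tendsto_mult_left_zero)
qed

lemma norm_bop_one_le: "norm (1 :: 'x::real_normed_vector bop) \<le> 1"
  by (rule norm_bop_le) auto

lemma star_zero [simp]: "star (0 :: 'a::cstar_algebra) = 0"
  using star_add[of "0::'a" 0] by simp

lemma star_sum: "star (\<Sum>i\<in>I. f i) = (\<Sum>i\<in>I. star (f i :: 'a::cstar_algebra))"
  by (induction I rule: infinite_finite_induct) (auto simp: star_add)

lemma norm_star: "norm (star a) = norm (a :: 'a::cstar_algebra)"
proof -
  have *: "norm b \<le> norm (star b)" for b :: 'a
  proof (cases "b = 0")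
    case False
    have "norm b * norm b \<le> norm (star b) * norm b"
      using cstar_identity[of b] norm_mult_ineq[of "star b" b] by (simp add: power2_eq_square)
    with False show ?thesis by simp
  qed simp
  from *[of a] *[of "star a"] show ?thesis by (simp add: star_star)
qed

lemma cstar_mult_eq_0: "star a * a = 0 \<Longrightarrow> a = (0 :: 'a::cstar_algebra)"
  using cstar_identity[of a] by simp

lemma cstar_cancel_left: "(\<And>b. star b * a = star b * c) \<Longrightarrow> a = (c :: 'a::cstar_algebra)"
  using cstar_mult_eq_0[of "a - c"] by (metis eq_iff_diff_eq_0 right_diff_distrib)

lemma scaleC_ii_ii: "\<i> *\<^sub>C \<i> *\<^sub>C x = - (x :: 'x::complex_vector)"
  by (simp add: scaleC_scaleC)

lemma bounded_linear_scaleC: "bounded_linear (\<lambda>x :: 'x::cbanach. c *\<^sub>C x)"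
proof (rule bounded_linear_intro)
  show "norm (c *\<^sub>C x) \<le> norm x * cmod c" for x :: 'x by (simp add: norm_scaleC)
qed (simp_all add: scaleC_add_right scaleR_scaleC scaleC_scaleC mult.commute)

context hilbert_module
begin

abbreviation ip :: "'e \<Rightarrow> 'e \<Rightarrow> 'a" where "ip \<equiv> hip E"

lemma ip_add_left: "ip (x + y) z = ip x z + ip y z"
  by (metis ip_add_right ip_star star_add)

lemma ip_scaleC_left: "ip (c *\<^sub>C x) y = cnj c *\<^sub>C ip x y"
  by (metis ip_scaleC_right ip_star star_scaleC)

lemma ip_scaleR_left: "ip (r *\<^sub>R x) y = r *\<^sub>R ip x y"
  by (simp add: scaleR_scaleC ip_scaleC_left)

lemma ip_scaleR_right: "ip x (r *\<^sub>R y) = r *\<^sub>R ip x y"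
  by (simp add: scaleR_scaleC ip_scaleC_right)

lemma ip_act_left: "ip (hact E x a) y = star a * ip x y"
  by (metis ip_act_right ip_star star_mult star_star)

lemma ip_zero [simp]: "ip 0 y = 0" "ip x 0 = 0"
  using ip_scaleR_left[of 0 0 y] ip_scaleR_right[of x 0 0] by simp_all

lemma ip_minus: "ip (- x) y = - ip x y" "ip x (- y) = - ip x y"
  using ip_scaleR_left[of "- 1" x y] ip_scaleR_right[of x "- 1" y] by simp_all

lemma ip_diff: "ip (x - z) y = ip x y - ip z y" "ip x (y - w) = ip x y - ip x w"
  using ip_add_left[of x "- z" y] ip_add_right[of x y "- w"] by (simp_all add: ip_minus)

lemma ip_self_eq_0: "ip x x = 0 \<Longrightarrow> x = 0"
  using norm_ip[of x] by simp

lemma ip_eqI: "(\<And>y. ip y x = ip y z) \<Longrightarrow> x = z"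
  using ip_self_eq_0[of "x - z"] by (simp add: ip_diff)

definition adjointable_ops :: "'e bop set" where
  "adjointable_ops = {T. \<exists>S. \<forall>x y. ip (bop_apply T x) y = ip x (bop_apply S y)}"

definition op_star :: "'e bop \<Rightarrow> 'e bop" where
  "op_star T = (THE S. \<forall>x y. ip (bop_apply T x) y = ip x (bop_apply S y))"

lemma op_star_eqI:
  assumes "\<And>x y. ip (bop_apply T x) y = ip x (bop_apply S y)"
  shows "op_star T = S"
  unfolding op_star_def
  by (rule the_equality) (use assms in \<open>auto intro!: bop_eqI ip_eqI\<close>)

lemma adjointable_opsI:
  assumes "\<And>x y. ip (bop_apply T x) y = ip x (bop_apply S y)"
  shows "T \<in> adjointable_ops"
  using assms unfolding adjointable_ops_def by blast

lemma op_star_right: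
  assumes "T \<in> adjointable_ops"
  shows "ip (bop_apply T x) y = ip x (bop_apply (op_star T) y)"
proof -
  from assms obtain S where S: "\<And>x y. ip (bop_apply T x) y = ip x (bop_apply S y)"
    unfolding adjointable_ops_def by blast
  show ?thesis unfolding op_star_eqI[of T S, OF S] by (rule S)
qed

lemma op_star_left:
  assumes "T \<in> adjointable_ops"
  shows "ip x (bop_apply T y) = ip (bop_apply (op_star T) x) y"
  using arg_cong[OF op_star_right[OF assms, of y x], of star] by (simp add: ip_star)

end

text \<open>The Cauchy--Schwarz inequality is needed to make the adjointable operators a \<open>C\<^sup>*\<close>-algebra, and its
  proof in general uses the order of \<open>A\<close>. For \<open>A\<close> as a module over itself it is trivial. The order of
  \<open>A\<close> is therefore obtained first, from the operators on \<open>A\<close>, and the inequality for an arbitrary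
  module is derived from it afterwards.\<close>

locale hilbert_module_cs = hilbert_module E
  for E :: "('a::cstar_algebra, 'e::cbanach) hmod" +
  assumes cs: "norm (hip E x y) \<le> norm x * norm y"
begin

text \<open>Only the Cauchy--Schwarz inequality enters here, and with constant \<open>1\<close>: any larger constant would
  spoil the \<open>C\<^sup>*\<close>-identity below.\<close>

lemma norm_op_star_le:
  assumes adj: "\<And>x y. ip (bop_apply T x) y = ip x (bop_apply S y)"
  shows "norm S \<le> norm T"
proof (rule norm_bop_le)
  fix y
  let ?z = "bop_apply S y"
  have "(norm ?z)\<^sup>2 = norm (ip (bop_apply T ?z) y)" by (simp add: norm_ip adj)
  also have "\<dots> \<le> norm (bop_apply T ?z) * norm y" by (rule cs)
  also have "\<dots> \<le> (norm T * norm ?z) * norm y" by (intro mult_right_mono norm_bop) simp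
  finally have "norm ?z * norm ?z \<le> (norm T * norm y) * norm ?z" by (simp add: power2_eq_square algebra_simps)
  then show "norm ?z \<le> norm T * norm y"
    by (cases "?z = 0") auto
qed simp

lemma bounded_bilinear_ip: "bounded_bilinear ip"
  by (rule bounded_bilinear.intro)
    (auto simp: ip_add_left ip_add_right ip_scaleR_left ip_scaleR_right intro!: exI[of _ 1] cs)

lemmas tendsto_ip = bounded_bilinear.tendsto[OF bounded_bilinear_ip]

text \<open>Taking adjoints is contractive, so the adjoints of a convergent sequence converge, and the limit is
  an adjoint of the limit.\<close>

lemma closed_adjointable_ops: "closed adjointable_ops"
  unfolding closed_sequential_limits
proof (intro allI impI, elim conjE)
  fix X T assume X: "\<forall>n. X n \<in> adjointable_ops" and lim: "X \<longlonglongrightarrow> T"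
  have adj: "ip (bop_apply (X n) x) y = ip x (bop_apply (op_star (X n)) y)" for n x y
    using X op_star_right by blast
  have "norm (op_star (X m) - op_star (X n)) \<le> norm (X m - X n)" for m n
    by (rule norm_op_star_le) (simp add: ip_diff adj)
  then have "dist (op_star (X m)) (op_star (X n)) \<le> dist (X m) (X n)" for m n by (simp add: dist_norm)
  then have "Cauchy (\<lambda>n. op_star (X n))"
    using LIMSEQ_imp_Cauchy[OF lim] unfolding Cauchy_def by (meson le_less_trans)
  then obtain S where S: "(\<lambda>n. op_star (X n)) \<longlonglongrightarrow> S" using Cauchy_convergent_iff convergent_def by blast
  show "T \<in> adjointable_ops"
  proof (rule adjointable_opsI)
    fix x y
    have 1: "(\<lambda>n. ip (bop_apply (X n) x) y) \<longlonglongrightarrow> ip (bop_apply T x) y"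
      by (intro tendsto_ip tendsto_bop_apply lim tendsto_const)
    have 2: "(\<lambda>n. ip x (bop_apply (op_star (X n)) y)) \<longlonglongrightarrow> ip x (bop_apply S y)"
      by (intro tendsto_ip tendsto_bop_apply S tendsto_const)
    show "ip (bop_apply T x) y = ip x (bop_apply S y)"
      using 1 2 unfolding adj by (rule LIMSEQ_unique)
  qed
qed

lemma op_star_op:
  assumes "T \<in> adjointable_ops" shows "op_star T \<in> adjointable_ops" "op_star (op_star T) = T"
  using op_star_left[OF assms] by (auto intro: adjointable_opsI[where S = T] op_star_eqI)

lemma norm_op_star_mult:
  assumes T: "T \<in> adjointable_ops" shows "norm (op_star T * T) = (norm T)\<^sup>2"
proof (rule antisym)
  have "norm (op_star T * T) \<le> norm (op_star T) * norm T" by (rule norm_mult_ineq)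
  also have "\<dots> \<le> norm T * norm T" by (intro mult_right_mono norm_op_star_le op_star_right T) simp
  finally show "norm (op_star T * T) \<le> (norm T)\<^sup>2" by (simp add: power2_eq_square)
next
  have "norm T \<le> sqrt (norm (op_star T * T))"
  proof (rule norm_bop_le)
    fix x
    have "(norm (bop_apply T x))\<^sup>2 = norm (ip x (bop_apply (op_star T * T) x))"
      by (simp add: norm_ip op_star_right[OF T])
    also have "\<dots> \<le> norm x * norm (bop_apply (op_star T * T) x)" by (rule cs)
    also have "\<dots> \<le> norm x * (norm (op_star T * T) * norm x)" by (intro mult_left_mono norm_bop) simp
    also have "\<dots> = (sqrt (norm (op_star T * T)) * norm x)\<^sup>2"
      by (simp add: power_mult_distrib) (simp add: power2_eq_square)
    finally show "norm (bop_apply T x) \<le> sqrt (norm (op_star T * T)) * norm x"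
      by (rule power2_le_imp_le) simp
  qed simp
  then show "(norm T)\<^sup>2 \<le> norm (op_star T * T)"
    by (metis norm_ge_zero real_sqrt_le_iff real_sqrt_abs abs_norm_cancel)
qed

sublocale ops: unital_cstar adjointable_ops op_star "bop_of (scaleC \<i>)"
proof
  let ?J = "bop_of (scaleC \<i>) :: 'e bop"
  have J: "bop_apply ?J x = \<i> *\<^sub>C x" for x by (simp add: bop_apply_of bounded_linear_scaleC)
  show "closed adjointable_ops" by (rule closed_adjointable_ops)
  show "1 \<in> adjointable_ops" by (rule adjointable_opsI[where S = 1]) simp
  have J_adj: "ip (bop_apply ?J x) y = ip x (bop_apply (- ?J) y)" for x y
    by (simp add: J ip_scaleC_left ip_scaleC_right ip_minus cvec.scale_minus_left)
  then show "?J \<in> adjointable_ops" by (rule adjointable_opsI)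
  show "op_star ?J = - ?J" by (rule op_star_eqI[OF J_adj])
  show "?J * ?J = - 1" by (rule bop_eqI) (simp add: J scaleC_ii_ii)
  show "norm (1 :: 'e bop) \<le> 1" by (rule norm_bop_one_le)
  fix T S :: "'e bop" and r :: real
  assume T: "T \<in> adjointable_ops"
  note Tr = op_star_right[OF T]
  show "op_star T \<in> adjointable_ops" "op_star (op_star T) = T" by (rule op_star_op[OF T])+
  show "norm (op_star T * T) = (norm T)\<^sup>2" by (rule norm_op_star_mult[OF T])
  have r: "ip (bop_apply (r *\<^sub>R T) x) y = ip x (bop_apply (r *\<^sub>R op_star T) y)" for x y
    by (simp add: ip_scaleR_left ip_scaleR_right Tr)
  show "r *\<^sub>R T \<in> adjointable_ops" "op_star (r *\<^sub>R T) = r *\<^sub>R op_star T"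
    by (rule adjointable_opsI[OF r], rule op_star_eqI[OF r])
  show "?J * T = T * ?J"
  proof (rule bop_eqI, rule ip_eqI)
    fix x y
    have "op_star (op_star T) = T" "op_star T \<in> adjointable_ops" by (rule op_star_op[OF T])+
    then have l: "ip y (bop_apply T z) = ip (bop_apply (op_star T) y) z" for z
      using op_star_left[OF T] by blast
    show "ip y (bop_apply (?J * T) x) = ip y (bop_apply (T * ?J) x)"
      by (simp add: J ip_scaleC_right l)
  qed
  assume S: "S \<in> adjointable_ops"
  note Sr = op_star_right[OF S]
  have a: "ip (bop_apply (T + S) x) y = ip x (bop_apply (op_star T + op_star S) y)" for x y
    by (simp add: ip_add_left ip_add_right Tr Sr)
  show "T + S \<in> adjointable_ops" "op_star (T + S) = op_star T + op_star S"
    by (rule adjointable_opsI[OF a], rule op_star_eqI[OF a])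
  have m: "ip (bop_apply (T * S) x) y = ip x (bop_apply (op_star S * op_star T) y)" for x y
    by (simp add: Tr Sr)
  show "T * S \<in> adjointable_ops" "op_star (T * S) = op_star S * op_star T"
    by (rule adjointable_opsI[OF m], rule op_star_eqI[OF m])
qed

end

interpretation alg: hilbert_module_cs "alg_mod :: ('a::cstar_algebra, 'a) hmod"
proof
  fix x y z a b :: 'a and c
  show "norm (hip alg_mod x y) \<le> norm x * norm y"
    using norm_mult_ineq[of "star x" y] by (simp add: alg_mod_def norm_star)
qed (auto simp: alg_mod_def algebra_simps mult_scaleC_left mult_scaleC_right star_mult star_star
    positive_def cstar_identity)

definition lmult :: "'a::cstar_algebra \<Rightarrow> 'a bop" where
  "lmult a = bop_of ((*) a)"

lemma lmult_apply [simp]: "bop_apply (lmult a) b = a * b"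
  by (simp add: lmult_def bop_apply_of bounded_linear_mult_right)

lemma lmult_adj: "hip alg_mod (bop_apply (lmult a) x) y = hip alg_mod x (bop_apply (lmult (star a)) y)"
  by (simp add: alg_mod_def star_mult mult.assoc)

lemma lmult_op: "lmult a \<in> alg.adjointable_ops"
  by (rule alg.adjointable_opsI[OF lmult_adj])

lemma op_star_lmult: "alg.op_star (lmult a) = lmult (star a)"
  by (rule alg.op_star_eqI[OF lmult_adj])

lemma lmult_add: "lmult (a + b) = lmult a + lmult b"
  and lmult_diff: "lmult (a - b) = lmult a - lmult b"
  and lmult_mult: "lmult (a * b) = lmult a * lmult b"
  and lmult_zero: "lmult 0 = 0"
  and lmult_scaleR: "lmult (r *\<^sub>R a) = r *\<^sub>R lmult a"
  by (rule bop_eqI, simp add: algebra_simps)+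

lemma norm_lmult: "norm (lmult a) = norm a"
proof (rule antisym)
  show "norm (lmult a) \<le> norm a" by (rule norm_bop_le) (simp_all add: norm_mult_ineq)
  have "norm a * norm a = norm (bop_apply (lmult a) (star a))"
    using cstar_identity[of "star a"] by (simp add: star_star norm_star power2_eq_square)
  also have "\<dots> \<le> norm (lmult a) * norm a" using norm_bop[of "lmult a" "star a"] by (simp add: norm_star)
  finally show "norm a \<le> norm (lmult a)" by (cases "a = 0") auto
qed

text \<open>Positivity in an algebra that may lack a unit, tested in its algebra of adjointable operators.\<close>

definition pos :: "'a::cstar_algebra \<Rightarrow> bool" where
  "pos a \<longleftrightarrow> alg.ops.npos (lmult a)"

lemma pos_star_mult: "pos (star a * a)"
  using alg.ops.npos_st_mult[OF lmult_op, of a] by (simp add: pos_def lmult_mult op_star_lmult)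

lemma positive_imp_pos: "positive a \<Longrightarrow> pos a"
  by (auto simp: positive_def pos_star_mult)

lemma pos_zero: "pos 0" by (simp add: pos_def lmult_zero alg.ops.npos_zero)
lemma pos_add: "pos a \<Longrightarrow> pos b \<Longrightarrow> pos (a + b)" by (simp add: pos_def lmult_add alg.ops.npos_add)
lemma pos_scaleR: "pos a \<Longrightarrow> 0 \<le> r \<Longrightarrow> pos (r *\<^sub>R a)" by (simp add: pos_def lmult_scaleR alg.ops.npos_scaleR)
lemma pos_sum: "(\<And>i. i \<in> I \<Longrightarrow> pos (f i)) \<Longrightarrow> pos (\<Sum>i\<in>I. f i)"
  by (induction I rule: infinite_finite_induct) (auto intro: pos_zero pos_add)

lemma pos_norm_mono: "pos a \<Longrightarrow> pos b \<Longrightarrow> norm a \<le> norm (a + b)"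
  using alg.ops.npos_norm_mono[of "lmult a" "lmult b"] by (simp add: pos_def lmult_add[symmetric] norm_lmult)

lemma pos_add_eq_0: "pos a \<Longrightarrow> pos b \<Longrightarrow> a + b = 0 \<Longrightarrow> a = 0"
  using pos_norm_mono[of a b] by simp

text \<open>If \<open>k\<close> is a root of \<open>1 - c\<close>, the element is \<open>(k a)\<^sup>* (k a)\<close>.\<close>

lemma pos_conj_contraction:
  assumes c: "pos c" "norm c \<le> 1"
  shows "pos (star a * a - star a * c * a)"
proof -
  have "alg.ops.npos (1 *\<^sub>R 1 - lmult c)"
    using c by (intro alg.ops.npos_norm_minus alg.ops.npos_sa) (simp_all add: norm_lmult pos_def)
  then obtain k where k: "alg.ops.npos k" "k * k = 1 *\<^sub>R 1 - lmult c"
    using alg.ops.npos_sqrt by blast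
  have kB: "k \<in> alg.adjointable_ops" "alg.op_star k = k" using alg.ops.npos_sa[OF k(1)] by (auto simp: alg.ops.sa_def)
  have "alg.ops.npos (alg.op_star (k * lmult a) * (k * lmult a))"
    by (intro alg.ops.npos_st_mult alg.ops.B_mult kB lmult_op)
  also have "alg.op_star (k * lmult a) * (k * lmult a) = lmult (star a) * (k * k) * lmult a"
    using kB by (simp add: alg.ops.st_mult lmult_op op_star_lmult mult.assoc)
  also have "\<dots> = lmult (star a * a - star a * c * a)"
    unfolding k(2) by (simp add: lmult_diff lmult_mult left_diff_distrib right_diff_distrib mult.assoc)
  finally show ?thesis by (simp add: pos_def)
qed

context hilbert_module
begin

lemma pos_ip: "pos (ip x x)"
  by (rule positive_imp_pos[OF ip_positive])

text \<open>Scale \<open>y\<close> to a vector \<open>u\<close> of norm \<open>1\<close> and put \<open>b = (u|x)\<close>. In the expansion of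
  \<open>(x - u b|x - u b)\<close> the term \<open>b\<^sup>* (u|u) b\<close> is at most \<open>b\<^sup>* b\<close>, so \<open>b\<^sup>* b \<le> (x|x)\<close>.\<close>

lemma cauchy_schwarz: "norm (ip x y) \<le> norm x * norm y"
proof (cases "y = 0")
  case False
  define u where "u = (1 / norm y) *\<^sub>R y"
  have nu: "norm u = 1" using False by (simp add: u_def)
  define b where "b = ip u x"
  define c where "c = ip u u"
  define z where "z = x - hact E u b"
  have c: "pos c" "norm c \<le> 1" using norm_ip[of u] nu by (simp_all add: c_def pos_ip)
  have "ip z z = ip x x - star b * b - star b * b + star b * c * b"
    unfolding z_def ip_diff ip_act_left ip_act_right
    by (simp add: algebra_simps b_def c_def ip_star)
  then have eq: "ip x x = star b * b + (ip z z + (star b * b - star b * c * b))" by simp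
  have "norm (star b * b) \<le> norm (ip x x)" unfolding eq
    by (intro pos_norm_mono pos_add pos_ip pos_star_mult pos_conj_contraction c)
  then have "(norm b)\<^sup>2 \<le> (norm x)\<^sup>2" by (simp add: cstar_identity norm_ip)
  then have "norm b \<le> norm x" by simp
  moreover have "norm b = norm (ip x u)" by (metis b_def ip_star norm_star)
  moreover have "ip x y = norm y *\<^sub>R ip x u" using False by (simp add: u_def ip_scaleR_right)
  ultimately show ?thesis by (simp add: mult_left_mono mult.commute[of "norm x"])
qed simp

end

sublocale hilbert_module \<subseteq> hilbert_module_cs E
  by unfold_locales (rule cauchy_schwarz)

context hilbert_module
begin

text \<open>As in the proof that \<open>b\<^sup>* b\<close> is positive, let \<open>g = \<bar>T\<bar> - T\<close>. Then \<open>(g x|T g x)\<close> is positive by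
  assumption and negative because \<open>T g = - \<bar>T\<bar> g\<close>.\<close>

lemma npos_of_pos:
  assumes T: "ops.sa T" and pos: "\<And>x. pos (ip x (bop_apply T x))"
  shows "ops.npos T"
proof -
  obtain a where a: "ops.npos a" "a * a = T * T" "\<And>y. y * T = T * y \<Longrightarrow> y * a = a * y"
    using ops.npos_abs[OF T] by blast
  obtain k where k: "ops.npos k" "k * k = a" "\<And>y. y * a = a * y \<Longrightarrow> y * k = k * y"
    using ops.npos_sqrt[OF a(1)] by blast
  have aT: "T * a = a * T" by (rule a(3)) simp
  define g where "g = a - T"
  have g: "ops.sa g" unfolding g_def by (intro ops.sa_diff ops.npos_sa a(1) T)
  have Tg: "T * g = - (a * g)" by (simp add: g_def algebra_simps aT a(2))
  have kB: "k \<in> adjointable_ops" "op_star k = k" using ops.npos_sa[OF k(1)] by (auto simp: ops.sa_def)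
  have "bop_apply (k * g) x = 0" for x
  proof -
    let ?y = "bop_apply g x"
    let ?z = "bop_apply k ?y"
    have "bop_apply T ?y = - bop_apply a ?y" using arg_cong[OF Tg, of "\<lambda>S. bop_apply S x"] by simp
    then have "ip ?y (bop_apply T ?y) = - ip ?y (bop_apply k ?z)"
      by (simp add: ip_minus k(2)[symmetric])
    also have "ip ?y (bop_apply k ?z) = ip ?z ?z" using op_star_left[OF kB(1)] kB(2) by simp
    finally have "ip ?z ?z + ip ?y (bop_apply T ?y) = 0" by simp
    from pos_add_eq_0[OF pos_ip pos this] show ?thesis by (simp add: ip_self_eq_0)
  qed
  then have "k * g = 0" by (intro bop_eqI) simp
  then have ag: "a * g = 0" by (simp add: k(2)[symmetric] mult.assoc)
  then have "g * g = 0" using Tg by (subst (1) g_def) (simp add: left_diff_distrib)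
  then have "g = 0" using ops.norm_sa_square[OF g] by simp
  with a(1) show ?thesis by (simp add: g_def)
qed

end

section \<open>Uniform boundedness, adjoint pairs and frames\<close>

text \<open>By Baire's theorem some set of points at which the whole family is bounded by \<open>n\<close> contains a ball.
  Translating the ball to the origin at most doubles the bound.\<close>

lemma uniform_boundedness:
  fixes F :: "('x::banach \<Rightarrow> 'y::real_normed_vector) set"
  assumes lin: "\<And>f. f \<in> F \<Longrightarrow> bounded_linear f"
    and bdd: "\<And>x. \<exists>K. \<forall>f\<in>F. norm (f x) \<le> K"
  obtains C where "0 \<le> C" "\<And>f x. f \<in> F \<Longrightarrow> norm (f x) \<le> C * norm x"
proof -
  define A where "A n = {x. \<forall>f\<in>F. norm (f x) \<le> real n}" for n :: nat
  have closed_A: "closed (A n)" for n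
  proof -
    have "closed {x. norm (f x) \<le> real n}" if "f \<in> F" for f
      by (intro closed_Collect_le continuous_intros linear_continuous_on lin that)
    moreover have "A n = (\<Inter>f\<in>F. {x. norm (f x) \<le> real n})" by (auto simp: A_def)
    ultimately show ?thesis by auto
  qed
  have "\<exists>n. interior (A n) \<noteq> {}"
  proof (rule ccontr)
    assume neg: "\<nexists>n. interior (A n) \<noteq> {}"
    have "Met_TC.mtopology closure_of (\<Inter>(range (\<lambda>n. - A n))) = UNIV"
    proof (rule Met_TC.metric_Baire_category)
      show "Met_TC.mcomplete TYPE('x)" using complete_UNIV by simp
      fix T assume "T \<in> range (\<lambda>n. - A n)"
      then obtain n where "T = - A n" by blast
      with neg closed_A[of n] show "openin Met_TC.mtopology T \<and> Met_TC.mtopology closure_of T = UNIV"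
        by (simp add: closure_complement open_Compl)
    qed auto
    then have "closure (\<Inter>(range (\<lambda>n. - A n))) \<noteq> {}" by simp
    then obtain x where "x \<in> \<Inter>(range (\<lambda>n. - A n))"
      by (metis closure_empty equals0I)
    moreover obtain K where "\<forall>f\<in>F. norm (f x) \<le> K" using bdd by blast
    then have "x \<in> A (nat \<lceil>K\<rceil>)" unfolding A_def using real_nat_ceiling_ge[of K] by (auto intro: order_trans)
    ultimately show False by auto
  qed
  then obtain n x0 where "x0 \<in> interior (A n)" by auto
  then obtain e where e: "e > 0" "cball x0 e \<subseteq> A n" by (auto simp: mem_interior_cball)
  show ?thesis
  proof (rule that[of "2 * real n / e"])
    fix f x assume f: "f \<in> F"
    show "norm (f x) \<le> 2 * real n / e * norm x"
    proof (cases "x = 0")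
      case True
      then show ?thesis by (simp add: linear_0[OF bounded_linear.linear[OF lin[OF f]]])
    next
      case False
      define y where "y = (e / norm x) *\<^sub>R x"
      have "norm y = e" using False e by (simp add: y_def)
      then have "x0 + y \<in> cball x0 e" "x0 \<in> cball x0 e" using e(1) by (simp_all add: dist_norm)
      then have "x0 + y \<in> A n" "x0 \<in> A n" using e(2) by blast+
      then have 1: "norm (f (x0 + y)) \<le> n" "norm (f x0) \<le> n" using f by (auto simp: A_def)
      have "f y = f (x0 + y) - f x0" by (simp add: linear_add[OF bounded_linear.linear[OF lin[OF f]]])
      then have "norm (f y) \<le> 2 * real n" using 1 norm_triangle_ineq4[of "f (x0 + y)" "f x0"] by simp
      moreover have "f y = (e / norm x) *\<^sub>R f x"
        unfolding y_def by (rule linear_scale[OF bounded_linear.linear[OF lin[OF f]]])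
      ultimately have "e / norm x * norm (f x) \<le> 2 * real n" using e by simp
      then show ?thesis using False e by (simp add: field_simps)
    qed
  qed (use e in simp)
qed

text \<open>A Hilbert module up to equivalence of norms: the norm of the type may exceed the norm given by the
  inner product by a bounded factor. Besides Hilbert modules this covers \<open>E \<oplus> A\<close>, which carries the
  Euclidean norm of the product type. The laws for the action follow from those for the inner
  product.\<close>

locale hmod_like =
  fixes X :: "('a::cstar_algebra, 'x::{banach, complex_vector}) hmod"
  assumes carrier: "hcarrier X = UNIV"
    and scaleR_eq_scaleC: "r *\<^sub>R (x :: 'x) = complex_of_real r *\<^sub>C x"
    and ip_add_right: "hip X x (y + z) = hip X x y + hip X x z"
    and ip_scaleC_right: "hip X x (c *\<^sub>C y) = c *\<^sub>C hip X x y"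
    and ip_act_right: "hip X x (hact X y a) = hip X x y * a"
    and ip_star: "star (hip X x y) = hip X y x"
    and cauchy_schwarz: "norm (hip X x y) \<le> norm x * norm y"
    and norm_le_ip: "(norm x)\<^sup>2 \<le> 2 * norm (hip X x x)"
begin

lemma ip_add_left: "hip X (x + y) z = hip X x z + hip X y z"
  by (metis ip_add_right ip_star star_add)

lemma ip_scaleC_left: "hip X (c *\<^sub>C x) y = cnj c *\<^sub>C hip X x y"
  by (metis ip_scaleC_right ip_star star_scaleC)

lemma ip_scaleR: "hip X (r *\<^sub>R x) y = r *\<^sub>R hip X x y" "hip X x (r *\<^sub>R y) = r *\<^sub>R hip X x y"
  by (simp_all add: scaleR_eq_scaleC scaleR_scaleC ip_scaleC_left ip_scaleC_right)

lemma ip_act_left: "hip X (hact X x a) y = star a * hip X x y"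
  by (metis ip_act_right ip_star star_mult star_star)

lemma ip_zero [simp]: "hip X 0 y = 0" "hip X x 0 = 0"
  using ip_scaleR(1)[of 0 0 y] ip_scaleR(2)[of x 0 0] by simp_all

lemma ip_diff: "hip X (x - z) y = hip X x y - hip X z y" "hip X x (y - w) = hip X x y - hip X x w"
  using ip_add_left[of "x - z" z y] ip_add_right[of x "y - w" w] by (simp_all add: algebra_simps)

lemma ip_sum_right: "hip X x (\<Sum>i\<in>I. f i) = (\<Sum>i\<in>I. hip X x (f i))"
  by (induction I rule: infinite_finite_induct) (auto simp: ip_add_right)

lemma ip_eqI: "(\<And>y. hip X y x = hip X y z) \<Longrightarrow> x = z"
  using norm_le_ip[of "x - z"] by (simp add: ip_diff)

lemma bounded_linear_ip: "bounded_linear (hip X x)"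
  by (rule bounded_linear_intro[where K = "norm x"])
    (auto simp: ip_add_right ip_scaleR cauchy_schwarz mult.commute[of "norm _" "norm x"])

lemma act_add_left: "hact X (x + y) a = hact X x a + hact X y a"
  by (rule ip_eqI) (simp add: ip_act_right ip_add_right algebra_simps)

lemma act_add_right: "hact X x (a + b) = hact X x a + hact X x b"
  by (rule ip_eqI) (simp add: ip_act_right ip_add_right algebra_simps)

lemma act_diff_left: "hact X (x - y) a = hact X x a - hact X y a"
  by (rule ip_eqI) (simp add: ip_act_right ip_diff algebra_simps)

lemma act_act: "hact X (hact X x a) b = hact X x (a * b)"
  by (rule ip_eqI) (simp add: ip_act_right mult.assoc)

lemma act_scaleC: "hact X (c *\<^sub>C x) a = c *\<^sub>C hact X x a" "hact X x (c *\<^sub>C a) = c *\<^sub>C hact X x a"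
  by (rule ip_eqI, simp add: ip_act_right ip_scaleC_right mult_scaleC_left mult_scaleC_right)+

lemma act_zero [simp]: "hact X 0 a = 0" "hact X x 0 = 0"
  by (rule ip_eqI, simp add: ip_act_right)+

lemma norm_act_le: "norm (hact X x a) \<le> 2 * norm x * norm a"
proof -
  let ?y = "hact X x a"
  have "(norm ?y)\<^sup>2 \<le> 2 * norm (star a * hip X x ?y)" using norm_le_ip[of ?y] by (simp add: ip_act_left)
  also have "\<dots> \<le> 2 * (norm a * (norm x * norm ?y))"
    by (intro mult_left_mono order_trans[OF norm_mult_ineq]) (auto simp: norm_star intro!: mult_left_mono cauchy_schwarz)
  finally have "norm ?y * norm ?y \<le> (2 * norm x * norm a) * norm ?y" by (simp add: power2_eq_square algebra_simps)
  then show ?thesis by (cases "?y = 0") auto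
qed

lemma bounded_bilinear_act: "bounded_bilinear (hact X)"
proof (rule bounded_bilinear.intro)
  show "hact X (r *\<^sub>R x) a = r *\<^sub>R hact X x a" "hact X x (r *\<^sub>R a) = r *\<^sub>R hact X x a" for r x a
    by (simp_all add: scaleR_eq_scaleC scaleR_scaleC act_scaleC)
  show "\<exists>K. \<forall>x a. norm (hact X x a) \<le> norm x * norm a * K"
    by (rule exI[of _ 2]) (use norm_act_le in \<open>simp add: mult.commute mult.left_commute\<close>)
qed (simp_all add: act_add_left act_add_right)

end

lemma is_adjoint_sym:
  assumes "hmod_like X" "hmod_like Y" "is_adjoint X Y T S"
  shows "is_adjoint Y X S T"
proof -
  interpret X: hmod_like X by fact
  interpret Y: hmod_like Y by fact
  from assms(3) show ?thesis
    unfolding is_adjoint_def by (metis X.ip_star Y.ip_star UNIV_I X.carrier Y.carrier)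
qed

text \<open>Adjointability alone forces linearity and, by uniform boundedness, continuity.\<close>

locale adjoint_pair = X: hmod_like X + Y: hmod_like Y
  for X :: "('a::cstar_algebra, 'x::{banach, complex_vector}) hmod"
    and Y :: "('a, 'y::{banach, complex_vector}) hmod" +
  fixes T S
  assumes is_adjoint: "is_adjoint X Y T S"
begin

lemma adj_eq: "hip Y (T x) y = hip X x (S y)"
  using is_adjoint by (simp add: is_adjoint_def X.carrier Y.carrier)

lemma adj_eq': "hip Y y (T x) = hip X (S y) x"
  by (metis X.ip_star Y.ip_star adj_eq)

lemma add: "T (x + x') = T x + T x'"
  by (rule Y.ip_eqI) (simp add: adj_eq' Y.ip_add_right X.ip_add_right)

lemma scaleC: "T (c *\<^sub>C x) = c *\<^sub>C T x"
  by (rule Y.ip_eqI) (simp add: adj_eq' Y.ip_scaleC_right X.ip_scaleC_right)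

lemma scaleR: "T (r *\<^sub>R x) = r *\<^sub>R T x"
  by (simp add: X.scaleR_eq_scaleC Y.scaleR_eq_scaleC scaleC)

lemma act: "T (hact X x a) = hact Y (T x) a"
  by (rule Y.ip_eqI) (simp add: adj_eq' Y.ip_act_right X.ip_act_right)

lemma zero: "T 0 = 0"
  using scaleR[of 0 0] by simp

text \<open>The maps \<open>y \<mapsto> (T x|y) = (x|S y)\<close> with \<open>\<parallel>x\<parallel> \<le> 1\<close> are pointwise bounded by \<open>\<parallel>S y\<parallel>\<close>, hence uniformly
  bounded.\<close>

lemma bounded_linear: "bounded_linear T"
proof -
  obtain C where C: "0 \<le> C" "\<And>f y. f \<in> (\<lambda>x. hip Y (T x)) ` {x. norm x \<le> 1} \<Longrightarrow> norm (f y) \<le> C * norm y"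
  proof (rule uniform_boundedness[of "(\<lambda>x. hip Y (T x)) ` {x. norm x \<le> 1}"])
    show "bounded_linear f" if "f \<in> (\<lambda>x. hip Y (T x)) ` {x. norm x \<le> 1}" for f
      using that Y.bounded_linear_ip by auto
    fix y
    have "norm (hip Y (T x) y) \<le> norm (S y)" if "norm x \<le> 1" for x
    proof -
      have "norm (hip Y (T x) y) \<le> norm x * norm (S y)" unfolding adj_eq by (rule X.cauchy_schwarz)
      also have "\<dots> \<le> 1 * norm (S y)" by (intro mult_right_mono that) simp
      finally show ?thesis by simp
    qed
    then show "\<exists>K. \<forall>f\<in>(\<lambda>x. hip Y (T x)) ` {x. norm x \<le> 1}. norm (f y) \<le> K" by auto
  qed (rule that)
  have unit: "norm (T x) \<le> 2 * C" if "norm x \<le> 1" for x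
  proof -
    have "norm (hip Y (T x) (T x)) \<le> C * norm (T x)" using C(2)[of "hip Y (T x)" "T x"] that by blast
    with Y.norm_le_ip[of "T x"] have "norm (T x) * norm (T x) \<le> (2 * C) * norm (T x)"
      by (simp add: power2_eq_square)
    then show ?thesis using C(1) by (cases "T x = 0") auto
  qed
  show ?thesis
  proof (rule bounded_linear_intro)
    fix x
    show "norm (T x) \<le> norm x * (2 * C)"
    proof (cases "x = 0")
      case False
      have "norm (T ((1 / norm x) *\<^sub>R x)) \<le> 2 * C" by (rule unit) (use False in simp)
      then show ?thesis using False by (simp add: scaleR field_simps)
    qed (simp add: zero)
  qed (auto simp: add scaleR)
qed

end

sublocale hilbert_module \<subseteq> like: hmod_like E
  by unfold_locales
    ((rule carrier scaleR_scaleC ip_add_right ip_scaleC_right ip_act_right ip_star cauchy_schwarz)+,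
     simp only: norm_ip mult_2 le_add_same_cancel1 norm_ge_zero)

lemma adjoint_pairI:
  "hmod_like X \<Longrightarrow> hmod_like Y \<Longrightarrow> is_adjoint X Y T S \<Longrightarrow> adjoint_pair X Y T S"
  by (simp add: adjoint_pair_def adjoint_pair_axioms_def)

context hilbert_module
begin

abbreviation hom_adj :: "('a \<Rightarrow> 'e) \<Rightarrow> ('e \<Rightarrow> 'a) \<Rightarrow> bool" where
  "hom_adj \<equiv> is_adjoint alg_mod E"

lemma hom_adj_iff: "hom_adj t s \<longleftrightarrow> (\<forall>a x. ip (t a) x = star a * s x)"
  by (simp add: is_adjoint_def carrier alg.carrier) (simp add: alg_mod_def)

lemma hom_adj_left: "hom_adj t s \<Longrightarrow> ip (t a) x = star a * s x"
  by (simp add: hom_adj_iff)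

lemma hom_adj_right: "hom_adj t s \<Longrightarrow> ip x (t a) = star (s x) * a"
  by (metis hom_adj_left ip_star star_mult star_star)

lemma hom_pair: "hom_adj t s \<Longrightarrow> adjoint_pair alg_mod E t s"
  by (rule adjoint_pairI[OF alg.like.hmod_like_axioms like.hmod_like_axioms])

lemma hom_pair': "hom_adj t s \<Longrightarrow> adjoint_pair E alg_mod s t"
  by (rule adjoint_pairI[OF like.hmod_like_axioms alg.like.hmod_like_axioms
      is_adjoint_sym[OF alg.like.hmod_like_axioms like.hmod_like_axioms]])

lemma hom_adj_vector: "hom_adj (hact E z) (ip z)"
  by (simp add: hom_adj_iff ip_act_left)

lemma hom_adj_compose_op:
  assumes "hom_adj t s" "T \<in> adjointable_ops"
  shows "hom_adj (\<lambda>a. bop_apply T (t a)) (\<lambda>x. s (bop_apply (op_star T) x))"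
  using assms by (simp add: hom_adj_iff op_star_right)

text \<open>The map \<open>gs i\<close> is the adjoint of \<open>g i\<close>. It is carried along explicitly, which spares a choice of
  adjoints.\<close>

definition parseval_frame :: "nat \<Rightarrow> (nat \<Rightarrow> 'a \<Rightarrow> 'e) \<Rightarrow> (nat \<Rightarrow> 'e \<Rightarrow> 'a) \<Rightarrow> bool" where
  "parseval_frame n g gs \<longleftrightarrow> (\<forall>i<n. hom_adj (g i) (gs i)) \<and> (\<forall>x. (\<Sum>i<n. g i (gs i x)) = x)"

text \<open>Since \<open>(x|S x) = \<Sum> (g\<^sub>i\<^sup>* x)\<^sup>* (g\<^sub>i\<^sup>* x)\<close> dominates each summand, \<open>\<parallel>g\<^sub>i\<^sup>* x\<parallel>\<^sup>2 \<le> \<parallel>x\<parallel> \<parallel>(l + S) x\<parallel>\<close> for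
  \<open>l \<ge> 0\<close>. So \<open>l + S\<close> is bounded below uniformly in \<open>l\<close> and \<open>S\<close> is invertible. Its root is
  invertible as well, and \<open>c = S\<^sup>-\<^sup>1\<^sup>/\<^sup>2\<close> turns \<open>g\<close> into a Parseval frame because \<open>c S c = 1\<close>.\<close>

theorem parseval_of_bounded_below:
  assumes g: "\<And>i. i < n \<Longrightarrow> hom_adj (g i) (gs i)"
    and d: "0 < d" "\<And>x. d * norm x \<le> (\<Sum>i<n. norm (gs i x))"
  shows "\<exists>g gs. parseval_frame n g gs"
proof -
  let ?S = "\<lambda>x. \<Sum>i<n. g i (gs i x)"
  have bl: "bounded_linear ?S"
    by (intro bounded_linear_sum bounded_linear_compose[OF
        adjoint_pair.bounded_linear[OF hom_pair[OF g]] adjoint_pair.bounded_linear[OF hom_pair'[OF g]]]) auto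
  define S where "S = bop_of ?S"
  have S_apply: "bop_apply S x = ?S x" for x by (simp add: S_def bop_apply_of bl)
  have ip_S: "ip x (bop_apply S y) = (\<Sum>i<n. star (gs i x) * gs i y)" for x y
    by (simp add: S_apply like.ip_sum_right hom_adj_right[OF g])
  have S_adj: "ip (bop_apply S x) y = ip x (bop_apply S y)" for x y
    by (subst ip_star[symmetric]) (simp add: ip_S star_sum star_mult star_star)
  have SB: "S \<in> adjointable_ops" by (rule adjointable_opsI[OF S_adj])
  have S_sa: "ops.sa S" using SB op_star_eqI[OF S_adj] by (simp add: ops.sa_def)
  have pos_S: "pos (ip x (bop_apply S x))" for x
    unfolding ip_S by (intro pos_sum pos_star_mult)
  \<comment> \<open>The summand \<open>1\<close> in the denominator covers \<open>n = 0\<close>.\<close>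
  have below: "d\<^sup>2 / (real n ^ 2 + 1) * norm x \<le> norm (bop_apply (l *\<^sub>R 1 + S) x)" if l: "0 \<le> l" for l x
  proof -
    define N where "N = norm (bop_apply (l *\<^sub>R 1 + S) x)"
    have N0: "0 \<le> N" by (simp add: N_def)
    have "ip x (bop_apply (l *\<^sub>R 1 + S) x) = ip x (bop_apply S x) + l *\<^sub>R ip x x"
      by (simp add: ip_add_right ip_scaleR_right)
    then have "norm (ip x (bop_apply S x)) \<le> norm (ip x (bop_apply (l *\<^sub>R 1 + S) x))"
      by (metis pos_norm_mono[OF pos_S pos_scaleR[OF pos_ip l]])
    also have "\<dots> \<le> norm x * N" unfolding N_def by (rule cauchy_schwarz)
    finally have le: "norm (ip x (bop_apply S x)) \<le> norm x * N" .
    have each: "norm (gs i x) \<le> sqrt (norm x * N)" if i: "i < n" for i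
    proof -
      have "(norm (gs i x))\<^sup>2 = norm (star (gs i x) * gs i x)" by (simp add: cstar_identity)
      also have "\<dots> \<le> norm (star (gs i x) * gs i x + (\<Sum>j\<in>{..<n} - {i}. star (gs j x) * gs j x))"
        by (intro pos_norm_mono pos_sum pos_star_mult)
      also have "\<dots> = norm (ip x (bop_apply S x))"
        unfolding ip_S using i by (simp add: sum.remove[of "{..<n}" i])
      finally have "(norm (gs i x))\<^sup>2 \<le> norm x * N" using le by simp
      then show ?thesis by (rule real_le_rsqrt)
    qed
    have "d * norm x \<le> (\<Sum>i<n. sqrt (norm x * N))"
      by (rule order_trans[OF d(2) sum_mono]) (use each in auto)
    also have "\<dots> = real n * sqrt (norm x * N)" by simp
    finally have "(d * norm x)\<^sup>2 \<le> (real n * sqrt (norm x * N))\<^sup>2"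
      using d(1) by (intro power_mono) auto
    then have "(d\<^sup>2 * norm x) * norm x \<le> (real n ^ 2 * N) * norm x"
      using N0 by (simp add: power_mult_distrib) (simp add: power2_eq_square algebra_simps)
    then have "d\<^sup>2 * norm x \<le> real n ^ 2 * N" using N0 by (cases "x = 0") auto
    also have "\<dots> \<le> (real n ^ 2 + 1) * N" by (intro mult_right_mono N0) auto
    finally have "d\<^sup>2 * norm x \<le> (real n ^ 2 + 1) * N" .
    moreover have "real n ^ 2 + 1 > 0" by (simp add: add_nonneg_pos)
    ultimately show ?thesis unfolding N_def[symmetric] by (simp add: divide_le_eq mult.commute)
  qed
  let ?d = "d\<^sup>2 / (real n ^ 2 + 1)"
  have d0: "0 < ?d" using d(1) by (simp add: add_nonneg_pos)
  have "?d * norm w \<le> norm ((l *\<^sub>R 1 + S) * w)" if "0 \<le> l" for l w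
  proof -
    have "norm w \<le> norm ((l *\<^sub>R 1 + S) * w) / ?d"
    proof (rule norm_bop_le)
      fix x
      have "?d * norm (bop_apply w x) \<le> norm (bop_apply ((l *\<^sub>R 1 + S) * w) x)"
        using below[OF that, of "bop_apply w x"] by simp
      also have "\<dots> \<le> norm ((l *\<^sub>R 1 + S) * w) * norm x" by (rule norm_bop)
      finally show "norm (bop_apply w x) \<le> norm ((l *\<^sub>R 1 + S) * w) / ?d * norm x"
        using d0 by (metis mult.commute pos_le_divide_eq times_divide_eq_left)
    qed (use d0 in simp)
    then show ?thesis using d0 by (metis mult.commute pos_le_divide_eq)
  qed
  then obtain w where w: "w \<in> adjointable_ops" "w * S = 1" "S * w = 1"
    using ops.bounded_below_invertible[OF SB d0] by blast
  obtain b where b: "ops.npos b" "b * b = S" "\<And>y. y * S = S * y \<Longrightarrow> y * b = b * y"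
    using ops.npos_sqrt[OF npos_of_pos[OF S_sa pos_S]] by blast
  have bB: "b \<in> adjointable_ops" "op_star b = b" using ops.npos_sa[OF b(1)] by (auto simp: ops.sa_def)
  have wb: "w * b = b * w" by (rule b(3)) (simp add: w)
  define c where "c = b * w"
  have cB: "c \<in> adjointable_ops" unfolding c_def by (intro ops.B_mult bB w)
  have "op_star w * op_star S = 1"
    using ops.st_mult[OF SB w(1)] by (simp add: w(3) ops.st_one)
  then have "op_star w * S = 1" using S_sa by (simp add: ops.sa_def)
  then have "op_star w = w" by (metis w(3) mult.assoc mult_1 mult_1_right)
  then have c_star: "op_star c = c" by (simp add: c_def ops.st_mult bB w wb)
  have "c * S * c = b * (w * S) * (b * w)" by (simp add: c_def mult.assoc)
  then have cSc: "c * S * c = 1" by (simp add: w mult.assoc[symmetric] b(2))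
  have "parseval_frame n (\<lambda>i a. bop_apply c (g i a)) (\<lambda>i x. gs i (bop_apply c x))"
    unfolding parseval_frame_def
  proof (intro conjI allI impI)
    fix i assume "i < n"
    then show "hom_adj (\<lambda>a. bop_apply c (g i a)) (\<lambda>x. gs i (bop_apply c x))"
      using hom_adj_compose_op[OF g cB] by (simp add: c_star)
  next
    fix x
    have "(\<Sum>i<n. bop_apply c (g i (gs i (bop_apply c x)))) = bop_apply c (?S (bop_apply c x))"
      by (simp add: linear_sum[OF bounded_linear.linear[OF bounded_linear_bop]])
    also have "\<dots> = bop_apply (c * S * c) x" by (simp add: S_apply)
    finally show "(\<Sum>i<n. bop_apply c (g i (gs i (bop_apply c x)))) = x" by (simp add: cSc)
  qed
  then show ?thesis by blast
qed

text \<open>For \<open>z\<close> in \<open>E\<close> the map \<open>a \<mapsto> z a\<close> lies in \<open>Hom(A,E)\<close>, so \<open>z a = \<Sum> g\<^sub>i (m\<^sub>i a)\<close> with multipliers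
  \<open>m\<^sub>i\<close>. If all \<open>\<parallel>g\<^sub>i\<^sup>* x\<parallel> \<le> 1\<close>, then \<open>\<parallel>(x|z) a\<parallel> \<le> \<Sum> \<parallel>m\<^sub>i\<parallel> \<parallel>a\<parallel>\<close>, a bound that does not depend on \<open>x\<close>.
  By uniform boundedness such \<open>x\<close> form a bounded set.\<close>

theorem bounded_below_of_generating:
  fixes n :: nat
  assumes g: "\<And>i. i < n \<Longrightarrow> hom_adj (g i) (gs i)"
    and gen: "\<And>t s. hom_adj t s \<Longrightarrow> \<exists>m. (\<forall>i<n. m i \<in> Mult) \<and> (\<forall>a. t a = (\<Sum>i<n. g i (m i a)))"
  shows "\<exists>d>0. \<forall>x. d * norm x \<le> (\<Sum>i<n. norm (gs i x))"
proof -
  let ?q = "\<lambda>x. \<Sum>i<n. norm (gs i x)"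
  obtain C where C: "0 \<le> C" "\<And>f z. f \<in> ip ` {x. ?q x \<le> 1} \<Longrightarrow> norm (f z) \<le> C * norm z"
  proof (rule uniform_boundedness[of "ip ` {x. ?q x \<le> 1}"])
    show "bounded_linear f" if "f \<in> ip ` {x. ?q x \<le> 1}" for f
      using that like.bounded_linear_ip by auto
    fix z
    obtain m where m: "\<And>i. i < n \<Longrightarrow> m i \<in> Mult" "\<And>a. hact E z a = (\<Sum>i<n. g i (m i a))"
      using gen[OF hom_adj_vector[of z]] by blast
    have "\<exists>K\<ge>0. \<forall>a. norm (m i a) \<le> K * norm a" if i: "i < n" for i
    proof -
      obtain ms where "is_adjoint alg_mod alg_mod (m i) ms" using m(1)[OF i] by (auto simp: Mult_def End_def)
      then have "bounded_linear (m i)"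
        by (rule adjoint_pair.bounded_linear[OF adjoint_pairI[OF alg.like.hmod_like_axioms alg.like.hmod_like_axioms]])
      then show ?thesis by (metis bounded_linear.nonneg_bounded mult.commute)
    qed
    then obtain K where K: "\<And>i. i < n \<Longrightarrow> 0 \<le> K i" "\<And>i a. i < n \<Longrightarrow> norm (m i a) \<le> K i * norm a" by metis
    have "norm (ip x z) \<le> (\<Sum>i<n. K i)" if x: "?q x \<le> 1" for x
    proof -
      have gs1: "norm (gs i x) \<le> 1" if "i < n" for i
        using member_le_sum[of i "{..<n}" "\<lambda>i. norm (gs i x)"] that x by simp
      have "norm (lmult (ip x z)) \<le> (\<Sum>i<n. K i)"
      proof (rule norm_bop_le)
        show "0 \<le> (\<Sum>i<n. K i)" using K(1) by (intro sum_nonneg) auto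
        fix a
        have "ip x z * a = (\<Sum>i<n. star (gs i x) * m i a)"
          unfolding ip_act_right[symmetric] m(2) like.ip_sum_right
          by (intro sum.cong hom_adj_right g) auto
        also have "norm \<dots> \<le> (\<Sum>i<n. 1 * (K i * norm a))"
          by (intro order_trans[OF norm_sum] sum_mono order_trans[OF norm_mult_ineq] mult_mono)
            (auto simp: norm_star gs1 K)
        finally show "norm (bop_apply (lmult (ip x z)) a) \<le> (\<Sum>i<n. K i) * norm a"
          by (simp add: sum_distrib_right)
      qed
      then show ?thesis by (simp add: norm_lmult)
    qed
    then show "\<exists>K. \<forall>f\<in>ip ` {x. ?q x \<le> 1}. norm (f z) \<le> K" by auto
  qed (rule that)
  have unit: "norm x \<le> C" if "?q x \<le> 1" for x
  proof -
    have "norm x * norm x \<le> C * norm x" using C(2)[of "ip x" x] that norm_ip[of x] by (auto simp: power2_eq_square)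
    then show ?thesis using C(1) by (cases "x = 0") auto
  qed
  have scale: "?q (r *\<^sub>R x) = \<bar>r\<bar> * ?q x" for r x
    unfolding sum_distrib_left
    by (rule sum.cong) (auto simp: adjoint_pair.scaleR[OF hom_pair'[OF g]])
  have q0: "0 \<le> ?q x" for x by (intro sum_nonneg) auto
  \<comment> \<open>The constant \<open>C\<close> may be \<open>0\<close>, and \<open>d = 1/(C + 1)\<close> below needs a positive one.\<close>
  have main: "norm x \<le> (C + 1) * ?q x" for x
  proof (cases "?q x = 0")
    case True
    have "norm (r *\<^sub>R x) \<le> C" for r by (rule unit) (unfold scale True, simp)
    from this[of "(C + 1) / norm x"] have "x = 0" using C(1) by (cases "x = 0") auto
    then show ?thesis using C(1) q0 by simp
  next
    case False
    with q0[of x] have q: "?q x > 0" by linarith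
    have "norm ((1 / ?q x) *\<^sub>R x) \<le> C" by (rule unit) (unfold scale, use q in simp)
    then have "norm x \<le> C * ?q x" using q by (simp add: field_simps)
    also have "\<dots> \<le> (C + 1) * ?q x" using q by (intro mult_right_mono) auto
    finally show ?thesis .
  qed
  show ?thesis
    by (rule exI[of _ "1 / (C + 1)"]) (use main C(1) in \<open>auto simp: divide_le_eq mult.commute\<close>)
qed

end

section \<open>The multiplier module as a space of adjointable maps\<close>

lemma approximate_unit:
  assumes "sigma_unital TYPE('a::cstar_algebra)"
  obtains u :: "nat \<Rightarrow> 'a::cstar_algebra" where "\<And>n. star (u n) = u n" "\<And>n. norm (u n) \<le> 1"
    "\<And>a. (\<lambda>n. a * u n) \<longlonglongrightarrow> a"
proof -
  from assms obtain u :: "nat \<Rightarrow> 'a" where u: "\<And>n. positive (u n)" "\<And>n. norm (u n) \<le> 1"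
    "\<And>a. (\<lambda>n. a * u n) \<longlonglongrightarrow> a"
    unfolding sigma_unital_def by blast
  have "star (u n) = u n" for n using u(1)[of n] by (auto simp: positive_def star_mult star_star)
  with u show ?thesis using that by blast
qed

lemma Cauchy_of_harmonic_bound:
  fixes v :: "nat \<Rightarrow> 'x::real_normed_vector"
  assumes diff: "\<And>n m. norm (v n - v m) \<le> 1 / real (Suc n) + 1 / real (Suc m)"
  shows "Cauchy v"
proof (rule metric_CauchyI)
  fix e :: real assume "0 < e"
  then obtain N where N: "1 / real (Suc N) < e / 2" using nat_approx_posE[of "e / 2"] by auto
  have "dist (v m) (v n) < e" if "N \<le> m" "N \<le> n" for m n
  proof -
    have "1 / real (Suc m) \<le> 1 / real (Suc N)" "1 / real (Suc n) \<le> 1 / real (Suc N)"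
      using that by (simp_all add: frac_le)
    then show ?thesis using diff[of m n] N unfolding dist_norm by linarith
  qed
  then show "\<exists>M. \<forall>m\<ge>M. \<forall>n\<ge>M. dist (v m) (v n) < e" by blast
qed

lemma cstar_cancel_right:
  assumes "\<And>b. a * b = c * b" shows "a = (c :: 'a::cstar_algebra)"
proof -
  have "(a - c) * star (a - c) = 0" using assms by (simp add: left_diff_distrib)
  then have "star (a - c) = 0" using cstar_mult_eq_0[of "star (a - c)"] by (simp add: star_star)
  then have "star (star (a - c)) = 0" by simp
  then show ?thesis by (simp add: star_star)
qed

context hmod_like
begin

lemma is_adjoint_iff: "is_adjoint X X T S \<longleftrightarrow> (\<forall>x y. hip X (T x) y = hip X x (S y))"
  by (simp add: is_adjoint_def carrier)

lemma adj_eqI: "is_adjoint X X T S \<Longrightarrow> adj X T = S"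
  unfolding adj_def by (rule the_equality) (auto simp: is_adjoint_iff intro!: ext ip_eqI)

lemma EndI: "is_adjoint X X T S \<Longrightarrow> T \<in> End X"
  by (auto simp: End_def)

lemma adj_adjoint: "T \<in> End X \<Longrightarrow> is_adjoint X X T (adj X T)"
  using adj_eqI by (auto simp: End_def)

lemma End_pair: "T \<in> End X \<Longrightarrow> adjoint_pair X X T (adj X T)"
  by (rule adjoint_pairI[OF hmod_like_axioms hmod_like_axioms adj_adjoint])

lemma End_compose:
  assumes "T \<in> End X" "S \<in> End X" shows "T \<circ> S \<in> End X"
  using adj_adjoint[OF assms(1)] adj_adjoint[OF assms(2)]
  by (intro EndI[where S = "adj X S \<circ> adj X T"]) (simp add: is_adjoint_iff)

lemma act_cancel: "(\<And>b. hact X x b = hact X y b) \<Longrightarrow> x = y"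
  by (rule ip_eqI, rule cstar_cancel_right) (simp add: ip_act_right[symmetric])

lemma hnorm_le_norm: "hnorm X x \<le> norm x"
  using cauchy_schwarz[of x x] unfolding hnorm_def by (intro real_le_lsqrt) (auto simp: power2_eq_square)

lemma norm_le_hnorm: "norm x \<le> 2 * hnorm X x"
proof (rule power2_le_imp_le)
  have "(norm x)\<^sup>2 \<le> 2 * norm (hip X x x)" by (rule norm_le_ip)
  also have "\<dots> \<le> (2 * hnorm X x)\<^sup>2" by (simp add: hnorm_def power_mult_distrib)
  finally show "(norm x)\<^sup>2 \<le> (2 * hnorm X x)\<^sup>2" .
qed (simp add: hnorm_def)

lemma op_closure_iff:
  "T \<in> op_closure X Z \<longleftrightarrow> T \<in> End X \<and> (\<forall>e>0. \<exists>S\<in>Z. \<forall>x. norm (T x - S x) \<le> e * norm x)"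
proof -
  have 1: "norm (T x - S x) \<le> e * norm x" if "0 < e" "hnorm X (T x - S x) \<le> e / 2 * hnorm X x" for e S x
  proof -
    have "norm (T x - S x) \<le> 2 * (e / 2 * hnorm X x)"
      using norm_le_hnorm[of "T x - S x"] that(2) by linarith
    also have "\<dots> \<le> e * norm x" using hnorm_le_norm[of x] that(1) by simp
    finally show ?thesis .
  qed
  have 2: "hnorm X (T x - S x) \<le> e * hnorm X x" if "0 < e" "norm (T x - S x) \<le> e / 2 * norm x" for e S x
  proof -
    have "e / 2 * norm x \<le> e / 2 * (2 * hnorm X x)" using that(1) by (intro mult_left_mono norm_le_hnorm) simp
    then show ?thesis using hnorm_le_norm[of "T x - S x"] that(2) by simp
  qed
  show ?thesis
  proof
    assume T: "T \<in> op_closure X Z"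
    have "\<exists>S\<in>Z. \<forall>x. norm (T x - S x) \<le> e * norm x" if e: "0 < e" for e
    proof -
      obtain S where "S \<in> Z" "\<And>x. hnorm X (T x - S x) \<le> e / 2 * hnorm X x"
        using T half_gt_zero[OF e] unfolding op_closure_def carrier by blast
      with 1[OF e] show ?thesis by blast
    qed
    with T show "T \<in> End X \<and> (\<forall>e>0. \<exists>S\<in>Z. \<forall>x. norm (T x - S x) \<le> e * norm x)"
      by (simp add: op_closure_def)
  next
    assume T: "T \<in> End X \<and> (\<forall>e>0. \<exists>S\<in>Z. \<forall>x. norm (T x - S x) \<le> e * norm x)"
    have "\<exists>S\<in>Z. \<forall>x. hnorm X (T x - S x) \<le> e * hnorm X x" if e: "0 < e" for e
    proof -
      obtain S where "S \<in> Z" "\<And>x. norm (T x - S x) \<le> e / 2 * norm x"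
        using T half_gt_zero[OF e] by blast
      with 2[OF e] show ?thesis by blast
    qed
    with T show "T \<in> op_closure X Z" by (simp add: op_closure_def carrier)
  qed
qed

lemma op_closure_End: "op_closure X Z \<subseteq> End X"
  by (auto simp: op_closure_def)

lemma op_closure_superset: "Z \<subseteq> End X \<Longrightarrow> Z \<subseteq> op_closure X Z"
  by (force simp: op_closure_iff)

lemma op_closure_mono: "Z \<subseteq> Z' \<Longrightarrow> op_closure X Z \<subseteq> op_closure X Z'"
  by (force simp: op_closure_def)

lemma theta_apply: "theta X x y z = hact X x (hip X y z)"
  by (simp add: theta_def carrier)

abbreviation finite_rank :: "('x \<Rightarrow> 'x) set" where
  "finite_rank \<equiv> cvec.span {theta X x y | x y. x \<in> hcarrier X \<and> y \<in> hcarrier X}"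

lemma theta_finite_rank: "theta X x y \<in> finite_rank"
  by (rule cvec.span_base) (auto simp: carrier)

lemma finite_rank_induct [consumes 1, case_names zero add scale theta]:
  assumes "F \<in> finite_rank" "P 0" "\<And>F G. P F \<Longrightarrow> P G \<Longrightarrow> P (F + G)"
    "\<And>c F. P F \<Longrightarrow> P (c *\<^sub>C F)" "\<And>x y. P (theta X x y)"
  shows "P F"
proof (rule cvec.span_induct[OF assms(1)])
  show "cvec.subspace {F. P F}" using assms(2-4) by (auto simp: cvec.subspace_def)
qed (use assms(5) in auto)

lemma compose_finite_rank:
  assumes T: "T \<in> End X" and F: "F \<in> finite_rank" shows "T \<circ> F \<in> finite_rank"
proof -
  interpret T: adjoint_pair X X T "adj X T" by (rule End_pair[OF T])
  from F show ?thesis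
  proof (induction rule: finite_rank_induct)
    case zero
    have eq: "T \<circ> 0 = 0" by (rule ext) (simp add: T.zero)
    show ?case unfolding eq by (rule cvec.span_zero)
  next
    case (add F G)
    have eq: "T \<circ> (F + G) = (T \<circ> F) + (T \<circ> G)" by (rule ext) (simp add: T.add)
    show ?case unfolding eq by (intro cvec.span_add add)
  next
    case (scale c F)
    have eq: "T \<circ> (c *\<^sub>C F) = c *\<^sub>C (T \<circ> F)" by (rule ext) (simp add: T.scaleC scaleC_fun_def)
    show ?case unfolding eq by (intro cvec.span_scale scale)
  next
    case (theta x y)
    have eq: "T \<circ> theta X x y = theta X (T x) y" by (rule ext) (simp add: theta_apply T.act)
    show ?case unfolding eq by (rule theta_finite_rank)
  qed
qed

lemma End0_iff:
  "T \<in> End0 X \<longleftrightarrow> T \<in> End X \<and> (\<forall>e>0. \<exists>F\<in>finite_rank. \<forall>x. norm (T x - F x) \<le> e * norm x)"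
  unfolding End0_def op_closure_iff ..

lemma End0_End: "T \<in> End0 X \<Longrightarrow> T \<in> End X"
  by (simp add: End0_iff)

lemma End0_compose:
  assumes T: "T \<in> End X" and k: "k \<in> End0 X" shows "T \<circ> k \<in> End0 X"
  unfolding End0_iff
proof (intro conjI allI impI)
  interpret T: adjoint_pair X X T "adj X T" by (rule End_pair[OF T])
  show "T \<circ> k \<in> End X" by (intro End_compose T End0_End k)
  fix e :: real assume e: "0 < e"
  obtain B where B: "0 < B" "\<And>x. norm (T x) \<le> norm x * B"
    using bounded_linear.pos_bounded[OF T.bounded_linear] by blast
  obtain F where F: "F \<in> finite_rank" "\<And>x. norm (k x - F x) \<le> e / B * norm x"
    using k e B(1) unfolding End0_iff by (meson divide_pos_pos)
  show "\<exists>F\<in>finite_rank. \<forall>x. norm ((T \<circ> k) x - F x) \<le> e * norm x"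
  proof (intro bexI allI)
    fix x
    have "norm (T (k x) - T (F x)) = norm (T (k x - F x))"
      using linear_diff[OF bounded_linear.linear[OF T.bounded_linear]] by metis
    also have "\<dots> \<le> norm (k x - F x) * B" by (rule B(2))
    also have "\<dots> \<le> (e / B * norm x) * B" using F(2) B(1) by (intro mult_right_mono) auto
    finally show "norm ((T \<circ> k) x - (T \<circ> F) x) \<le> e * norm x" using B(1) by simp
  qed (rule compose_finite_rank[OF T F(1)])
qed

lemma zero_End0: "0 \<in> End0 X"
  unfolding End0_iff
  by (auto intro!: EndI[where S = 0] bexI[of _ 0] simp: is_adjoint_iff cvec.span_zero)

text \<open>With \<open>d = (x|x) - (x|x) u\<^sub>n\<close> the inner square of \<open>x - x u\<^sub>n\<close> is \<open>d - u\<^sub>n d\<close>.\<close>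

lemma act_approximate_unit:
  assumes u: "\<And>n. star (u n) = u n" "\<And>n. norm (u n) \<le> 1" "\<And>a. (\<lambda>n. a * u n) \<longlonglongrightarrow> a"
  shows "(\<lambda>n. hact X x (u n)) \<longlonglongrightarrow> x"
proof -
  define p where "p = hip X x x"
  have le: "(norm (x - hact X x (u n)))\<^sup>2 \<le> 4 * norm (p - p * u n)" for n
  proof -
    have "hip X (x - hact X x (u n)) (x - hact X x (u n)) = (p - p * u n) - u n * (p - p * u n)"
      by (simp add: ip_diff ip_act_left ip_act_right p_def u(1) algebra_simps)
    also have "norm \<dots> \<le> norm (p - p * u n) + norm (u n) * norm (p - p * u n)"
      by (intro order_trans[OF norm_triangle_ineq4] add_left_mono norm_mult_ineq)
    also have "\<dots> \<le> norm (p - p * u n) + 1 * norm (p - p * u n)"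
      by (intro add_left_mono mult_right_mono u) simp
    finally show ?thesis using norm_le_ip[of "x - hact X x (u n)"] by simp
  qed
  have "(\<lambda>n. 4 * norm (p - p * u n)) \<longlonglongrightarrow> 4 * norm (p - p)"
    by (intro tendsto_intros u)
  then have lim0: "(\<lambda>n. 4 * norm (p - p * u n)) \<longlonglongrightarrow> 0" by simp
  have "(\<lambda>n. (norm (x - hact X x (u n)))\<^sup>2) \<longlonglongrightarrow> 0"
    by (rule tendsto_sandwich[OF _ _ tendsto_const lim0]) (use le in auto)
  then have "(\<lambda>n. sqrt ((norm (x - hact X x (u n)))\<^sup>2)) \<longlonglongrightarrow> sqrt 0" by (rule tendsto_real_sqrt)
  then have "(\<lambda>n. x - hact X x (u n)) \<longlonglongrightarrow> 0" by (simp add: tendsto_norm_zero_iff)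
  from tendsto_diff[OF tendsto_const[of x] this] show ?thesis by simp
qed

end

lemma Mult_iff: "m \<in> Mult \<longleftrightarrow> (\<exists>n. \<forall>a b. star (m a) * b = star a * n b)"
  unfolding Mult_def End_def alg.like.is_adjoint_iff by (simp add: alg_mod_def)

context hilbert_module
begin

lemma EA_carrier: "hcarrier (EA E) = UNIV"
  by (simp add: hmod_sum_def carrier alg_mod_def)

lemma EA_hip: "hip (EA E) p q = ip (fst p) (fst q) + star (snd p) * snd q"
  by (simp add: hmod_sum_def alg_mod_def split_beta)

lemma EA_hact: "hact (EA E) p b = (hact E (fst p) b, snd p * b)"
  by (simp add: hmod_sum_def alg_mod_def split_beta)

sublocale EA: hmod_like "EA E"
proof
  fix r :: real and c :: complex and p q s :: "'e \<times> 'a" and b :: 'a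
  show "hcarrier (EA E) = UNIV" by (rule EA_carrier)
  show "r *\<^sub>R p = complex_of_real r *\<^sub>C p"
    by (simp add: scaleR_prod_def scaleC_prod_def scaleR_scaleC)
  show "hip (EA E) p (q + s) = hip (EA E) p q + hip (EA E) p s"
    by (simp add: EA_hip ip_add_right algebra_simps)
  show "hip (EA E) p (c *\<^sub>C q) = c *\<^sub>C hip (EA E) p q"
    by (simp add: EA_hip ip_scaleC_right scaleC_prod_def mult_scaleC_right scaleC_add_right)
  show "hip (EA E) p (hact (EA E) q b) = hip (EA E) p q * b"
    by (simp add: EA_hip EA_hact ip_act_right algebra_simps)
  show "star (hip (EA E) p q) = hip (EA E) q p"
    by (simp add: EA_hip star_add star_mult star_star ip_star)
  show "norm (hip (EA E) p q) \<le> norm p * norm q"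
  proof -
    have "norm (hip (EA E) p q) \<le> norm (fst p) * norm (fst q) + norm (snd p) * norm (snd q)"
      unfolding EA_hip
      by (intro order_trans[OF norm_triangle_ineq] add_mono cauchy_schwarz order_trans[OF norm_mult_ineq]) (simp add: norm_star)
    also have "\<dots> \<le> sqrt (((norm (fst p))\<^sup>2 + (norm (snd p))\<^sup>2) * ((norm (fst q))\<^sup>2 + (norm (snd q))\<^sup>2))"
    proof (rule real_le_rsqrt)
      have "0 \<le> (norm (fst p) * norm (snd q) - norm (snd p) * norm (fst q))\<^sup>2" by simp
      then show "(norm (fst p) * norm (fst q) + norm (snd p) * norm (snd q))\<^sup>2
          \<le> ((norm (fst p))\<^sup>2 + (norm (snd p))\<^sup>2) * ((norm (fst q))\<^sup>2 + (norm (snd q))\<^sup>2)"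
        by (simp add: power2_eq_square algebra_simps)
    qed
    also have "\<dots> = norm p * norm q" by (simp add: norm_prod_def real_sqrt_mult)
    finally show ?thesis .
  qed
  show "(norm p)\<^sup>2 \<le> 2 * norm (hip (EA E) p p)"
  proof -
    have "(norm (fst p))\<^sup>2 \<le> norm (hip (EA E) p p)"
      unfolding EA_hip norm_ip by (intro pos_norm_mono pos_ip pos_star_mult)
    moreover have "(norm (snd p))\<^sup>2 \<le> norm (hip (EA E) p p)"
      unfolding EA_hip cstar_identity[symmetric] add.commute[of "ip _ _"]
      by (intro pos_norm_mono pos_ip pos_star_mult)
    ultimately show ?thesis by (simp add: norm_prod_def)
  qed
qed

text \<open>The operator \<open>(x, a) \<mapsto> v a\<close> on \<open>E \<oplus> A\<close>. These operators form the second column of the linking algebra: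
  \<open>v = (x, 0)\<close> gives the copy of \<open>E\<close> and \<open>v = (0, a)\<close> that of \<open>A\<close>.\<close>

definition column :: "'e \<times> 'a \<Rightarrow> 'e \<times> 'a \<Rightarrow> 'e \<times> 'a" where
  "column v = (\<lambda>z. hact (EA E) v (snd z))"

definition hom_op :: "('a \<Rightarrow> 'e) \<Rightarrow> 'e \<times> 'a \<Rightarrow> 'e \<times> 'a" where
  "hom_op t = (\<lambda>(x, a). (t a, 0))"

text \<open>The element of \<open>Mult(E)\<close> that corresponds to an adjointable map from \<open>A\<close> to \<open>E\<close>.\<close>

definition emb :: "('a \<Rightarrow> 'e) \<Rightarrow> ('a, 'e) linkmult" where
  "emb t = lmul E (hom_op t)"

lemma mod_emb_eq: "mod_emb E x = emb (hact E x)"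
  by (simp add: mod_emb_def emb_def hom_op_def)

lemma hom_op_adjoint: "hom_adj t s \<Longrightarrow> is_adjoint (EA E) (EA E) (hom_op t) (\<lambda>(x, a). (0, s x))"
  by (simp add: EA.is_adjoint_iff EA_hip hom_op_def hom_adj_left split_beta)

lemma hom_op_End: "hom_adj t s \<Longrightarrow> hom_op t \<in> End (EA E)"
  by (rule EA.EndI[OF hom_op_adjoint])

lemma adj_hom_op_End: "hom_adj t s \<Longrightarrow> (\<lambda>(x, a). (0, s x)) \<in> End (EA E)"
  by (rule EA.EndI[OF is_adjoint_sym[OF EA.hmod_like_axioms EA.hmod_like_axioms hom_op_adjoint]])

lemma hom_adj_swap:
  assumes "hom_adj t s" "hom_adj t' s'" shows "star (s (t' a)) * b = star a * s' (t b)"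
  using hom_adj_right[OF assms(1), of "t' a" b] hom_adj_left[OF assms(2), of a "t b"] by simp

lemma hom_adj_compose_Mult:
  assumes "hom_adj t s" "hom_adj t' s'" shows "s \<circ> t' \<in> Mult"
  unfolding Mult_iff by (intro exI[of _ "s' \<circ> t"]) (simp add: hom_adj_swap[OF assms])

lemma mult_op_End:
  assumes "m \<in> Mult" shows "(\<lambda>(x :: 'e, a). (0, m a)) \<in> End (EA E)"
proof -
  from assms obtain n where n: "\<And>a b. star (m a) * b = star a * n b" by (auto simp: Mult_iff)
  show ?thesis
    by (rule EA.EndI[where S = "\<lambda>(x, a). (0, n a)"]) (simp add: EA.is_adjoint_iff EA_hip split_beta n)
qed

lemma proj_End: "(\<lambda>(x :: 'e, a :: 'a). (x, 0)) \<in> End (EA E)" "(\<lambda>(x :: 'e, a :: 'a). (0, a)) \<in> End (EA E)"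
  by (rule EA.EndI[where S = "\<lambda>(x, a). (x, 0)"], simp add: EA.is_adjoint_iff EA_hip split_beta,
      rule EA.EndI[where S = "\<lambda>(x, a). (0, a)"], simp add: EA.is_adjoint_iff EA_hip split_beta)

lemma lmul_apply: "k \<in> End0 (EA E) \<Longrightarrow> lmul E T k = T \<circ> k" "k \<notin> End0 (EA E) \<Longrightarrow> lmul E T k = 0"
  by (simp_all add: lmul_def)

lemma End_zero: "T \<in> End (EA E) \<Longrightarrow> T \<circ> 0 = 0"
  using adjoint_pair.zero[OF EA.End_pair] by (auto intro!: ext)

lemma lmul_compose:
  assumes "T \<in> End (EA E)" "S \<in> End (EA E)"
  shows "lmul E T \<circ> lmul E S = lmul E (T \<circ> S)"
proof
  fix k
  show "(lmul E T \<circ> lmul E S) k = lmul E (T \<circ> S) k"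
    by (cases "k \<in> End0 (EA E)")
      (simp_all add: lmul_apply EA.End0_compose assms EA.zero_End0 End_zero comp_assoc)
qed

end

locale sigma_unital_module = hilbert_module E
  for E :: "('a::cstar_algebra, 'e::cbanach) hmod" +
  assumes sigma: "sigma_unital TYPE('a)"
begin

text \<open>The rank one operators \<open>\<theta>\<close> of \<open>v\<close> and \<open>(0, u\<^sub>n)\<close> converge to it in norm, because \<open>v u\<^sub>n\<close> tends to
  \<open>v\<close>.\<close>

lemma column_End0: "column v \<in> End0 (EA E)"
  unfolding EA.End0_iff
proof (intro conjI allI impI)
  show "column v \<in> End (EA E)"
    by (rule EA.EndI[where S = "\<lambda>z. (0, hip (EA E) v z)"])
      (simp add: EA.is_adjoint_iff column_def EA.ip_act_left, simp add: EA_hip)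
  fix e :: real assume e: "0 < e"
  obtain u :: "nat \<Rightarrow> 'a" where u: "\<And>n. star (u n) = u n" "\<And>n. norm (u n) \<le> 1"
    "\<And>a. (\<lambda>n. a * u n) \<longlonglongrightarrow> a" using approximate_unit[OF sigma] by blast
  obtain n where n: "norm (v - hact (EA E) v (u n)) < e / 2"
    using LIMSEQ_D[OF EA.act_approximate_unit[OF u, of v], of "e / 2"] e
    by (metis half_gt_zero norm_minus_commute order_refl)
  show "\<exists>F\<in>EA.finite_rank. \<forall>z. norm (column v z - F z) \<le> e * norm z"
  proof (intro bexI allI)
    fix z
    have "column v z - theta (EA E) v (0, u n) z = hact (EA E) (v - hact (EA E) v (u n)) (snd z)"
      by (simp add: column_def EA.theta_apply EA.act_diff_left EA.act_act, simp add: EA_hip u(1))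
    also have "norm \<dots> \<le> 2 * norm (v - hact (EA E) v (u n)) * norm (snd z)" by (rule EA.norm_act_le)
    also have "\<dots> \<le> e * norm z" using n e norm_snd_le[of "snd z" "fst z"] by (intro mult_mono) auto
    finally show "norm (column v z - theta (EA E) v (0, u n) z) \<le> e * norm z" .
  qed (rule EA.theta_finite_rank)
qed

text \<open>This holds for finite rank operators, since \<open>\<theta>\<close> of \<open>x\<close> and \<open>y\<close> sends \<open>(0, b)\<close> to \<open>x y\<^sub>2\<^sup>* b\<close> with
  \<open>y\<^sub>2\<close> the second component of \<open>y\<close>. The vector \<open>v\<close> is recovered from the operator through an
  approximate unit without increase of norm, so it passes to norm limits.\<close>

lemma End0_column:
  assumes k: "k \<in> End0 (EA E)"
  obtains v where "\<And>b. k (0, b) = hact (EA E) v b"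
proof -
  obtain u :: "nat \<Rightarrow> 'a" where u: "\<And>n. star (u n) = u n" "\<And>n. norm (u n) \<le> 1"
    "\<And>a. (\<lambda>n. a * u n) \<longlonglongrightarrow> a" using approximate_unit[OF sigma] by blast
  have fr: "\<exists>v. \<forall>b. F (0, b) = hact (EA E) v b" if "F \<in> EA.finite_rank" for F
    using that
  proof (induction rule: EA.finite_rank_induct)
    case zero
    then show ?case by (intro exI[of _ 0]) simp
  next
    case (add F G)
    then obtain v w where "\<forall>b. F (0, b) = hact (EA E) v b" "\<forall>b. G (0, b) = hact (EA E) w b" by blast
    then show ?case by (intro exI[of _ "v + w"]) (simp add: EA.act_add_left)
  next
    case (scale c F)
    then obtain v where "\<forall>b. F (0, b) = hact (EA E) v b" by blast
    then show ?case by (intro exI[of _ "c *\<^sub>C v"]) (simp add: EA.act_scaleC scaleC_fun_def)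
  next
    case (theta x y)
    show ?case by (intro exI[of _ "hact (EA E) x (star (snd y))"])
        (simp add: EA.theta_apply EA.act_act, simp add: EA_hip)
  qed
  have "\<forall>n. \<exists>F. F \<in> EA.finite_rank \<and> (\<forall>x. norm (k x - F x) \<le> 1 / real (Suc n) * norm x)"
  proof
    fix n
    have "0 < 1 / real (Suc n)" by simp
    then show "\<exists>F. F \<in> EA.finite_rank \<and> (\<forall>x. norm (k x - F x) \<le> 1 / real (Suc n) * norm x)"
      using k unfolding EA.End0_iff by blast
  qed
  from choice[OF this] obtain F where
    F: "\<And>n. F n \<in> EA.finite_rank" "\<And>n x. norm (k x - F n x) \<le> 1 / real (Suc n) * norm x"
    by blast
  have "\<forall>n. \<exists>v. \<forall>b. F n (0, b) = hact (EA E) v b" using fr[OF F(1)] by blast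
  from choice[OF this] obtain v where v: "\<And>n b. F n (0, b) = hact (EA E) (v n) b" by blast
  have diff: "norm (v n - v m) \<le> 1 / real (Suc n) + 1 / real (Suc m)" for n m
  proof -
    have lim: "(\<lambda>j. norm (hact (EA E) (v n - v m) (u j))) \<longlonglongrightarrow> norm (v n - v m)"
      by (rule tendsto_norm[OF EA.act_approximate_unit[OF u]])
    have "norm (hact (EA E) (v n - v m) (u j)) \<le> 1 / real (Suc n) + 1 / real (Suc m)" for j
    proof -
      have nu: "norm (0 :: 'e, u j) \<le> 1" using u(2) by (simp add: norm_prod_def)
      have "hact (EA E) (v n - v m) (u j) = (k (0, u j) - F m (0, u j)) - (k (0, u j) - F n (0, u j))"
        by (simp add: EA.act_diff_left v)
      also have "norm \<dots> \<le> 1 / real (Suc m) * norm (0 :: 'e, u j) + 1 / real (Suc n) * norm (0 :: 'e, u j)"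
        by (intro order_trans[OF norm_triangle_ineq4] add_mono F(2))
      also have "\<dots> \<le> 1 / real (Suc m) * 1 + 1 / real (Suc n) * 1"
        by (intro add_mono mult_left_mono nu) auto
      finally show ?thesis by simp
    qed
    then show ?thesis by (intro LIMSEQ_le_const2[OF lim]) blast
  qed
  have "Cauchy v" by (rule Cauchy_of_harmonic_bound[OF diff])
  then obtain w where w: "v \<longlonglongrightarrow> w" using Cauchy_convergent_iff convergent_def by blast
  show ?thesis
  proof (rule that[of w])
    fix b
    have 1: "(\<lambda>n. F n (0, b)) \<longlonglongrightarrow> hact (EA E) w b"
      unfolding v by (rule bounded_bilinear.tendsto[OF EA.bounded_bilinear_act w tendsto_const])
    have "(\<lambda>n. k (0, b) - F n (0, b)) \<longlonglongrightarrow> 0"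
    proof (rule Lim_null_comparison)
      show "\<forall>\<^sub>F n in sequentially. norm (k (0, b) - F n (0, b)) \<le> 1 / real (Suc n) * norm (0 :: 'e, b)"
        using F(2) by (intro always_eventually) blast
      show "(\<lambda>n. 1 / real (Suc n) * norm (0 :: 'e, b)) \<longlonglongrightarrow> 0"
        by (rule tendsto_mult_left_zero) (rule LIMSEQ_Suc[OF lim_1_over_n])
    qed
    from tendsto_diff[OF tendsto_const[of "k (0, b)"] this]
    have 2: "(\<lambda>n. F n (0, b)) \<longlonglongrightarrow> k (0, b)" by simp
    show "k (0, b) = hact (EA E) w b" by (rule LIMSEQ_unique[OF 2 1])
  qed
qed

text \<open>Adjointness over the linking algebra, tested on the vectors of \<open>E \<oplus> A\<close>.\<close>

lemma link_adjoint_iff: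
  "is_adjoint (link_mod E) (link_mod E) T S \<longleftrightarrow>
    (\<forall>k\<in>End0 (EA E). T k \<in> End0 (EA E)) \<and> (\<forall>k. k \<notin> End0 (EA E) \<longrightarrow> T k = 0) \<and>
    (\<forall>k\<in>End0 (EA E). S k \<in> End0 (EA E)) \<and> (\<forall>k. k \<notin> End0 (EA E) \<longrightarrow> S k = 0) \<and>
    (\<forall>k\<in>End0 (EA E). \<forall>l\<in>End0 (EA E). \<forall>x y. hip (EA E) (T k x) (l y) = hip (EA E) (k x) (S l y))"
proof -
  have adj: "hip (EA E) (k x) y = hip (EA E) x (adj (EA E) k y)" if "k \<in> End0 (EA E)" for k x y
    using EA.adj_adjoint[OF EA.End0_End[OF that]] unfolding EA.is_adjoint_iff by blast
  have eq: "adj (EA E) k' \<circ> l = adj (EA E) k \<circ> l' \<longleftrightarrow> (\<forall>x y. hip (EA E) (k' x) (l y) = hip (EA E) (k x) (l' y))"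
    if k: "k \<in> End0 (EA E)" "k' \<in> End0 (EA E)" for k k' l l'
  proof
    assume "adj (EA E) k' \<circ> l = adj (EA E) k \<circ> l'"
    then show "\<forall>x y. hip (EA E) (k' x) (l y) = hip (EA E) (k x) (l' y)"
      unfolding adj[OF k(1)] adj[OF k(2)] by (metis comp_apply)
  next
    assume *: "\<forall>x y. hip (EA E) (k' x) (l y) = hip (EA E) (k x) (l' y)"
    show "adj (EA E) k' \<circ> l = adj (EA E) k \<circ> l'"
    proof (intro ext EA.ip_eqI)
      fix x y
      show "hip (EA E) y ((adj (EA E) k' \<circ> l) x) = hip (EA E) y ((adj (EA E) k \<circ> l') x)"
        using *[rule_format, of y x] unfolding adj[OF k(1)] adj[OF k(2)] by simp
    qed
  qed
  have ball: "(\<forall>k\<in>End0 (EA E). \<forall>l\<in>End0 (EA E). adj (EA E) (T k) \<circ> l = adj (EA E) k \<circ> S l) \<longleftrightarrow>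
      (\<forall>k\<in>End0 (EA E). \<forall>l\<in>End0 (EA E). \<forall>x y. hip (EA E) (T k x) (l y) = hip (EA E) (k x) (S l y))"
    if T: "\<forall>k\<in>End0 (EA E). T k \<in> End0 (EA E)"
    by (intro ball_cong refl eq) (use T in blast)+
  show ?thesis
    unfolding is_adjoint_def link_mod_def by (simp only: hmod.simps ball cong: conj_cong)
qed

lemma column_apply: "column v (x, b) = hact (EA E) v b"
  by (simp add: column_def)

lemma link_adjoint_unique:
  assumes S: "is_adjoint (link_mod E) (link_mod E) T S"
    and S': "is_adjoint (link_mod E) (link_mod E) T S'"
  shows "S = S'"
proof
  fix l
  show "S l = S' l"
  proof (cases "l \<in> End0 (EA E)")
    case True
    show ?thesis
    proof (rule ext, rule EA.ip_eqI, rule cstar_cancel_left)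
      fix y v b
      have "hip (EA E) (column v (0, b)) (S l y) = hip (EA E) (column v (0, b)) (S' l y)"
        using S S' True column_End0 unfolding link_adjoint_iff by metis
      then show "star b * hip (EA E) v (S l y) = star b * hip (EA E) v (S' l y)"
        by (simp add: column_apply EA.ip_act_left)
    qed
  qed (use S S' in \<open>auto simp: link_adjoint_iff\<close>)
qed

lemma lmul_adjoint:
  assumes "is_adjoint (EA E) (EA E) T S"
  shows "is_adjoint (link_mod E) (link_mod E) (lmul E T) (lmul E S)"
proof -
  have "T \<in> End (EA E)" "S \<in> End (EA E)"
    by (rule EA.EndI[OF assms], rule EA.EndI[OF is_adjoint_sym[OF EA.hmod_like_axioms EA.hmod_like_axioms assms]])
  moreover have "hip (EA E) (T x) y = hip (EA E) x (S y)" for x y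
    using assms unfolding EA.is_adjoint_iff by blast
  ultimately show ?thesis
    by (auto simp: link_adjoint_iff lmul_apply EA.End0_compose)
qed

lemma adj_lmul: "is_adjoint (EA E) (EA E) T S \<Longrightarrow> adj (link_mod E) (lmul E T) = lmul E S"
  unfolding adj_def by (rule the_equality) (auto intro: lmul_adjoint link_adjoint_unique)

lemma lmul_inject:
  assumes T: "T \<in> End (EA E)" and S: "S \<in> End (EA E)" and eq: "lmul E T = lmul E S"
  shows "T = S"
proof (rule ext, rule EA.act_cancel)
  fix v b
  have "T (column v (0, b)) = S (column v (0, b))"
    using fun_cong[OF fun_cong[OF eq, of "column v"], of "(0, b)"] by (simp add: lmul_apply column_End0)
  then show "hact (EA E) (T v) b = hact (EA E) (S v) b"
    using adjoint_pair.act[OF EA.End_pair[OF T]] adjoint_pair.act[OF EA.End_pair[OF S]]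
    by (simp add: column_apply)
qed

text \<open>Let \<open>S\<close> be the adjoint of \<open>T\<close>. Column operators for \<open>(0, a)\<close> and \<open>(x, 0)\<close> are sent by \<open>T\<close> and \<open>S\<close> to
  compact operators, whose restrictions to \<open>A\<close> are \<open>b \<mapsto> v b\<close> and \<open>b \<mapsto> w b\<close>. The first component of \<open>v\<close>
  and the second component of \<open>w\<close> define \<open>t\<close> and its adjoint \<open>s\<close>.\<close>

lemma corner_eq_emb:
  assumes T: "T \<in> Mult_link E"
  obtains t s where "hom_adj t s" "link_r E \<circ> T \<circ> link_s E = emb t"
proof -
  from T obtain S where TS: "is_adjoint (link_mod E) (link_mod E) T S" by (auto simp: Mult_link_def End_def)
  have TK: "T k \<in> End0 (EA E)" "S k \<in> End0 (EA E)" if "k \<in> End0 (EA E)" for k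
    using TS that by (auto simp: link_adjoint_iff)
  have adj: "hip (EA E) (T k x) (l y) = hip (EA E) (k x) (S l y)"
    if "k \<in> End0 (EA E)" "l \<in> End0 (EA E)" for k l x y
    using TS that unfolding link_adjoint_iff by blast
  have "\<exists>v. \<forall>b. T (column (0, a)) (0, b) = hact (EA E) v b" for a
    using End0_column[OF TK(1)[OF column_End0]] by metis
  then obtain v where v: "\<And>a b. T (column (0, a)) (0, b) = hact (EA E) (v a) b" by metis
  have "\<exists>w. \<forall>b. S (column (x, 0)) (0, b) = hact (EA E) w b" for x
    using End0_column[OF TK(2)[OF column_End0]] by metis
  then obtain w where w: "\<And>x b. S (column (x, 0)) (0, b) = hact (EA E) (w x) b" by metis
  define t where "t a = fst (v a)" for a
  define s where "s x = snd (w x)" for x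
  have ts: "hom_adj t s" unfolding hom_adj_iff
  proof (intro allI, rule cstar_cancel_left, rule cstar_cancel_right)
    fix a x b c
    show "star b * ip (t a) x * c = star b * (star a * s x) * c"
      using adj[OF column_End0 column_End0, of "(0, a)" "(0, b)" "(x, 0)" "(0, c)"]
      unfolding v w column_apply EA_hip EA_hact
      by (simp add: t_def s_def ip_act_left ip_act_right star_mult mult.assoc)
  qed
  \<comment> \<open>Outside the linking algebra multiplier operators are \<open>0\<close> by convention, so off
    it the claim comes down to \<open>T 0 = 0\<close>.\<close>
  have T0: "T 0 = 0"
  proof (rule ext)
    fix x
    have "hip (EA E) z (T 0 x) = hip (EA E) z 0" for z
    proof (rule cstar_cancel_left)
      fix c
      have "hip (EA E) (T 0 x) (column z (0, c)) = 0" using adj[OF EA.zero_End0 column_End0] by simp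
      then have "star (hip (EA E) (T 0 x) (column z (0, c))) = 0" by simp
      then show "star c * hip (EA E) z (T 0 x) = star c * hip (EA E) z 0"
        by (simp only: EA.ip_star column_apply EA.ip_act_left) simp
    qed
    then have "T 0 x = 0" by (rule EA.ip_eqI)
    then show "T 0 x = 0 x" by simp
  qed
  have "(link_r E \<circ> T \<circ> link_s E) k = emb t k" for k
  proof (cases "k \<in> End0 (EA E)")
    case True
    define k' where "k' = (\<lambda>(x :: 'e, a :: 'a). (0 :: 'e, a)) \<circ> k"
    have k': "k' \<in> End0 (EA E)" unfolding k'_def by (intro EA.End0_compose proj_End True)
    have k'_apply: "k' y = (0, snd (k y))" for y by (simp add: k'_def split_beta)
    have "fst (T k' y) = t (snd (k y))" for y
    proof (rule ip_eqI, rule cstar_cancel_left)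
      fix x c
      have "hip (EA E) (T k' y) (column (x, 0) (0, c)) = hip (EA E) (k' y) (S (column (x, 0)) (0, c))"
        by (rule adj[OF k' column_End0])
      then have "ip (fst (T k' y)) x * c = star (snd (k y)) * s x * c"
        unfolding w column_apply k'_apply by (simp add: EA_hip EA_hact s_def ip_act_right mult.assoc)
      also have "star (snd (k y)) * s x = ip (t (snd (k y))) x" by (simp add: hom_adj_left[OF ts])
      finally have "star (ip (fst (T k' y)) x * c) = star (ip (t (snd (k y))) x * c)" by simp
      then show "star c * ip x (fst (T k' y)) = star c * ip x (t (snd (k y)))"
        by (simp add: star_mult ip_star)
    qed
    then show ?thesis using True TK(1)[OF k']
      by (intro ext) (simp add: link_r_def link_s_def emb_def lmul_apply k'_def[symmetric] hom_op_def split_beta)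
  next
    case False
    then show ?thesis using End_zero[OF proj_End(1)]
      by (simp add: link_r_def link_s_def emb_def lmul_apply T0 EA.zero_End0)
  qed
  then show ?thesis using that[OF ts] by blast
qed

lemma emb_carrier:
  assumes "hom_adj t s" shows "emb t \<in> hcarrier (Mult_mod E)"
proof -
  have e: "emb t \<in> Mult_link E"
    using lmul_adjoint[OF hom_op_adjoint[OF assms]] by (auto simp: Mult_link_def End_def emb_def)
  have "link_r E \<circ> emb t \<circ> link_s E = lmul E ((\<lambda>(x, a). (x, 0)) \<circ> hom_op t \<circ> (\<lambda>(x, a). (0, a)))"
    unfolding link_r_def link_s_def emb_def
    by (simp only: lmul_compose proj_End hom_op_End[OF assms] EA.End_compose)
  also have "(\<lambda>(x, a). (x, 0)) \<circ> hom_op t \<circ> (\<lambda>(x, a). (0, a)) = hom_op t"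
    by (simp add: fun_eq_iff hom_op_def)
  finally have "link_r E \<circ> emb t \<circ> link_s E = emb t" by (simp only: emb_def)
  then show ?thesis using e by (auto simp: Mult_mod_def intro!: exI[of _ "emb t"])
qed

lemma Mult_mod_carrier: "hcarrier (Mult_mod E) = {emb t | t s. hom_adj t s}"
proof
  show "{emb t | t s. hom_adj t s} \<subseteq> hcarrier (Mult_mod E)" using emb_carrier by blast
  show "hcarrier (Mult_mod E) \<subseteq> {emb t | t s. hom_adj t s}"
  proof
    fix e assume "e \<in> hcarrier (Mult_mod E)"
    then obtain T where T: "T \<in> Mult_link E" "e = link_r E \<circ> T \<circ> link_s E"
      by (auto simp: Mult_mod_def)
    obtain t s where "hom_adj t s" "link_r E \<circ> T \<circ> link_s E = emb t"
      using corner_eq_emb[OF T(1)] .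
    with T(2) show "e \<in> {emb t | t s. hom_adj t s}" by blast
  qed
qed

lemma emb_inject:
  assumes "hom_adj t s" "hom_adj t' s'" "emb t = emb t'" shows "t = t'"
proof -
  have "hom_op t = hom_op t'" using assms unfolding emb_def by (intro lmul_inject hom_op_End)
  then show ?thesis by (auto simp: hom_op_def fun_eq_iff)
qed

lemma Mult_mod_act:
  assumes "hom_adj t s" "m \<in> Mult"
  shows "hact (Mult_mod E) (emb t) m = emb (t \<circ> m)"
proof -
  have "hact (Mult_mod E) (emb t) m = lmul E (hom_op t \<circ> (\<lambda>(x, a). (0, m a)))"
    by (simp add: Mult_mod_def emb_def Mult_emb_def lmul_compose hom_op_End[OF assms(1)] mult_op_End[OF assms(2)])
  also have "hom_op t \<circ> (\<lambda>(x, a). (0, m a)) = hom_op (t \<circ> m)"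
    by (simp add: fun_eq_iff hom_op_def)
  finally show ?thesis by (simp add: emb_def)
qed

lemma Mult_mod_ip:
  assumes ts: "hom_adj t s" and ts': "hom_adj t' s'"
  shows "hip (Mult_mod E) (emb t) (emb t') = s \<circ> t'"
proof -
  have "adj (link_mod E) (emb t) \<circ> emb t' = lmul E ((\<lambda>(x, a). (0, s x)) \<circ> hom_op t')"
    unfolding emb_def
    by (simp add: adj_lmul[OF hom_op_adjoint[OF ts]] lmul_compose[OF adj_hom_op_End[OF ts] hom_op_End[OF ts']])
  also have "(\<lambda>(x, a). (0, s x)) \<circ> hom_op t' = (\<lambda>(x, a). (0, (s \<circ> t') a))"
    by (simp add: fun_eq_iff hom_op_def)
  finally have eq: "adj (link_mod E) (emb t) \<circ> emb t' = Mult_emb E (s \<circ> t')" by (simp only: Mult_emb_def)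
  have "hip (Mult_mod E) (emb t) (emb t') = (THE m. m \<in> Mult \<and> Mult_emb E m = Mult_emb E (s \<circ> t'))"
    by (simp add: Mult_mod_def eq)
  also have "\<dots> = s \<circ> t'"
  proof (rule the_equality)
    show "s \<circ> t' \<in> Mult \<and> Mult_emb E (s \<circ> t') = Mult_emb E (s \<circ> t')"
      using hom_adj_compose_Mult[OF ts ts'] by simp
    fix m assume m: "m \<in> Mult \<and> Mult_emb E m = Mult_emb E (s \<circ> t')"
    have "(\<lambda>(x :: 'e, a). (0 :: 'e, m a)) = (\<lambda>(x, a). (0, (s \<circ> t') a))"
      by (rule lmul_inject[OF mult_op_End mult_op_End[OF hom_adj_compose_Mult[OF ts ts']]])
        (use m in \<open>simp_all only: Mult_emb_def\<close>)
    then show "m = s \<circ> t'" by (auto simp: fun_eq_iff)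
  qed
  finally show ?thesis .
qed

lemma End_E_compose: "hom_adj t s \<Longrightarrow> hom_adj t' s' \<Longrightarrow> t \<circ> s' \<in> End E"
  by (rule like.EndI[where S = "t' \<circ> s"])
    (simp add: like.is_adjoint_iff hom_adj_left hom_adj_right star_star)

text \<open>Both inner products reduce to composition with adjoints: for \<open>x\<close> in \<open>E\<close> the rank one operator gives
  \<open>t (t'\<^sup>* x)\<close>, which is again in \<open>E\<close>.\<close>

lemma left_ip_eq:
  assumes ts: "hom_adj t s" and ts': "hom_adj t' s'"
  shows "left_ip E (emb t) (emb t') = t \<circ> s'"
proof -
  have th: "theta (Mult_mod E) (emb t) (emb t') (mod_emb E x) = mod_emb E (t (s' x))" for x
  proof -
    have "theta (Mult_mod E) (emb t) (emb t') (mod_emb E x)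
        = hact (Mult_mod E) (emb t) (s' \<circ> hact E x)"
      by (simp add: theta_def mod_emb_eq emb_carrier[OF hom_adj_vector] Mult_mod_ip[OF ts' hom_adj_vector])
    also have "\<dots> = emb (t \<circ> (s' \<circ> hact E x))"
      by (rule Mult_mod_act[OF ts hom_adj_compose_Mult[OF ts' hom_adj_vector]])
    also have "t \<circ> (s' \<circ> hact E x) = hact E (t (s' x))"
    proof
      fix a
      have "s' (hact E x a) = hact alg_mod (s' x) a" by (rule adjoint_pair.act[OF hom_pair'[OF ts']])
      moreover have "t (hact alg_mod (s' x) a) = hact E (t (s' x)) a" by (rule adjoint_pair.act[OF hom_pair[OF ts]])
      ultimately show "(t \<circ> (s' \<circ> hact E x)) a = hact E (t (s' x)) a" by simp
    qed
    finally show ?thesis by (simp add: mod_emb_eq)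
  qed
  show ?thesis unfolding left_ip_def
  proof (rule the_equality)
    show "t \<circ> s' \<in> End E \<and> (\<forall>x\<in>hcarrier E. mod_emb E ((t \<circ> s') x) = theta (Mult_mod E) (emb t) (emb t') (mod_emb E x))"
      using End_E_compose[OF ts ts'] by (simp add: th)
    fix T assume T: "T \<in> End E \<and> (\<forall>x\<in>hcarrier E. mod_emb E (T x) = theta (Mult_mod E) (emb t) (emb t') (mod_emb E x))"
    show "T = t \<circ> s'"
    proof
      fix x
      have "emb (hact E (T x)) = emb (hact E (t (s' x)))" using T by (simp add: carrier th mod_emb_eq[symmetric])
      then have eq: "hact E (T x) = hact E (t (s' x))" by (rule emb_inject[OF hom_adj_vector hom_adj_vector])
      show "T x = (t \<circ> s') x" by (rule like.act_cancel) (simp only: comp_apply eq)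
    qed
  qed
qed

lemma emb_add: "emb (\<lambda>a. t a + t' a) = emb t + emb t'"
  by (simp add: emb_def lmul_def hom_op_def fun_eq_iff split_beta)

lemma emb_zero: "emb (\<lambda>a. 0) = 0"
  by (simp add: emb_def lmul_def hom_op_def fun_eq_iff split_beta zero_prod_def)

lemma emb_sum: "emb (\<lambda>a. \<Sum>i\<in>I. t i a) = (\<Sum>i\<in>I. emb (t i))"
  by (induction I rule: infinite_finite_induct) (simp_all add: emb_zero emb_add)

end

section \<open>Unitisations and finite projectivity\<close>

lemma sum_apply: "(\<Sum>i\<in>I. f i) x = (\<Sum>i\<in>I. f i x)"
  by (induction I rule: infinite_finite_induct) simp_all

lemma alg_hip: "hip alg_mod a b = star a * b"
  and alg_hact: "hact alg_mod a b = a * b"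
  by (simp_all add: alg_mod_def)

lemma Mult_pair: "m \<in> Mult \<Longrightarrow> adjoint_pair alg_mod alg_mod m (adj alg_mod m)"
  unfolding Mult_def by (rule alg.like.End_pair)

lemma Mult_adj: "m \<in> Mult \<Longrightarrow> star (m a) * b = star a * adj alg_mod m b"
  using adjoint_pair.adj_eq[OF Mult_pair] by (simp add: alg_hip)

lemma Mult_module_map: "m \<in> Mult \<Longrightarrow> m (a * b) = m a * b"
  using adjoint_pair.act[OF Mult_pair] by (simp add: alg_hact)

lemma Mult_zero: "(0 :: 'a::cstar_algebra \<Rightarrow> 'a) \<in> Mult"
  unfolding Mult_iff by (intro exI[of _ 0]) simp

lemma Mult_id: "(id :: 'a::cstar_algebra \<Rightarrow> 'a) \<in> Mult"
  unfolding Mult_iff by (intro exI[of _ id]) simp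

lemma Mult_compose: "m \<in> Mult \<Longrightarrow> k \<in> Mult \<Longrightarrow> m \<circ> k \<in> Mult"
  unfolding Mult_def by (rule alg.like.End_compose)

lemma Mult_add: assumes "m \<in> Mult" "k \<in> Mult" shows "m + k \<in> Mult"
proof -
  from assms obtain n l where "\<And>a b. star (m a) * b = star a * n b" "\<And>a b. star (k a) * b = star a * l b"
    unfolding Mult_iff by blast
  then show ?thesis unfolding Mult_iff by (intro exI[of _ "n + l"]) (simp add: star_add algebra_simps)
qed

lemma Mult_scaleC: assumes "m \<in> Mult" shows "c *\<^sub>C m \<in> Mult"
proof -
  from assms obtain n where "\<And>a b. star (m a) * b = star a * n b" unfolding Mult_iff by blast
  then show ?thesis unfolding Mult_iff
    by (intro exI[of _ "cnj c *\<^sub>C n"]) (simp add: star_scaleC scaleC_fun_def mult_scaleC_left mult_scaleC_right)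
qed

lemma Mult_diff: assumes "m \<in> Mult" "k \<in> Mult" shows "m - k \<in> Mult"
proof -
  have "m - k = m + (- 1) *\<^sub>C k" by (simp add: cvec.scale_minus_left)
  with assms show ?thesis by (simp only: Mult_add Mult_scaleC)
qed

lemma Mult_sum: "(\<And>i. i \<in> I \<Longrightarrow> f i \<in> Mult) \<Longrightarrow> (\<Sum>i\<in>I. f i) \<in> Mult"
  by (induction I rule: infinite_finite_induct) (auto intro: Mult_zero Mult_add)

lemma adj_Mult: "m \<in> Mult \<Longrightarrow> adj alg_mod m \<in> Mult"
  unfolding Mult_def
  by (rule alg.like.EndI[OF is_adjoint_sym[OF alg.like.hmod_like_axioms alg.like.hmod_like_axioms alg.like.adj_adjoint]])

lemma alg_emb_Mult: "alg_emb a \<in> Mult"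
  unfolding Mult_iff by (intro exI[of _ "\<lambda>b. star a * b"]) (simp add: alg_emb_def star_mult mult.assoc)

lemma subspace_Mult: "cvec.subspace Mult"
  unfolding cvec.subspace_def using Mult_zero Mult_add Mult_scaleC by blast

lemma cstar_subalgebra_Mult: "cstar_subalgebra (Mult :: ('a::cstar_algebra \<Rightarrow> 'a) set)"
proof -
  have "op_closure alg_mod (Mult :: ('a \<Rightarrow> 'a) set) = Mult"
    using alg.like.op_closure_End alg.like.op_closure_superset[of Mult] unfolding Mult_def by blast
  then show ?thesis
    unfolding cstar_subalgebra_def using subspace_Mult Mult_compose adj_Mult by blast
qed

lemma cstar_subalgebra_generated:
  assumes S: "S \<subseteq> (Mult :: ('a::cstar_algebra \<Rightarrow> 'a) set)"
  shows "cstar_subalgebra (cstar_generated S)"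
proof -
  let ?C = "{B. cstar_subalgebra B \<and> S \<subseteq> B}"
  have M: "Mult \<in> ?C" using S cstar_subalgebra_Mult by blast
  have sub: "\<Inter>?C \<subseteq> Mult" using M by blast
  have "op_closure alg_mod (\<Inter>?C) \<subseteq> B" if "B \<in> ?C" for B
    using that alg.like.op_closure_mono[of "\<Inter>?C" B] by (auto simp: cstar_subalgebra_def)
  then have "op_closure alg_mod (\<Inter>?C) \<subseteq> \<Inter>?C" by blast
  moreover have "\<Inter>?C \<subseteq> op_closure alg_mod (\<Inter>?C)"
    using sub unfolding Mult_def by (rule alg.like.op_closure_superset)
  moreover have "cvec.subspace (\<Inter>?C)"
    by (rule cvec.subspace_Inter) (auto simp: cstar_subalgebra_def)
  ultimately show ?thesis
    unfolding cstar_generated_def using sub by (auto simp: cstar_subalgebra_def)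
qed

lemma generators_subset: "S \<subseteq> cstar_generated S"
  by (auto simp: cstar_generated_def)

text \<open>Left multiplication is isometric, so a norm limit of left multiplications comes from a Cauchy sequence
  in \<open>A\<close>.\<close>

lemma op_closure_alg_emb: "op_closure alg_mod (range alg_emb) = range (alg_emb :: 'a::cstar_algebra \<Rightarrow> _)"
proof
  show "range (alg_emb :: 'a \<Rightarrow> _) \<subseteq> op_closure alg_mod (range alg_emb)"
    by (rule alg.like.op_closure_superset) (use alg_emb_Mult in \<open>auto simp: Mult_def\<close>)
  show "op_closure alg_mod (range alg_emb) \<subseteq> range (alg_emb :: 'a \<Rightarrow> _)"
  proof
    fix T :: "'a \<Rightarrow> 'a" assume T: "T \<in> op_closure alg_mod (range alg_emb)"
    have "\<forall>n. \<exists>a. \<forall>x. norm (T x - a * x) \<le> 1 / real (Suc n) * norm x"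
    proof
      fix n
      have "0 < 1 / real (Suc n)" by simp
      then obtain S where "S \<in> range alg_emb" "\<forall>x. norm (T x - S x) \<le> 1 / real (Suc n) * norm x"
        using T unfolding alg.like.op_closure_iff by blast
      then show "\<exists>a. \<forall>x. norm (T x - a * x) \<le> 1 / real (Suc n) * norm x"
        unfolding alg_emb_def by blast
    qed
    from choice[OF this] obtain a where a: "\<And>n x. norm (T x - a n * x) \<le> 1 / real (Suc n) * norm x" by blast
    have diff: "norm (a n - a m) \<le> 1 / real (Suc n) + 1 / real (Suc m)" for n m
    proof -
      have "norm (lmult (a n - a m)) \<le> 1 / real (Suc n) + 1 / real (Suc m)"
      proof (rule norm_bop_le)
        fix x
        have "bop_apply (lmult (a n - a m)) x = (T x - a m * x) - (T x - a n * x)"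
          by (simp add: left_diff_distrib)
        also have "norm \<dots> \<le> 1 / real (Suc m) * norm x + 1 / real (Suc n) * norm x"
          by (rule order_trans[OF norm_triangle_ineq4 add_mono[OF a a]])
        also have "\<dots> = (1 / real (Suc n) + 1 / real (Suc m)) * norm x" by (simp only: distrib_right add.commute)
        finally show "norm (bop_apply (lmult (a n - a m)) x) \<le> (1 / real (Suc n) + 1 / real (Suc m)) * norm x" .
      qed simp
      then show ?thesis by (simp only: norm_lmult)
    qed
    have "Cauchy a" by (rule Cauchy_of_harmonic_bound[OF diff])
    then obtain b where b: "a \<longlonglongrightarrow> b" using Cauchy_convergent_iff convergent_def by blast
    have "T x = b * x" for x
    proof -
      have 1: "(\<lambda>n. a n * x) \<longlonglongrightarrow> b * x" by (rule tendsto_mult[OF b tendsto_const])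
      have "(\<lambda>n. T x - a n * x) \<longlonglongrightarrow> 0"
      proof (rule Lim_null_comparison)
        show "\<forall>\<^sub>F n in sequentially. norm (T x - a n * x) \<le> 1 / real (Suc n) * norm x"
          using a by (intro always_eventually) blast
        show "(\<lambda>n. 1 / real (Suc n) * norm x) \<longlonglongrightarrow> 0"
          by (rule tendsto_mult_left_zero) (rule LIMSEQ_Suc[OF lim_1_over_n])
      qed
      from tendsto_diff[OF tendsto_const[of "T x"] this]
      have 2: "(\<lambda>n. a n * x) \<longlonglongrightarrow> T x" by simp
      show ?thesis by (rule LIMSEQ_unique[OF 2 1])
    qed
    then have "T = alg_emb b" by (auto simp: alg_emb_def)
    then show "T \<in> range alg_emb" by blast
  qed
qed

lemma Mult_compose_alg_emb: "m \<in> Mult \<Longrightarrow> m \<circ> alg_emb a = alg_emb (m a)"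
  by (rule ext) (simp add: alg_emb_def Mult_module_map)

lemma alg_emb_compose_Mult:
  assumes "m \<in> Mult" shows "alg_emb a \<circ> m = alg_emb (star (adj alg_mod m (star a)))"
proof
  fix x
  have "star (star (m x) * star a) = star (star x * adj alg_mod m (star a))" by (simp add: Mult_adj[OF assms])
  then show "(alg_emb a \<circ> m) x = alg_emb (star (adj alg_mod m (star a))) x"
    by (simp add: alg_emb_def star_mult star_star)
qed

text \<open>A nonzero ideal \<open>J\<close> meets \<open>A\<close>: if \<open>T\<close> is in \<open>J\<close> and \<open>T a \<noteq> 0\<close>, then \<open>T\<close> composed with left
  multiplication by \<open>a\<close> is left multiplication by \<open>T a\<close>.\<close>

lemma unitisation_of_subalgebra:
  assumes B: "cstar_subalgebra (B :: ('a::cstar_algebra \<Rightarrow> 'a) set)" and id: "id \<in> B" and A: "range alg_emb \<subseteq> B"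
  shows "unitisation B"
proof -
  have BM: "B \<subseteq> Mult" using B by (simp add: cstar_subalgebra_def)
  have "cvec.subspace (range (alg_emb :: 'a \<Rightarrow> _))"
    unfolding cvec.subspace_def
  proof (intro conjI ballI allI)
    have "alg_emb (0 :: 'a) = 0" by (simp add: alg_emb_def fun_eq_iff)
    then show "0 \<in> range (alg_emb :: 'a \<Rightarrow> _)" by (metis rangeI)
    fix S T :: "'a \<Rightarrow> 'a" and c assume "S \<in> range alg_emb"
    then obtain a where a: "S = alg_emb a" by blast
    have "c *\<^sub>C S = alg_emb (c *\<^sub>C a)" by (simp add: a alg_emb_def scaleC_fun_def mult_scaleC_left)
    then show "c *\<^sub>C S \<in> range alg_emb" by blast
    assume "T \<in> range alg_emb"
    then obtain b where b: "T = alg_emb b" by blast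
    have "S + T = alg_emb (a + b)" by (simp add: a b alg_emb_def fun_eq_iff algebra_simps)
    then show "S + T \<in> range alg_emb" by blast
  qed
  moreover have "T \<circ> S \<in> range alg_emb \<and> S \<circ> T \<in> range alg_emb" if "T \<in> B" "S \<in> range alg_emb" for T S
  proof -
    from that(2) obtain a where "S = alg_emb a" by blast
    moreover have "T \<in> Mult" using that(1) BM by blast
    ultimately show ?thesis by (simp add: Mult_compose_alg_emb alg_emb_compose_Mult)
  qed
  ultimately have ideal: "closed_ideal B (range alg_emb)"
    unfolding closed_ideal_def using A op_closure_alg_emb by blast
  have "J \<inter> range alg_emb \<noteq> {0}" if J: "closed_ideal B J" "J \<noteq> {0}" for J
  proof -
    have "0 \<in> J" using J(1) by (simp add: closed_ideal_def cvec.subspace_def)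
    with J(2) obtain T where T: "T \<in> J" "T \<noteq> 0" by blast
    then obtain a where a: "T a \<noteq> 0" by (auto simp: fun_eq_iff)
    have TM: "T \<in> Mult" using T J(1) BM by (auto simp: closed_ideal_def)
    have "T \<circ> alg_emb a \<in> J" using J(1) T A by (auto simp: closed_ideal_def)
    then have "alg_emb (T a) \<in> J \<inter> range alg_emb" using Mult_compose_alg_emb[OF TM] by auto
    moreover have "alg_emb (T a) \<noteq> 0"
    proof
      assume "alg_emb (T a) = 0"
      from fun_cong[OF this, of "star (T a)"] have "T a * star (T a) = 0" by (simp add: alg_emb_def)
      then have "star (T a) = 0" using cstar_mult_eq_0[of "star (T a)"] by (simp add: star_star)
      then show False using a by (metis star_star star_zero)
    qed
    ultimately show ?thesis by blast
  qed
  then show ?thesis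
    unfolding unitisation_def using B ideal id by (auto intro!: bexI[of _ id])
qed

context hilbert_module
begin

lemma hom_adj_add: "hom_adj t s \<Longrightarrow> hom_adj t' s' \<Longrightarrow> hom_adj (\<lambda>a. t a + t' a) (\<lambda>x. s x + s' x)"
  by (simp add: hom_adj_iff ip_add_left algebra_simps)

lemma hom_adj_zero: "hom_adj (\<lambda>a. 0) (\<lambda>x. 0)"
  by (simp add: hom_adj_iff)

lemma hom_adj_sum:
  "(\<And>i. i \<in> I \<Longrightarrow> hom_adj (t i) (s i)) \<Longrightarrow> hom_adj (\<lambda>a. \<Sum>i\<in>I. t i a) (\<lambda>x. \<Sum>i\<in>I. s i x)"
  by (induction I rule: infinite_finite_induct) (simp_all add: hom_adj_zero hom_adj_add)

lemma hom_adj_compose: "hom_adj t s \<Longrightarrow> m \<in> Mult \<Longrightarrow> hom_adj (t \<circ> m) (adj alg_mod m \<circ> s)"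
  by (simp add: hom_adj_iff Mult_adj)

lemma hom_adj_End:
  assumes "hom_adj t s" "T \<in> End E" shows "hom_adj (T \<circ> t) (s \<circ> adj E T)"
  using assms adjoint_pair.adj_eq[OF like.End_pair[OF assms(2)]] by (simp add: hom_adj_iff)

lemma hom_linear:
  assumes "hom_adj t s"
  shows "t (a - b) = t a - t b" "t (\<Sum>i\<in>I. f i) = (\<Sum>i\<in>I. t (f i))"
  by (rule linear_diff[OF bounded_linear.linear[OF adjoint_pair.bounded_linear[OF hom_pair[OF assms]]]]
      linear_sum[OF bounded_linear.linear[OF adjoint_pair.bounded_linear[OF hom_pair[OF assms]]]])+

lemma hom_linear':
  assumes "hom_adj t s"
  shows "s (x + y) = s x + s y" "s (x - y) = s x - s y" "s (c *\<^sub>C x) = c *\<^sub>C s x" "s (hact E x b) = s x * b" "s 0 = 0"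
    "s (\<Sum>i\<in>I. f i) = (\<Sum>i\<in>I. s (f i))"
proof -
  interpret adjoint_pair E alg_mod s t by (rule hom_pair'[OF assms])
  show "s (x + y) = s x + s y" "s (c *\<^sub>C x) = c *\<^sub>C s x" "s 0 = 0" by (rule add scaleC zero)+
  show "s (x - y) = s x - s y" "s (\<Sum>i\<in>I. f i) = (\<Sum>i\<in>I. s (f i))"
    by (rule linear_diff[OF bounded_linear.linear[OF bounded_linear]] linear_sum[OF bounded_linear.linear[OF bounded_linear]])+
  show "s (hact E x b) = s x * b" using act[of x b] by (simp add: alg_hact)
qed

lemma parseval_frame_iff:
  "parseval_frame n g gs \<longleftrightarrow> (\<forall>i<n. hom_adj (g i) (gs i)) \<and> (\<forall>x y. ip x y = (\<Sum>i<n. star (gs i x) * gs i y))"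
proof -
  have "ip x (\<Sum>i<n. g i (gs i y)) = (\<Sum>i<n. star (gs i x) * gs i y)" if "\<forall>i<n. hom_adj (g i) (gs i)" for x y
    unfolding like.ip_sum_right by (intro sum.cong refl) (use that hom_adj_right in auto)
  then show ?thesis unfolding parseval_frame_def by (metis ip_eqI)
qed

lemma frame_matrix_projection:
  assumes fr: "parseval_frame n g gs" and B: "\<And>i j. i < n \<Longrightarrow> j < n \<Longrightarrow> gs i \<circ> g j \<in> B"
  shows "mat_projection B n (\<lambda>i j. gs i \<circ> g j)"
  unfolding mat_projection_def
proof (intro allI impI conjI)
  fix i j assume ij: "i < n" "j < n"
  have g: "hom_adj (g i) (gs i)" "hom_adj (g j) (gs j)" using fr ij by (auto simp: parseval_frame_def)
  show "gs i \<circ> g j \<in> B" by (rule B[OF ij])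
  show "adj alg_mod (gs j \<circ> g i) = gs i \<circ> g j"
    by (rule alg.like.adj_eqI)
      (simp add: alg.like.is_adjoint_iff alg_hip hom_adj_swap[OF g(2,1)])
  show "(\<Sum>k<n. (gs i \<circ> g k) \<circ> (gs k \<circ> g j)) = gs i \<circ> g j"
  proof
    fix a
    have "(\<Sum>k<n. (gs i \<circ> g k) \<circ> (gs k \<circ> g j)) a = gs i (\<Sum>k<n. g k (gs k (g j a)))"
      by (simp add: sum_apply hom_linear'(6)[OF g(1)])
    then show "(\<Sum>k<n. (gs i \<circ> g k) \<circ> (gs k \<circ> g j)) a = (gs i \<circ> g j) a"
      using fr by (simp add: parseval_frame_def)
  qed
qed

text \<open>The isomorphism is \<open>x \<mapsto> (g\<^sub>i\<^sup>* x)\<^sub>i\<close>.\<close>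

lemma frame_iso:
  assumes fr: "parseval_frame n g gs"
  shows "hmod_iso E (proj_mod n (\<lambda>i j. gs i \<circ> g j))"
proof -
  let ?p = "\<lambda>i j. gs i \<circ> g j"
  have g: "\<And>i. i < n \<Longrightarrow> hom_adj (g i) (gs i)" using fr by (auto simp: parseval_frame_def)
  have rec: "(\<Sum>i<n. g i (gs i x)) = x" for x using fr by (simp add: parseval_frame_def)
  define \<phi> where "\<phi> x i = (if i < n then gs i x else 0)" for x i
  have app: "mat_app n ?p \<xi> = \<phi> (\<Sum>j<n. g j (\<xi> j))" for \<xi>
    by (auto simp: mat_app_def \<phi>_def fun_eq_iff hom_linear'(6)[OF g])
  have "\<phi> x = mat_app n ?p (\<phi> x)" for x unfolding app by (simp add: \<phi>_def rec)
  moreover have "\<phi> x \<in> vecs n" for x by (simp add: vecs_def \<phi>_def)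
  ultimately have "range \<phi> = mat_app n ?p ` vecs n" using app by blast
  moreover have "inj \<phi>"
  proof (rule injI)
    fix x y assume "\<phi> x = \<phi> y"
    then have "(\<Sum>i<n. g i (\<phi> x i)) = (\<Sum>i<n. g i (\<phi> y i))" by simp
    then show "x = y" by (simp add: \<phi>_def rec)
  qed
  ultimately have "bij_betw \<phi> (hcarrier E) (hcarrier (proj_mod n ?p))"
    by (simp add: bij_betw_def carrier proj_mod_def)
  moreover have "\<phi> (x + y) = \<phi> x + \<phi> y" "\<phi> (c *\<^sub>C x) = c *\<^sub>C \<phi> x" "\<phi> (hact E x b) = (\<lambda>i. \<phi> x i * b)" for x y b c
    by (auto simp: \<phi>_def fun_eq_iff scaleC_fun_def hom_linear'[OF g])
  moreover have "(\<Sum>i<n. star (\<phi> x i) * \<phi> y i) = ip x y" for x y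
    using fr by (simp add: \<phi>_def parseval_frame_iff)
  ultimately show ?thesis unfolding hmod_iso_def
    by (intro exI[of _ \<phi>]) (simp add: proj_mod_def)
qed

text \<open>The frame is \<open>g\<^sub>j a = \<phi>\<^sup>-\<^sup>1 (p (a e\<^sub>j))\<close>, where \<open>a e\<^sub>j\<close> has \<open>a\<close> in place \<open>j\<close> and \<open>0\<close> elsewhere. Its adjoint is
  the \<open>j\<close>-th component of \<open>\<phi>\<close>.\<close>

lemma frame_of_iso:
  assumes p: "mat_projection Mult n p" and iso: "hmod_iso E (proj_mod n p)"
  shows "\<exists>g gs. parseval_frame n g gs"
proof -
  from iso obtain \<phi> where bij: "bij_betw \<phi> UNIV (mat_app n p ` vecs n)"
    and ip_\<phi>: "\<And>x y. (\<Sum>i<n. star (\<phi> x i) * \<phi> y i) = ip x y"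
    unfolding hmod_iso_def by (auto simp: proj_mod_def carrier)
  have pM: "p i j \<in> Mult" and p_adj: "adj alg_mod (p j i) = p i j" and p_idem: "(\<Sum>k<n. p i k \<circ> p k j) = p i j"
    if "i < n" "j < n" for i j using p that by (auto simp: mat_projection_def)
  have p_sum: "p i j (\<Sum>k\<in>I. f k) = (\<Sum>k\<in>I. p i j (f k))" if "i < n" "j < n" for i j I and f :: "nat \<Rightarrow> 'a"
    by (rule linear_sum[OF bounded_linear.linear[OF adjoint_pair.bounded_linear[OF Mult_pair[OF pM[OF that]]]]])
  have fixed: "(\<Sum>j<n. p i j (\<phi> x j)) = \<phi> x i" if i: "i < n" for i x
  proof -
    obtain \<xi> where \<xi>: "\<phi> x = mat_app n p \<xi>" using bij by (auto simp: bij_betw_def)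
    have "(\<Sum>j<n. p i j (\<phi> x j)) = (\<Sum>j<n. \<Sum>k<n. p i j (p j k (\<xi> k)))"
      using i by (intro sum.cong) (auto simp: \<xi> mat_app_def p_sum)
    also have "\<dots> = (\<Sum>k<n. \<Sum>j<n. p i j (p j k (\<xi> k)))" by (rule sum.swap)
    also have "\<dots> = (\<Sum>k<n. p i k (\<xi> k))"
    proof (rule sum.cong)
      fix k assume "k \<in> {..<n}"
      then show "(\<Sum>j<n. p i j (p j k (\<xi> k))) = p i k (\<xi> k)"
        using fun_cong[OF p_idem[OF i, of k], of "\<xi> k"] by (simp add: sum_apply)
    qed simp
    also have "\<dots> = \<phi> x i" using i by (simp add: \<xi> mat_app_def)
    finally show ?thesis .
  qed
  have "\<exists>x. \<phi> x = (\<lambda>i. if i < n then p i j a else 0)" if j: "j < n" for j a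
  proof -
    let ?e = "\<lambda>i. if i = j then a else 0"
    have p0: "p i k 0 = 0" if "i < n" "k < n" for i k using p_sum[OF that, of "\<lambda>_. 0" "{}"] by simp
    have "?e \<in> vecs n" using j by (auto simp: vecs_def)
    moreover have "mat_app n p ?e = (\<lambda>i. if i < n then p i j a else 0)"
    proof
      fix i
      have "(\<Sum>k<n. p i k (?e k)) = (\<Sum>k<n. if k = j then p i j a else 0)" if "i < n"
        using that by (intro sum.cong) (auto simp: p0)
      then show "mat_app n p ?e i = (if i < n then p i j a else 0)" using j by (simp add: mat_app_def)
    qed
    ultimately have "(\<lambda>i. if i < n then p i j a else 0) \<in> range \<phi>" using bij by (metis bij_betw_def imageI)
    then show ?thesis by (metis imageE)
  qed
  then obtain g where g: "\<And>j a. j < n \<Longrightarrow> \<phi> (g j a) = (\<lambda>i. if i < n then p i j a else 0)" by metis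
  have "parseval_frame n g (\<lambda>j x. \<phi> x j)" unfolding parseval_frame_iff
  proof (intro conjI allI impI)
    fix j assume j: "j < n"
    show "hom_adj (g j) (\<lambda>x. \<phi> x j)" unfolding hom_adj_iff
    proof (intro allI)
      fix a x
      have "ip (g j a) x = (\<Sum>i<n. star (p i j a) * \<phi> x i)"
        unfolding ip_\<phi>[symmetric] g[OF j] by (intro sum.cong) auto
      also have "\<dots> = (\<Sum>i<n. star a * p j i (\<phi> x i))"
        by (intro sum.cong) (use j in \<open>auto simp: Mult_adj pM p_adj\<close>)
      also have "\<dots> = star a * \<phi> x j" by (simp add: sum_distrib_left[symmetric] fixed[OF j])
      finally show "ip (g j a) x = star a * \<phi> x j" .
    qed
  qed (simp add: ip_\<phi>)
  then show ?thesis by blast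
qed

end

lemma (in hilbert_module) frame_iff_finite_projective:
  "finite_projective Mult E \<longleftrightarrow> (\<exists>n g gs. parseval_frame n g gs)"
proof
  assume "finite_projective Mult E"
  then show "\<exists>n g gs. parseval_frame n g gs" unfolding finite_projective_def using frame_of_iso by blast
next
  assume "\<exists>n g gs. parseval_frame n g gs"
  then obtain n g gs where fr: "parseval_frame n g gs" by blast
  have "gs i \<circ> g j \<in> Mult" if "i < n" "j < n" for i j
    using fr that by (auto simp: parseval_frame_def intro: hom_adj_compose_Mult)
  from frame_matrix_projection[OF fr this]
  show "finite_projective Mult E" unfolding finite_projective_def
    using unitisation_of_subalgebra[OF cstar_subalgebra_Mult Mult_id] alg_emb_Mult frame_iso[OF fr] by blast
qed

lemma (in hilbert_module) frame_iff_finite_projective_generated: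
  "(\<exists>F \<subseteq> Mult. finite F \<and> finite_projective (cstar_generated (F \<union> range alg_emb)) E)
    \<longleftrightarrow> (\<exists>n g gs. parseval_frame n g gs)"
proof
  assume "\<exists>F \<subseteq> Mult. finite F \<and> finite_projective (cstar_generated (F \<union> range alg_emb)) E"
  then obtain F n p where F: "unitisation (cstar_generated (F \<union> range alg_emb))"
    "mat_projection (cstar_generated (F \<union> range alg_emb)) n p" "hmod_iso E (proj_mod n p)"
    unfolding finite_projective_def by blast
  then have "cstar_generated (F \<union> range alg_emb) \<subseteq> Mult" by (simp add: unitisation_def cstar_subalgebra_def)
  with F(2) have "mat_projection Mult n p" unfolding mat_projection_def by blast
  with F(3) show "\<exists>n g gs. parseval_frame n g gs" using frame_of_iso by blast
next
  assume "\<exists>n g gs. parseval_frame n g gs"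
  then obtain n g gs where fr: "parseval_frame n g gs" by blast
  define F where "F = insert id ((\<lambda>(i, j). gs i \<circ> g j) ` ({..<n} \<times> {..<n}))"
  have "gs i \<circ> g j \<in> Mult" if "i < n" "j < n" for i j
    using fr that by (auto simp: parseval_frame_def intro: hom_adj_compose_Mult)
  then have FM: "F \<subseteq> Mult" using Mult_id by (auto simp: F_def)
  have fin: "finite F" by (simp add: F_def)
  let ?B = "cstar_generated (F \<union> range alg_emb)"
  have B: "cstar_subalgebra ?B" using FM alg_emb_Mult by (intro cstar_subalgebra_generated) auto
  have sub: "F \<union> range alg_emb \<subseteq> ?B" by (rule generators_subset)
  have "unitisation ?B" by (rule unitisation_of_subalgebra[OF B]) (use sub in \<open>auto simp: F_def\<close>)
  moreover have "mat_projection ?B n (\<lambda>i j. gs i \<circ> g j)"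
    by (rule frame_matrix_projection[OF fr]) (use sub in \<open>auto simp: F_def\<close>)
  ultimately have "finite_projective ?B E" unfolding finite_projective_def using frame_iso[OF fr] by blast
  with FM fin show "\<exists>F \<subseteq> Mult. finite F \<and> finite_projective (cstar_generated (F \<union> range alg_emb)) E" by blast
qed

section \<open>Fullness, finite generation and projectivity\<close>

lemma infinite_UNIV_of_nonzero:
  assumes "(x :: 'a::real_vector) \<noteq> 0" shows "infinite (UNIV :: 'a set)"
proof
  assume "finite (UNIV :: 'a set)"
  then have "finite (range (\<lambda>r :: real. r *\<^sub>R x))" by (rule finite_subset[rotated]) simp
  moreover have "inj (\<lambda>r :: real. r *\<^sub>R x)" using assms by (auto intro!: injI)
  ultimately have "finite (UNIV :: real set)" by (rule finite_imageD)
  then show False by (simp add: infinite_UNIV_char_0)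
qed

context sigma_unital_module
begin

definition hom :: "('a \<Rightarrow> 'e) set" where
  "hom = {t. \<exists>s. hom_adj t s}"

lemma hom_closed:
  "t \<in> hom \<Longrightarrow> t' \<in> hom \<Longrightarrow> (\<lambda>a. t a + t' a) \<in> hom"
  "t \<in> hom \<Longrightarrow> m \<in> Mult \<Longrightarrow> t \<circ> m \<in> hom"
  "(\<And>i. i \<in> I \<Longrightarrow> f i \<in> hom) \<Longrightarrow> (\<lambda>a. \<Sum>i\<in>I. f i a) \<in> hom"
proof -
  show "t \<in> hom \<Longrightarrow> t' \<in> hom \<Longrightarrow> (\<lambda>a. t a + t' a) \<in> hom" for t t'
    unfolding hom_def using hom_adj_add by blast
  show "t \<in> hom \<Longrightarrow> m \<in> Mult \<Longrightarrow> t \<circ> m \<in> hom"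
    unfolding hom_def using hom_adj_compose by blast
  assume "\<And>i. i \<in> I \<Longrightarrow> f i \<in> hom"
  then have "\<forall>i\<in>I. \<exists>s. hom_adj (f i) s" by (auto simp: hom_def)
  from bchoice[OF this] obtain s where "\<And>i. i \<in> I \<Longrightarrow> hom_adj (f i) (s i)" by blast
  then have "hom_adj (\<lambda>a. \<Sum>i\<in>I. f i a) (\<lambda>x. \<Sum>i\<in>I. s i x)" by (rule hom_adj_sum)
  then show "(\<lambda>a. \<Sum>i\<in>I. f i a) \<in> hom" unfolding hom_def by (intro CollectI exI)
qed

lemma Mult_mod_carrier_hom: "hcarrier (Mult_mod E) = emb ` hom"
  unfolding Mult_mod_carrier hom_def by blast

lemma emb_inj_hom: "inj_on emb hom"
  unfolding hom_def by (rule inj_onI) (auto dest: emb_inject)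

lemma act_emb: "t \<in> hom \<Longrightarrow> m \<in> Mult \<Longrightarrow> hact (Mult_mod E) (emb t) m = emb (t \<circ> m)"
  unfolding hom_def using Mult_mod_act by blast

text \<open>Every \<open>T\<close> in \<open>End(E)\<close> equals \<open>\<Sum> (T g\<^sub>i) g\<^sub>i\<^sup>*\<close>, so the span is everything even before closure.\<close>

theorem left_full_of_frame:
  assumes fr: "parseval_frame n g gs"
  shows "left_full E"
proof -
  let ?Z = "cvec.span {left_ip E e f | e f. e \<in> hcarrier (Mult_mod E) \<and> f \<in> hcarrier (Mult_mod E)}"
  have g: "\<And>i. i < n \<Longrightarrow> hom_adj (g i) (gs i)" using fr by (auto simp: parseval_frame_def)
  have "T \<in> op_closure E ?Z" if T: "T \<in> End E" for T
  proof -
    interpret T: adjoint_pair E E T "adj E T" by (rule like.End_pair[OF T])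
    have "T x = (\<Sum>i<n. (T \<circ> g i) \<circ> gs i) x" for x
    proof -
      have "(\<Sum>i<n. (T \<circ> g i) \<circ> gs i) x = T (\<Sum>i<n. g i (gs i x))"
        by (simp add: sum_apply linear_sum[OF bounded_linear.linear[OF T.bounded_linear]])
      then show ?thesis using fr by (simp add: parseval_frame_def)
    qed
    then have "T = (\<Sum>i<n. (T \<circ> g i) \<circ> gs i)" by (rule ext)
    also have "\<dots> = (\<Sum>i<n. left_ip E (emb (T \<circ> g i)) (emb (g i)))"
      by (intro sum.cong refl left_ip_eq[symmetric, OF hom_adj_End[OF g T] g]) auto
    also have "\<dots> \<in> ?Z"
      by (intro cvec.span_sum cvec.span_base) (use emb_carrier[OF hom_adj_End[OF g T]] emb_carrier[OF g] in blast)
    finally have "T \<in> ?Z" .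
    then show ?thesis unfolding like.op_closure_iff using T by (auto intro!: bexI[of _ T])
  qed
  then show ?thesis unfolding left_full_def using like.op_closure_End by blast
qed

text \<open>An operator in the span of the left inner products has the form \<open>S = \<Sum> t\<^sub>i g\<^sub>i\<^sup>*\<close>, so
  \<open>\<parallel>S x\<parallel> \<le> K \<Sum> \<parallel>g\<^sub>i\<^sup>* x\<parallel>\<close>. If \<open>S\<close> is within \<open>1/2\<close> of the identity, then \<open>\<parallel>x\<parallel> \<le> 2 \<parallel>S x\<parallel>\<close>.\<close>

theorem frame_of_left_full:
  assumes full: "left_full E"
  shows "\<exists>n g gs. parseval_frame n g gs"
proof -
  let ?Z = "cvec.span {left_ip E e f | e f. e \<in> hcarrier (Mult_mod E) \<and> f \<in> hcarrier (Mult_mod E)}"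
  \<comment> \<open>Domination by finitely many adjoints. Lists make it additive: those of two operators are joined.\<close>
  define dom where "dom S \<longleftrightarrow> (\<exists>ps K. (\<forall>(g, gs)\<in>set ps. hom_adj g gs) \<and> 0 \<le> K \<and>
      (\<forall>x. norm (S x) \<le> K * (\<Sum>(g, gs)\<leftarrow>ps. norm (gs x))))" for S :: "'e \<Rightarrow> 'e"
  have nonneg: "0 \<le> (\<Sum>(g, gs)\<leftarrow>ps. norm (gs x))" for ps :: "(('a \<Rightarrow> 'e) \<times> ('e \<Rightarrow> 'a)) list" and x
    by (induction ps) auto
  have dom_Z: "dom S" if "S \<in> ?Z" for S
  proof (rule cvec.span_induct[OF that])
    show "cvec.subspace {S. dom S}" unfolding cvec.subspace_def
    proof (intro conjI ballI allI)
      show "0 \<in> {S. dom S}" by (auto simp: dom_def intro!: exI[of _ "[]"] exI[of _ 0])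
      fix S T :: "'e \<Rightarrow> 'e" and c assume "S \<in> {S. dom S}"
      then obtain ps K where S: "\<forall>(g, gs)\<in>set ps. hom_adj g gs" "0 \<le> K"
        "\<And>x. norm (S x) \<le> K * (\<Sum>(g, gs)\<leftarrow>ps. norm (gs x))" unfolding dom_def by blast
      have "norm ((c *\<^sub>C S) x) \<le> cmod c * K * (\<Sum>(g, gs)\<leftarrow>ps. norm (gs x))" for x
        using S(3)[of x] by (simp add: scaleC_fun_def norm_scaleC mult.assoc mult_left_mono)
      with S(1,2) show "c *\<^sub>C S \<in> {S. dom S}" unfolding dom_def
        by (intro CollectI exI[of _ ps] exI[of _ "cmod c * K"]) auto
      assume "T \<in> {S. dom S}"
      then obtain qs L where T: "\<forall>(g, gs)\<in>set qs. hom_adj g gs" "0 \<le> L"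
        "\<And>x. norm (T x) \<le> L * (\<Sum>(g, gs)\<leftarrow>qs. norm (gs x))" unfolding dom_def by blast
      have "norm ((S + T) x) \<le> (K + L) * (\<Sum>(g, gs)\<leftarrow>ps @ qs. norm (gs x))" for x
      proof -
        have "norm ((S + T) x) \<le> norm (S x) + norm (T x)" by (simp add: norm_triangle_ineq)
        also have "\<dots> \<le> K * (\<Sum>(g, gs)\<leftarrow>ps. norm (gs x)) + L * (\<Sum>(g, gs)\<leftarrow>qs. norm (gs x))"
          by (intro add_mono S T)
        also have "\<dots> \<le> (K + L) * (\<Sum>(g, gs)\<leftarrow>ps. norm (gs x)) + (K + L) * (\<Sum>(g, gs)\<leftarrow>qs. norm (gs x))"
          using S(2) T(2) by (intro add_mono mult_right_mono nonneg) auto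
        finally show ?thesis by (simp add: distrib_left)
      qed
      with S(1,2) T(1,2) show "S + T \<in> {S. dom S}" unfolding dom_def
        by (intro CollectI exI[of _ "ps @ qs"] exI[of _ "K + L"]) auto
    qed
    fix S assume "S \<in> {left_ip E e f | e f. e \<in> hcarrier (Mult_mod E) \<and> f \<in> hcarrier (Mult_mod E)}"
    then obtain t s t' s' where ts: "hom_adj t s" "hom_adj t' s'" "S = left_ip E (emb t) (emb t')"
      unfolding Mult_mod_carrier by blast
    obtain K where K: "0 \<le> K" "\<And>a. norm (t a) \<le> norm a * K"
      using bounded_linear.nonneg_bounded[OF adjoint_pair.bounded_linear[OF hom_pair[OF ts(1)]]] by blast
    show "dom S" unfolding dom_def ts(3) left_ip_eq[OF ts(1,2)]
      using ts(2) K by (intro exI[of _ "[(t', s')]"] exI[of _ K]) (auto simp: mult.commute)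
  qed
  have "id \<in> op_closure E ?Z"
    using full like.EndI[of id id] by (simp add: left_full_def like.is_adjoint_iff)
  then have near: "\<forall>e>0. \<exists>S\<in>?Z. \<forall>x. norm (id x - S x) \<le> e * norm x"
    unfolding like.op_closure_iff by (rule conjunct2)
  have "\<exists>S\<in>?Z. \<forall>x. norm (id x - S x) \<le> 1 / 2 * norm x"
    by (rule near[rule_format]) simp
  then obtain S where S: "S \<in> ?Z" "\<And>x. norm (x - S x) \<le> 1 / 2 * norm x"
    unfolding id_apply by (elim bexE) blast
  obtain ps K where ps: "\<forall>(g, gs)\<in>set ps. hom_adj g gs" "0 \<le> K"
    "\<And>x. norm (S x) \<le> K * (\<Sum>(g, gs)\<leftarrow>ps. norm (gs x))"
    using dom_Z[OF S(1)] unfolding dom_def by blast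
  show ?thesis
  proof (rule exI, rule parseval_of_bounded_below)
    show "hom_adj (fst (ps ! i)) (snd (ps ! i))" if "i < length ps" for i
      using ps(1) nth_mem[OF that] by (auto simp: split_beta)
    show "0 < 1 / (2 * K + 1)" using ps(2) by simp
    fix x
    let ?q = "\<Sum>i<length ps. norm (snd (ps ! i) x)"
    have q: "(\<Sum>(g, gs)\<leftarrow>ps. norm (gs x)) = ?q"
      by (simp add: sum_list_sum_nth split_beta atLeast0LessThan)
    have "norm x \<le> norm (x - S x) + norm (S x)" using norm_triangle_ineq[of "x - S x" "S x"] by simp
    then have "norm x \<le> 2 * (K * ?q)" using S(2)[of x] ps(3)[of x] unfolding q by linarith
    also have "\<dots> \<le> (2 * K + 1) * ?q" by (simp add: algebra_simps sum_nonneg)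
    finally show "1 / (2 * K + 1) * norm x \<le> ?q" using ps(2) by (simp add: divide_le_eq mult.commute)
  qed
qed

text \<open>In \<open>t = \<Sum> g\<^sub>i (g\<^sub>i\<^sup>* t)\<close> the members of the frame may repeat, so the coefficient of a generator is the
  sum over all indices at which it occurs.\<close>

theorem finitely_generated_of_frame:
  assumes fr: "parseval_frame n g gs"
  shows "finitely_generated Mult (hcarrier (Mult_mod E)) (hact (Mult_mod E))"
proof -
  have g: "\<And>i. i < n \<Longrightarrow> hom_adj (g i) (gs i)" using fr by (auto simp: parseval_frame_def)
  have g_hom: "\<And>i. i < n \<Longrightarrow> g i \<in> hom" using g by (auto simp: hom_def)
  define h where "h i = emb (g i)" for i
  have h_eq: "g i = g j" if "i < n" "j < n" "h i = h j" for i j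
    using emb_inject[OF g[OF that(1)] g[OF that(2)]] that(3) by (simp add: h_def)
  show ?thesis unfolding finitely_generated_def
  proof (intro exI[of _ "h ` {..<n}"] conjI ballI)
    show "h ` {..<n} \<subseteq> hcarrier (Mult_mod E)" using emb_carrier[OF g] by (auto simp: h_def)
    fix x assume "x \<in> hcarrier (Mult_mod E)"
    then obtain t s where ts: "hom_adj t s" "x = emb t" unfolding Mult_mod_carrier by blast
    have gt: "gs i \<circ> t \<in> Mult" if "i < n" for i using hom_adj_compose_Mult[OF g[OF that] ts(1)] .
    define c where "c w = (\<Sum>i\<in>{i \<in> {..<n}. h i = w}. gs i \<circ> t)" for w
    have c_M: "c w \<in> Mult" for w unfolding c_def by (intro Mult_sum gt) auto
    have "hact (Mult_mod E) w (c w) = (\<Sum>i\<in>{i \<in> {..<n}. h i = w}. emb (g i \<circ> (gs i \<circ> t)))"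
      if "w \<in> h ` {..<n}" for w
    proof -
      from that obtain j where j: "j < n" "w = h j" by blast
      have "g j \<circ> c w = (\<lambda>a. \<Sum>i\<in>{i \<in> {..<n}. h i = w}. (g i \<circ> (gs i \<circ> t)) a)"
      proof
        fix a
        have "g j (c w a) = (\<Sum>i\<in>{i \<in> {..<n}. h i = w}. g j (gs i (t a)))"
          by (simp add: c_def sum_apply hom_linear(2)[OF g[OF j(1)]])
        also have "\<dots> = (\<Sum>i\<in>{i \<in> {..<n}. h i = w}. (g i \<circ> (gs i \<circ> t)) a)"
        proof (intro sum.cong refl)
          fix i assume "i \<in> {i \<in> {..<n}. h i = w}"
          then have "g i = g j" using h_eq[of i j] j by simp
          then show "g j (gs i (t a)) = (g i \<circ> (gs i \<circ> t)) a" by simp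
        qed
        finally show "(g j \<circ> c w) a = (\<Sum>i\<in>{i \<in> {..<n}. h i = w}. (g i \<circ> (gs i \<circ> t)) a)" by simp
      qed
      moreover have "hact (Mult_mod E) w (c w) = emb (g j \<circ> c w)"
        unfolding j(2) h_def by (rule act_emb[OF g_hom[OF j(1)] c_M])
      ultimately show ?thesis by (simp only: emb_sum)
    qed
    then have "(\<Sum>w\<in>h ` {..<n}. hact (Mult_mod E) w (c w))
        = (\<Sum>w\<in>h ` {..<n}. \<Sum>i\<in>{i \<in> {..<n}. h i = w}. emb (g i \<circ> (gs i \<circ> t)))"
      by (rule sum.cong[OF refl])
    also have "\<dots> = (\<Sum>i<n. emb (g i \<circ> (gs i \<circ> t)))" by (rule sum.group) auto
    also have "\<dots> = emb t" using fr by (simp add: emb_sum[symmetric] parseval_frame_def)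
    finally have "x = (\<Sum>w\<in>h ` {..<n}. hact (Mult_mod E) w (c w))" by (simp add: ts(2))
    then show "\<exists>c. (\<forall>w\<in>h ` {..<n}. c w \<in> Mult) \<and> x = (\<Sum>w\<in>h ` {..<n}. hact (Mult_mod E) w (c w))"
      by (intro exI[of _ c] conjI ballI c_M)
  qed simp
qed

text \<open>Analysis \<open>t \<mapsto> (g\<^sub>i\<^sup>* t)\<^sub>i\<close> followed by synthesis \<open>(c\<^sub>i) \<mapsto> \<Sum> g\<^sub>i c\<^sub>i\<close> is the identity of \<open>Hom(A,E)\<close>. So
  \<open>Hom(A,E)\<close> is isomorphic to the range of the idempotent \<open>analysis \<circ> synthesis\<close> on the free module of
  rank \<open>n\<close>, whose complement is the kernel of synthesis.\<close>

theorem projective_of_frame: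
  assumes fr: "parseval_frame n g gs" and nonzero: "(a0 :: 'a) \<noteq> 0"
  shows "projective Mult (\<circ>) (hcarrier (Mult_mod E)) (hact (Mult_mod E))"
proof -
  have g: "\<And>i. i < n \<Longrightarrow> hom_adj (g i) (gs i)" using fr by (auto simp: parseval_frame_def)
  have rec: "\<And>x. (\<Sum>i<n. g i (gs i x)) = x" using fr by (simp add: parseval_frame_def)
  have gen: "(\<Sum>i<n. g i 0) = 0" using rec[of 0] hom_linear'(5)[OF g] by simp
  \<comment> \<open>The index type is a function space over \<open>'a\<close>, so it has \<open>n\<close> distinct elements.\<close>
  have "infinite (UNIV :: ('e \<times> 'a) set)"
    by (rule infinite_UNIV_of_nonzero[of "(0, a0)"]) (use nonzero in \<open>simp add: zero_prod_def\<close>)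
  moreover have "inj (\<lambda>(x :: 'e \<times> 'a) k z. x)"
    by (rule injI) (drule fun_cong, drule fun_cong)
  ultimately have "infinite (range (\<lambda>x k z. x) :: ('a, 'e) linkmult set)"
    using finite_imageD by blast
  from infinite_arbitrarily_large[OF this, of n]
  obtain I :: "('a, 'e) linkmult set" where I: "finite I" "card I = n" by blast
  obtain \<iota> where \<iota>: "bij_betw \<iota> {..<n} I" using ex_bij_betw_nat_finite[OF I(1)] I(2) by (auto simp: atLeast0LessThan)
  define \<kappa> where "\<kappa> = inv_into {..<n} \<iota>"
  have \<iota>_I: "\<iota> i \<in> I" if "i < n" for i using \<iota> that by (auto simp: bij_betw_def)
  have \<kappa>\<iota>: "\<kappa> (\<iota> i) = i" if "i < n" for i
    using bij_betw_inv_into_left[OF \<iota>, of i] that by (simp add: \<kappa>_def)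
  have \<kappa>_I: "\<kappa> w < n" "\<iota> (\<kappa> w) = w" if "w \<in> I" for w
    using \<iota> that bij_betw_inv_into_right[OF \<iota> that] bij_betw_inv_into[OF \<iota>]
    by (auto simp: \<kappa>_def bij_betw_def)
  define F where "F = free_rmod (Mult :: ('a \<Rightarrow> 'a) set) I"
  have F_iff: "c \<in> F \<longleftrightarrow> (\<forall>w\<in>I. c w \<in> Mult) \<and> (\<forall>w. w \<notin> I \<longrightarrow> c w = 0)" for c
  proof -
    have "finite {w. c w \<noteq> 0}" if "\<forall>w. w \<notin> I \<longrightarrow> c w = 0"
      by (rule finite_subset[OF _ I(1)]) (use that in auto)
    then show ?thesis by (auto simp: F_def free_rmod_def)
  qed
  define fact where "fact = (\<lambda>(c :: ('a, 'e) linkmult \<Rightarrow> 'a \<Rightarrow> 'a) r w. c w \<circ> (r :: 'a \<Rightarrow> 'a))"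
  have F_diff: "c - d \<in> F" if "c \<in> F" "d \<in> F" for c d using that by (simp add: F_iff Mult_diff)
  have F_fact: "fact c r \<in> F" if "c \<in> F" "r \<in> Mult" for c r
    using that by (auto simp: F_iff fact_def Mult_compose fun_eq_iff)
  have F_zero: "0 \<in> F" by (simp add: F_iff Mult_zero)
  define syn where "syn c a = (\<Sum>i<n. g i (c (\<iota> i) a))"
    for c :: "('a, 'e) linkmult \<Rightarrow> 'a \<Rightarrow> 'a" and a
  define ana where "ana t w = (if w \<in> I then gs (\<kappa> w) \<circ> t else 0)" for t :: "'a \<Rightarrow> 'e" and w
  have syn_ana: "syn (ana t) = t" for t
  proof
    fix a
    have "syn (ana t) a = (\<Sum>i<n. g i (gs i (t a)))"
      unfolding syn_def ana_def by (intro sum.cong) (auto simp: \<iota>_I \<kappa>\<iota>)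
    then show "syn (ana t) a = t a" by (simp add: rec)
  qed
  have ana_F: "ana t \<in> F" if "t \<in> hom" for t
    using that hom_adj_compose_Mult[OF g[OF \<kappa>_I(1)]] by (auto simp: F_iff ana_def hom_def)
  have syn_hom: "syn c \<in> hom" if "c \<in> F" for c
  proof -
    have "(\<lambda>a. \<Sum>i\<in>{..<n}. (g i \<circ> c (\<iota> i)) a) \<in> hom"
      by (intro hom_closed(3) hom_closed(2)) (use that g \<iota>_I in \<open>auto simp: hom_def F_iff\<close>)
    then show ?thesis by (simp add: syn_def[abs_def])
  qed
  have syn_diff: "syn (c - d) = (\<lambda>a. syn c a - syn d a)" for c d
    by (simp add: syn_def fun_eq_iff sum_subtractf[symmetric] hom_linear(1)[OF g])
  have syn_fact: "syn (fact c r) = syn c \<circ> r" for c r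
    by (simp add: syn_def fun_eq_iff fact_def)
  have syn_zero: "syn 0 = (\<lambda>a. 0)" by (simp add: syn_def fun_eq_iff gen)
  have ana_add: "ana (\<lambda>a. t a + t' a) = ana t + ana t'" for t t'
    by (auto simp: ana_def fun_eq_iff hom_linear'(1)[OF g[OF \<kappa>_I(1)]])
  have ana_diff: "ana (\<lambda>a. t a - t' a) = ana t - ana t'" for t t'
    by (auto simp: ana_def fun_eq_iff hom_linear'(2)[OF g[OF \<kappa>_I(1)]])
  have ana_fact: "ana (t \<circ> r) = fact (ana t) r" for t r
    by (auto simp: ana_def fun_eq_iff fact_def)
  have ana_zero: "ana (\<lambda>a. 0) = 0"
    by (auto simp: ana_def fun_eq_iff hom_linear'(5)[OF g[OF \<kappa>_I(1)]])
  define P where "P = {c \<in> F. ana (syn c) = c}"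
  define Q where "Q = {c \<in> F. syn c = (\<lambda>a. 0)}"
  have P: "rsubmodule Mult fact P" unfolding rsubmodule_def P_def
    by (auto simp: F_zero F_diff F_fact syn_zero ana_zero syn_diff ana_diff syn_fact ana_fact)
  have Q: "rsubmodule Mult fact Q" unfolding rsubmodule_def Q_def
    by (auto simp: F_zero F_diff F_fact syn_zero syn_diff syn_fact fun_eq_iff)
  have PQ: "P \<inter> Q = {0}"
    by (auto simp: P_def Q_def F_zero syn_zero ana_zero)
  have dec: "\<exists>p\<in>P. \<exists>q\<in>Q. c = p + q" if c: "c \<in> F" for c
  proof (intro bexI)
    show "c = ana (syn c) + (c - ana (syn c))" by simp
    show "ana (syn c) \<in> P" using ana_F[OF syn_hom[OF c]] by (simp add: P_def syn_ana)
    show "c - ana (syn c) \<in> Q"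
      using F_diff[OF c ana_F[OF syn_hom[OF c]]] by (simp add: Q_def syn_diff syn_ana)
  qed
  have iso: "rmod_iso Mult (hcarrier (Mult_mod E)) (hact (Mult_mod E)) P fact"
  proof -
    define dec where "dec = inv_into hom emb"
    have dec: "dec (emb t) = t" if "t \<in> hom" for t
      unfolding dec_def by (rule inv_into_f_f[OF emb_inj_hom that])
    have bij: "bij_betw (ana \<circ> dec) (emb ` hom) P"
    proof (rule bij_betw_byWitness[where f' = "emb \<circ> syn"])
      show "\<forall>e\<in>emb ` hom. (emb \<circ> syn) ((ana \<circ> dec) e) = e" by (auto simp: dec syn_ana)
      show "\<forall>c\<in>P. (ana \<circ> dec) ((emb \<circ> syn) c) = c" by (auto simp: P_def dec syn_hom)
      show "(ana \<circ> dec) ` (emb ` hom) \<subseteq> P" by (auto simp: P_def dec syn_ana ana_F)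
      show "(emb \<circ> syn) ` P \<subseteq> emb ` hom" by (auto simp: P_def syn_hom)
    qed
    have "(ana \<circ> dec) (x + y) = (ana \<circ> dec) x + (ana \<circ> dec) y" if "x \<in> emb ` hom" "y \<in> emb ` hom" for x y
    proof -
      from that obtain t t' where t: "t \<in> hom" "t' \<in> hom" "x = emb t" "y = emb t'" by blast
      then have "x + y = emb (\<lambda>a. t a + t' a)" by (simp add: emb_add)
      then show ?thesis using t by (simp add: dec hom_closed(1) ana_add)
    qed
    moreover have "(ana \<circ> dec) (hact (Mult_mod E) x r) = fact ((ana \<circ> dec) x) r" if "x \<in> emb ` hom" "r \<in> Mult" for x r
      using that by (auto simp: act_emb dec hom_closed(2) ana_fact)
    ultimately show ?thesis unfolding rmod_iso_def Mult_mod_carrier_hom using bij by blast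
  qed
  have "P \<subseteq> F" "Q \<subseteq> F" by (auto simp: P_def Q_def)
  then have "P \<subseteq> F \<and> Q \<subseteq> F \<and> rsubmodule Mult fact P \<and> rsubmodule Mult fact Q \<and> P \<inter> Q = {0} \<and>
      (\<forall>c\<in>F. \<exists>p\<in>P. \<exists>q\<in>Q. c = p + q) \<and>
      rmod_iso Mult (hcarrier (Mult_mod E)) (hact (Mult_mod E)) P fact"
    using P Q PQ dec iso by (intro conjI ballI)
  then show ?thesis
    unfolding projective_def Let_def F_def fact_def by (intro exI)
qed

theorem frame_of_finitely_generated:
  assumes fg: "finitely_generated Mult (hcarrier (Mult_mod E)) (hact (Mult_mod E))"
  shows "\<exists>n g gs. parseval_frame n g gs"
proof -
  from fg obtain G where G: "finite G" "G \<subseteq> hcarrier (Mult_mod E)"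
    "\<And>x. x \<in> hcarrier (Mult_mod E) \<Longrightarrow> \<exists>c. (\<forall>g\<in>G. c g \<in> Mult) \<and> x = (\<Sum>g\<in>G. hact (Mult_mod E) g (c g))"
    unfolding finitely_generated_def by blast
  define n where "n = card G"
  obtain h where h: "bij_betw h {..<n} G"
    using ex_bij_betw_nat_finite[OF G(1)] by (auto simp: n_def atLeast0LessThan)
  have "\<forall>i. \<exists>p. i < n \<longrightarrow> hom_adj (fst p) (snd p) \<and> h i = emb (fst p)"
  proof
    fix i
    show "\<exists>p. i < n \<longrightarrow> hom_adj (fst p) (snd p) \<and> h i = emb (fst p)"
    proof (cases "i < n")
      case True
      then have "h i \<in> hcarrier (Mult_mod E)" using h G(2) by (auto simp: bij_betw_def)
      then show ?thesis unfolding Mult_mod_carrier by auto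
    qed simp
  qed
  from choice[OF this] obtain p where
    p: "\<And>i. i < n \<Longrightarrow> hom_adj (fst (p i)) (snd (p i))" "\<And>i. i < n \<Longrightarrow> h i = emb (fst (p i))" by blast
  have p_hom: "\<And>i. i < n \<Longrightarrow> fst (p i) \<in> hom" using p(1) by (auto simp: hom_def)
  have "\<exists>m. (\<forall>i<n. m i \<in> Mult) \<and> (\<forall>a. t a = (\<Sum>i<n. fst (p i) (m i a)))" if ts: "hom_adj t s" for t s
  proof -
    obtain c where c: "\<forall>w\<in>G. c w \<in> Mult" "emb t = (\<Sum>w\<in>G. hact (Mult_mod E) w (c w))"
      using G(3)[OF emb_carrier[OF ts]] by blast
    have cM: "c (h i) \<in> Mult" if "i < n" for i using c(1) h that by (auto simp: bij_betw_def)
    have "emb t = (\<Sum>i<n. hact (Mult_mod E) (h i) (c (h i)))"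
      unfolding c(2) by (rule sum.reindex_bij_betw[OF h, symmetric])
    also have "\<dots> = (\<Sum>i<n. emb (fst (p i) \<circ> c (h i)))"
    proof (intro sum.cong refl)
      fix i assume "i \<in> {..<n}"
      then have i: "i < n" by simp
      show "hact (Mult_mod E) (h i) (c (h i)) = emb (fst (p i) \<circ> c (h i))"
        by (subst (1) p(2)[OF i]) (rule act_emb[OF p_hom[OF i] cM[OF i]])
    qed
    also have "\<dots> = emb (\<lambda>a. \<Sum>i<n. (fst (p i) \<circ> c (h i)) a)" by (rule emb_sum[symmetric])
    finally have "emb t = emb (\<lambda>a. \<Sum>i<n. (fst (p i) \<circ> c (h i)) a)" .
    moreover have "t \<in> hom" using ts by (auto simp: hom_def)
    moreover have "(\<lambda>a. \<Sum>i<n. (fst (p i) \<circ> c (h i)) a) \<in> hom"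
      by (intro hom_closed(3) hom_closed(2)) (use p_hom cM in auto)
    ultimately have eq: "t = (\<lambda>a. \<Sum>i<n. (fst (p i) \<circ> c (h i)) a)"
      using inj_onD[OF emb_inj_hom] by blast
    show ?thesis
      by (intro exI[of _ "\<lambda>i. c (h i)"] conjI allI impI cM) (auto simp: fun_cong[OF eq])
  qed
  then obtain d where "d > 0" "\<And>x. d * norm x \<le> (\<Sum>i<n. norm (snd (p i) x))"
    using bounded_below_of_generating[of n "\<lambda>i. fst (p i)" "\<lambda>i. snd (p i)"] p(1) by blast
  then show ?thesis
    using parseval_of_bounded_below[of n "\<lambda>i. fst (p i)" "\<lambda>i. snd (p i)" d] p(1) by blast
qed

end

theorem theorem3p1:
  fixes E :: "('a::cstar_algebra, 'e::cbanach) hmod"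
  assumes nonunital: "\<not> unital TYPE('a)"
    and sigma: "sigma_unital TYPE('a)"
    and E: "hilbert_module E"
  defines "cond1 \<equiv> (\<exists>F \<subseteq> (Mult :: ('a \<Rightarrow> 'a) set). finite F \<and>
              finite_projective (cstar_generated (F \<union> range alg_emb)) E)"
    and "cond2 \<equiv> finite_projective Mult E"
    and "cond3 \<equiv> finitely_generated Mult (hcarrier (Mult_mod E)) (hact (Mult_mod E)) \<and>
              projective Mult (\<circ>) (hcarrier (Mult_mod E)) (hact (Mult_mod E))"
    and "cond4 \<equiv> left_full E"
  shows "(cond1 \<longleftrightarrow> cond2) \<and> (cond2 \<longleftrightarrow> cond3) \<and> (cond3 \<longleftrightarrow> cond4)"
proof -
  interpret sigma_unital_module E
    using E sigma by (simp add: sigma_unital_module_def sigma_unital_module_axioms_def)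
  let ?frame = "\<exists>n g gs. parseval_frame n g gs"
  \<comment> \<open>The zero algebra is unital, so \<open>A\<close> is not zero.\<close>
  have "\<exists>a :: 'a. a \<noteq> 0" using nonunital unfolding unital_def by (metis (full_types))
  then obtain a0 :: 'a where a0: "a0 \<noteq> 0" by blast
  have "cond1 \<longleftrightarrow> ?frame" unfolding cond1_def by (rule frame_iff_finite_projective_generated)
  moreover have "cond2 \<longleftrightarrow> ?frame" unfolding cond2_def by (rule frame_iff_finite_projective)
  moreover have "cond3 \<longleftrightarrow> ?frame" unfolding cond3_def
    using finitely_generated_of_frame projective_of_frame[OF _ a0] frame_of_finitely_generated by blast
  moreover have "cond4 \<longleftrightarrow> ?frame" unfolding cond4_def
    using left_full_of_frame frame_of_left_full by blast
  ultimately show ?thesis by blast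
qed

end
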